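(* Let $\mathcal{M}$ be a quasi-free Hilbert module over $A(\mathbb{D}^n)$ of multiplicity $m$, with coordinate multiplication operators $M=(M_{z_1},\dots,M_{z_n})$, and let $\mathcal{H}_k$ be a reproducing kernel Hilbert module over $A(\mathbb{D}^n)$ with (scalar) kernel function $k$. Suppose that $k^{-1}(\boldsymbol{z},\boldsymbol{w})=\sum_{\boldsymbol{k},\boldsymbol{l}}a_{\boldsymbol{k},\boldsymbol{l}}\,\boldsymbol{z}^{\boldsymbol{k}}\bar{\boldsymbol{w}}^{\boldsymbol{l}}$ is a polynomial in $\boldsymbol{z}$ and $\bar{\boldsymbol{w}}$. Then $\mathcal{H}_k\otimes\mathcal{F}$ is a dilation of $\mathcal{M}$ for some Hilbert space $\mathcal{F}$ if and only if $k^{-1}(M,M^* )\ge0$.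
   Context: $A(\mathbb{D}^n)$ is the polydisc algebra (continuous functions on $\overline{\mathbb{D}}^n$ that are holomorphic on $\mathbb{D}^n$, with the sup norm). A Hilbert module over $A(\mathbb{D}^n)$ is a Hilbert space with a unital bounded $A(\mathbb{D}^n)$-module action; module maps are bounded operators intertwining the actions. A reproducing kernel Hilbert module over $A(\mathbb{D}^n)$ is a reproducing kernel Hilbert space of holomorphic functions on $\mathbb{D}^n$ which is a Hilbert module over $A(\mathbb{D}^n)$ under pointwise multiplication; here $\mathcal{H}_k$ consists of scalar functions and $k^{-1}(\boldsymbol{z},\boldsymbol{w})=1/k(\boldsymbol{z},\boldsymbol{w})$. Let $\ell^2_m$ be the $m$-dimensional Hilbert space. A quasi-free Hilbert module of multiplicity (rank) $m$ over $A(\mathbb{D}^n)$ is a Hilbert module obtained as the completion of the algebraic tensor product $A(\mathbb{D}^n)\otimes\ell^2_m$ (viewed as $\ell_m^2$-valued functions) in an inner product such that: (a) the evaluations $f\mapsto f(\boldsymbol{w})\in\ell^2_m$ are bounded, with norms locally uniformly bounded in $\boldsymbol{w}\in\mathbb{D}^n$; (b) pointwise multiplication by elements of $A(\mathbb{D}^n)$ gives a bounded module action; (c) a sequence $\{F_i\}$ in $A(\mathbb{D}^n)\otimes\ell^2_m$ that is Cauchy in norm satisfies $\|F_i\|\to0$ if and only if $F_i(\boldsymbol{w})\to0$ for all $\boldsymbol{w}\in\mathbb{D}^n$. Thus it is a reproducing kernel Hilbert space of holomorphic $\ell^2_m$-valued functions on $\mathbb{D}^n$. $\mathcal{H}_k\otimes\mathcal{F}$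 (with action $f\mapsto M_f\otimes I_{\mathcal{F}}$) is a dilation of $\mathcal{M}$ if there is a co-isometric module map $\pi:\mathcal{H}_k\otimes\mathcal{F}\to\mathcal{M}$. Hereditary functional calculus: for a commuting tuple $T$ and $p(\boldsymbol{z},\bar{\boldsymbol{w}})=\sum a_{\boldsymbol{k},\boldsymbol{l}}\boldsymbol{z}^{\boldsymbol{k}}\bar{\boldsymbol{w}}^{\boldsymbol{l}}$, $p(T,T^* )=\sum a_{\boldsymbol{k},\boldsymbol{l}}T^{\boldsymbol{k}}T^{*\boldsymbol{l}}$ (adjoints on the right), where $T^{\boldsymbol{k}}=T_1^{k_1}\cdots T_n^{k_n}$. So $k^{-1}(M,M^* )=\sum a_{\boldsymbol{k},\boldsymbol{l}}M^{\boldsymbol{k}}M^{*\boldsymbol{l}}$. *)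

theory Defs
  imports "HOL-Analysis.Analysis" "HOL-Library.Function_Algebras"
begin

section \<open>Complex vector spaces\<close>

class scaleC =
  fixes scaleC :: "complex \<Rightarrow> 'a \<Rightarrow> 'a"  (infixr \<open>*\<^sub>C\<close> 75)

class complex_vector = scaleC + ab_group_add +
  assumes scaleC_add_right: "c *\<^sub>C (x + y) = c *\<^sub>C x + c *\<^sub>C y"
    and scaleC_add_left: "(c + d) *\<^sub>C x = c *\<^sub>C x + d *\<^sub>C x"
    and scaleC_scaleC: "c *\<^sub>C (d *\<^sub>C x) = (c * d) *\<^sub>C x"
    and scaleC_one: "1 *\<^sub>C x = x"

instantiation complex :: complex_vector
begin

definition scaleC_complex :: "complex \<Rightarrow> complex \<Rightarrow> complex"
  where "scaleC_complex c x = c * x"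

instance
  by standard (simp_all add: scaleC_complex_def algebra_simps)

end

instantiation "fun" :: (type, complex_vector) complex_vector
begin

definition scaleC_fun :: "complex \<Rightarrow> ('a \<Rightarrow> 'b) \<Rightarrow> 'a \<Rightarrow> 'b"
  where "scaleC_fun c f = (\<lambda>x. c *\<^sub>C f x)"

instance
  by standard
    (simp_all add: scaleC_fun_def plus_fun_def fun_eq_iff
      scaleC_add_right scaleC_add_left scaleC_scaleC scaleC_one)

end

global_interpretation cvec: vector_space "scaleC :: complex \<Rightarrow> 'a \<Rightarrow> 'a::complex_vector"
  by standard (simp_all add: scaleC_add_right scaleC_add_left scaleC_scaleC scaleC_one)


section \<open>Complex Hilbert spaces\<close>

text \<open>
  A Hilbert space is a complex linear subspace of an ambient complex vector space together with an
  inner product of its own, linear in the first argument. Nothing is assumed about the inner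
  product outside of the carrier.
\<close>

record 'a hspace =
  hcarrier :: "'a set"
  hinner :: "'a \<Rightarrow> 'a \<Rightarrow> complex"

definition hnorm :: "'a hspace \<Rightarrow> 'a \<Rightarrow> real"
  where "hnorm H x = sqrt (Re (hinner H x x))"

definition hCauchy :: "'a::complex_vector hspace \<Rightarrow> (nat \<Rightarrow> 'a) \<Rightarrow> bool"
  where "hCauchy H X \<longleftrightarrow> (\<forall>e>0. \<exists>N. \<forall>i\<ge>N. \<forall>j\<ge>N. hnorm H (X i - X j) < e)"

definition hdense :: "'a::complex_vector hspace \<Rightarrow> 'a set \<Rightarrow> bool"
  where "hdense H S \<longleftrightarrow>
    S \<subseteq> hcarrier H \<and> (\<forall>x\<in>hcarrier H. \<forall>e>0. \<exists>y\<in>S. hnorm H (x - y) < e)"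

locale inner_product_space =
  fixes H :: "'a::complex_vector hspace"
  assumes subspace: "cvec.subspace (hcarrier H)"
    and inner_add_left: "\<lbrakk>x \<in> hcarrier H; y \<in> hcarrier H; z \<in> hcarrier H\<rbrakk>
          \<Longrightarrow> hinner H (x + y) z = hinner H x z + hinner H y z"
    and inner_scale_left: "\<lbrakk>x \<in> hcarrier H; y \<in> hcarrier H\<rbrakk>
          \<Longrightarrow> hinner H (c *\<^sub>C x) y = c * hinner H x y"
    and inner_commute: "\<lbrakk>x \<in> hcarrier H; y \<in> hcarrier H\<rbrakk> \<Longrightarrow> hinner H x y = cnj (hinner H y x)"
    and inner_nonneg: "x \<in> hcarrier H \<Longrightarrow> 0 \<le> Re (hinner H x x)"
    and inner_definite: "\<lbrakk>x \<in> hcarrier H; hinner H x x = 0\<rbrakk> \<Longrightarrow> x = 0"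

locale hilbert_space = inner_product_space +
  assumes complete: "\<lbrakk>\<And>i. X i \<in> hcarrier H; hCauchy H X\<rbrakk>
          \<Longrightarrow> \<exists>x\<in>hcarrier H. (\<lambda>i. hnorm H (X i - x)) \<longlonglongrightarrow> 0"

definition linear_op :: "'a::complex_vector hspace \<Rightarrow> 'b::complex_vector hspace \<Rightarrow> ('a \<Rightarrow> 'b) \<Rightarrow> bool"
  where "linear_op H K A \<longleftrightarrow>
    (\<forall>x\<in>hcarrier H. A x \<in> hcarrier K) \<and>
    (\<forall>x\<in>hcarrier H. \<forall>y\<in>hcarrier H. A (x + y) = A x + A y) \<and>
    (\<forall>c. \<forall>x\<in>hcarrier H. A (c *\<^sub>C x) = c *\<^sub>C A x)"

definition bounded_op :: "'a::complex_vector hspace \<Rightarrow> 'b::complex_vector hspace \<Rightarrow> ('a \<Rightarrow> 'b) \<Rightarrow> bool"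
  where "bounded_op H K A \<longleftrightarrow>
    linear_op H K A \<and> (\<exists>C. \<forall>x\<in>hcarrier H. hnorm K (A x) \<le> C * hnorm H x)"

text \<open>Only meaningful for bounded operators between Hilbert spaces and for \<open>y\<close> in the carrier of \<open>K\<close>.\<close>

definition hadj :: "'a::complex_vector hspace \<Rightarrow> 'b::complex_vector hspace \<Rightarrow> ('a \<Rightarrow> 'b) \<Rightarrow> 'b \<Rightarrow> 'a"
  where "hadj H K A y =
    (THE x. x \<in> hcarrier H \<and> (\<forall>u\<in>hcarrier H. hinner K (A u) y = hinner H u x))"

definition coisometry :: "'a::complex_vector hspace \<Rightarrow> 'b::complex_vector hspace \<Rightarrow> ('a \<Rightarrow> 'b) \<Rightarrow> bool"
  where "coisometry H K A \<longleftrightarrow> bounded_op H K A \<and> (\<forall>y\<in>hcarrier K. A (hadj H K A y) = y)"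

definition positive_op :: "'a::complex_vector hspace \<Rightarrow> ('a \<Rightarrow> 'a) \<Rightarrow> bool"
  where "positive_op H A \<longleftrightarrow>
    (\<forall>x\<in>hcarrier H. hinner H (A x) x \<in> \<real> \<and> 0 \<le> Re (hinner H (A x) x))"

locale hilbert_completion =
  V: inner_product_space V + H: hilbert_space H
  for V :: "'v::complex_vector hspace" and H :: "'a::complex_vector hspace" +
  fixes \<iota> :: "'v \<Rightarrow> 'a"
  assumes linear: "linear_op V H \<iota>"
    and isometric: "\<lbrakk>f \<in> hcarrier V; g \<in> hcarrier V\<rbrakk> \<Longrightarrow> hinner H (\<iota> f) (\<iota> g) = hinner V f g"
    and dense_image: "hdense H (\<iota> ` hcarrier V)"

text \<open>
  A Hilbert space tensor product of \<open>H\<close> and \<open>F\<close>: a Hilbert space \<open>T\<close> which, along the bilinear map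
  \<open>t\<close>, is the completion of the algebraic tensor product in the inner product
  \<open>\<langle>h \<otimes> x, g \<otimes> y\<rangle> = \<langle>h, g\<rangle> \<langle>x, y\<rangle>\<close>. It is determined by \<open>H\<close> and \<open>F\<close> up to a unique unitary
  that respects elementary tensors.
\<close>

locale hilbert_tensor_product =
  H: hilbert_space H + F: hilbert_space F + T: hilbert_space T
  for H :: "'h::complex_vector hspace" and F :: "'f::complex_vector hspace"
    and T :: "'t::complex_vector hspace" +
  fixes t :: "'h \<Rightarrow> 'f \<Rightarrow> 't"
  assumes linear_left: "x \<in> hcarrier F \<Longrightarrow> linear_op H T (\<lambda>h. t h x)"
    and linear_right: "h \<in> hcarrier H \<Longrightarrow> linear_op F T (t h)"
    and inner_tensor: "\<lbrakk>h \<in> hcarrier H; g \<in> hcarrier H; x \<in> hcarrier F; y \<in> hcarrier F\<rbrakk>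
          \<Longrightarrow> hinner T (t h x) (t g y) = hinner H h g * hinner F x y"
    and total: "hdense T (cvec.span {t h x |h x. h \<in> hcarrier H \<and> x \<in> hcarrier F})"

text \<open>The Hilbert space \<open>\<ell>\<^sup>2\<close> on the index type \<open>'m\<close>; its dimension is the number of elements of \<open>'m\<close>.\<close>

definition ell2 :: "('m \<Rightarrow> complex) hspace"
  where "ell2 = \<lparr>hcarrier = {v. (\<lambda>i. (cmod (v i))\<^sup>2) summable_on UNIV},
                hinner = (\<lambda>u v. \<Sum>\<^sub>\<infinity>i. u i * cnj (v i))\<rparr>"


section \<open>The polydisc algebra\<close>

definition polydisc :: "(complex ^ 'n) set"
  where "polydisc = {z. \<forall>i. cmod (z $ i) < 1}"

definition cpolydisc :: "(complex ^ 'n) set"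
  where "cpolydisc = {z. \<forall>i. cmod (z $ i) \<le> 1}"

definition holomorphic_cvec :: "(complex ^ 'n \<Rightarrow> complex) \<Rightarrow> (complex ^ 'n) set \<Rightarrow> bool"
  where "holomorphic_cvec f S \<longleftrightarrow>
    (\<forall>z\<in>S. \<exists>f'. (f has_derivative f') (at z) \<and> (\<forall>c v. f' (c *s v) = c * f' v))"

text \<open>
  A function on the closed polydisc is represented by its extension by zero, so that elements of
  the algebra are equal as soon as they agree on the closed polydisc.
\<close>

definition polydisc_algebra :: "(complex ^ 'n \<Rightarrow> complex) set"
  where "polydisc_algebra =
    {f. continuous_on cpolydisc f \<and> holomorphic_cvec f polydisc \<and> (\<forall>z. z \<notin> cpolydisc \<longrightarrow> f z = 0)}"

definition polydisc_norm :: "(complex ^ 'n \<Rightarrow> complex) \<Rightarrow> real"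
  where "polydisc_norm f = (SUP z\<in>cpolydisc. cmod (f z))"

definition polydisc_one :: "complex ^ 'n \<Rightarrow> complex"
  where "polydisc_one z = (if z \<in> cpolydisc then 1 else 0)"

definition coord :: "'n \<Rightarrow> complex ^ 'n \<Rightarrow> complex"
  where "coord i z = (if z \<in> cpolydisc then z $ i else 0)"

text \<open>The algebraic tensor product of the polydisc algebra with \<open>\<ell>\<^sup>2\<close>, as vector-valued functions.\<close>

definition polydisc_tensor :: "(complex ^ 'n \<Rightarrow> 'm \<Rightarrow> complex) set"
  where "polydisc_tensor =
    cvec.span {(\<lambda>z. \<phi> z *\<^sub>C v) |\<phi> v. \<phi> \<in> polydisc_algebra \<and> v \<in> hcarrier ell2}"


section \<open>Hilbert modules over the polydisc algebra\<close>

locale hilbert_module = hilbert_space M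
  for M :: "'a::complex_vector hspace" +
  fixes act :: "(complex ^ 'n \<Rightarrow> complex) \<Rightarrow> 'a \<Rightarrow> 'a"
  assumes act_linear: "\<phi> \<in> polydisc_algebra \<Longrightarrow> linear_op M M (act \<phi>)"
    and act_add: "\<lbrakk>\<phi> \<in> polydisc_algebra; \<psi> \<in> polydisc_algebra; x \<in> hcarrier M\<rbrakk>
          \<Longrightarrow> act (\<phi> + \<psi>) x = act \<phi> x + act \<psi> x"
    and act_scale: "\<lbrakk>\<phi> \<in> polydisc_algebra; x \<in> hcarrier M\<rbrakk> \<Longrightarrow> act (c *\<^sub>C \<phi>) x = c *\<^sub>C act \<phi> x"
    and act_mult: "\<lbrakk>\<phi> \<in> polydisc_algebra; \<psi> \<in> polydisc_algebra; x \<in> hcarrier M\<rbrakk>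
          \<Longrightarrow> act (\<phi> * \<psi>) x = act \<phi> (act \<psi> x)"
    and act_one: "x \<in> hcarrier M \<Longrightarrow> act polydisc_one x = x"
    and act_bounded: "\<exists>C. \<forall>\<phi>\<in>polydisc_algebra. \<forall>x\<in>hcarrier M.
          hnorm M (act \<phi> x) \<le> C * polydisc_norm \<phi> * hnorm M x"

definition module_map ::
  "'a::complex_vector hspace \<Rightarrow> ((complex ^ 'n \<Rightarrow> complex) \<Rightarrow> 'a \<Rightarrow> 'a) \<Rightarrow>
   'b::complex_vector hspace \<Rightarrow> ((complex ^ 'n \<Rightarrow> complex) \<Rightarrow> 'b \<Rightarrow> 'b) \<Rightarrow> ('a \<Rightarrow> 'b) \<Rightarrow> bool"
  where "module_map M act N act' \<pi> \<longleftrightarrow>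
    bounded_op M N \<pi> \<and>
    (\<forall>\<phi>\<in>polydisc_algebra. \<forall>x\<in>hcarrier M. \<pi> (act \<phi> x) = act' \<phi> (\<pi> x))"

text \<open>
  A Hilbert space of holomorphic functions on the open polydisc (extended by zero) that is a Hilbert
  module under pointwise multiplication and has reproducing kernel \<open>k\<close>. The values of \<open>k\<close> outside
  of the polydisc are irrelevant.
\<close>

locale rk_hilbert_module =
  hilbert_module H "\<lambda>\<phi> h. \<phi> * h"
  for H :: "(complex ^ 'n \<Rightarrow> complex) hspace" +
  fixes k :: "complex ^ 'n \<Rightarrow> complex ^ 'n \<Rightarrow> complex"
  assumes holomorphic: "h \<in> hcarrier H \<Longrightarrow> holomorphic_cvec h polydisc"
    and zero_outside: "\<lbrakk>h \<in> hcarrier H; z \<notin> polydisc\<rbrakk> \<Longrightarrow> h z = 0"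
    and kernel_in: "w \<in> polydisc \<Longrightarrow> (\<lambda>z. if z \<in> polydisc then k z w else 0) \<in> hcarrier H"
    and reproducing: "\<lbrakk>h \<in> hcarrier H; w \<in> polydisc\<rbrakk>
          \<Longrightarrow> h w = hinner H h (\<lambda>z. if z \<in> polydisc then k z w else 0)"

text \<open>
  \<open>Q\<close> is the algebraic tensor product with the inner product in which \<open>M\<close> is its completion. The
  multiplicity is the number of elements of \<open>'m\<close>, which may be finite or countably infinite.
\<close>

locale quasi_free_module =
  hilbert_completion Q M \<iota> + hilbert_module M act
  for Q :: "(complex ^ 'n \<Rightarrow> 'm::countable \<Rightarrow> complex) hspace"
    and M :: "'a::complex_vector hspace"
    and act :: "(complex ^ 'n \<Rightarrow> complex) \<Rightarrow> 'a \<Rightarrow> 'a"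
    and \<iota> :: "(complex ^ 'n \<Rightarrow> 'm \<Rightarrow> complex) \<Rightarrow> 'a" +
  assumes carrier_eq: "hcarrier Q = polydisc_tensor"
    and eval_bounded: "w \<in> polydisc \<Longrightarrow>
          \<exists>U C. open U \<and> w \<in> U \<and> U \<subseteq> polydisc \<and>
            (\<forall>z\<in>U. \<forall>f\<in>polydisc_tensor. hnorm ell2 (f z) \<le> C * hnorm Q f)"
    and act_pointwise: "\<lbrakk>\<phi> \<in> polydisc_algebra; f \<in> polydisc_tensor\<rbrakk>
          \<Longrightarrow> act \<phi> (\<iota> f) = \<iota> (\<lambda>z. \<phi> z *\<^sub>C f z)"
    and null_iff: "\<lbrakk>\<And>i. X i \<in> polydisc_tensor; hCauchy Q X\<rbrakk> \<Longrightarrow>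
          (\<lambda>i. hnorm Q (X i)) \<longlonglongrightarrow> 0 \<longleftrightarrow> (\<forall>w\<in>polydisc. (\<lambda>i. hnorm ell2 (X i w)) \<longlonglongrightarrow> 0)"


section \<open>Dilations\<close>

text \<open>The action \<open>\<phi> \<mapsto> M\<^sub>\<phi> \<otimes> I\<close> on the tensor product.\<close>

definition tensor_action ::
  "(complex ^ 'n \<Rightarrow> complex) hspace \<Rightarrow> 'f::complex_vector hspace \<Rightarrow> 't::complex_vector hspace \<Rightarrow>
   ((complex ^ 'n \<Rightarrow> complex) \<Rightarrow> 'f \<Rightarrow> 't) \<Rightarrow> ((complex ^ 'n \<Rightarrow> complex) \<Rightarrow> 't \<Rightarrow> 't) \<Rightarrow> bool"
  where "tensor_action H F T t actT \<longleftrightarrow>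
    (\<forall>\<phi>\<in>polydisc_algebra. bounded_op T T (actT \<phi>) \<and>
      (\<forall>h\<in>hcarrier H. \<forall>x\<in>hcarrier F. actT \<phi> (t h x) = t (\<phi> * h) x))"

definition is_dilation ::
  "(complex ^ 'n \<Rightarrow> complex) hspace \<Rightarrow> 'f::complex_vector hspace \<Rightarrow> 't::complex_vector hspace \<Rightarrow>
   ((complex ^ 'n \<Rightarrow> complex) \<Rightarrow> 'f \<Rightarrow> 't) \<Rightarrow>
   'a::complex_vector hspace \<Rightarrow> ((complex ^ 'n \<Rightarrow> complex) \<Rightarrow> 'a \<Rightarrow> 'a) \<Rightarrow> bool"
  where "is_dilation H F T t M act \<longleftrightarrow>
    hilbert_tensor_product H F T t \<and>
    (\<exists>actT \<pi>. tensor_action H F T t actT \<and> module_map T actT M act \<pi> \<and> coisometry T M \<pi>)"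

text \<open>
  A formula cannot quantify over types, so the types that carry \<open>F\<close> and its tensor product with \<open>H\<close>
  are parameters. To express existence of some \<open>F\<close>, use sufficiently large types in positive position
  and arbitrary types in negative position.
\<close>

definition has_dilation ::
  "'f::complex_vector itself \<Rightarrow> 't::complex_vector itself \<Rightarrow> (complex ^ 'n \<Rightarrow> complex) hspace \<Rightarrow>
   'a::complex_vector hspace \<Rightarrow> ((complex ^ 'n \<Rightarrow> complex) \<Rightarrow> 'a \<Rightarrow> 'a) \<Rightarrow> bool"
  where "has_dilation _ _ H M act \<longleftrightarrow>
    (\<exists>(F :: 'f hspace) (T :: 't hspace) t. is_dilation H F T t M act)"


section \<open>Hereditary functional calculus\<close>

text \<open>
  The coefficients of a polynomial in \<open>z\<close> and the conjugate of \<open>w\<close> form a finitely supported family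
  indexed by pairs of multi-indices.
\<close>

definition multi_power :: "complex ^ 'n \<Rightarrow> ('n \<Rightarrow> nat) \<Rightarrow> complex"
  where "multi_power z p = (\<Prod>i\<in>UNIV. (z $ i) ^ p i)"

definition hereditary_poly ::
  "(('n \<Rightarrow> nat) \<Rightarrow> ('n \<Rightarrow> nat) \<Rightarrow> complex) \<Rightarrow> complex ^ 'n \<Rightarrow> complex ^ 'n \<Rightarrow> complex"
  where "hereditary_poly a z w =
    (\<Sum>(p, q)\<in>{(p, q). a p q \<noteq> 0}. a p q * multi_power z p * cnj (multi_power w q))"

text \<open>\<open>T\<^sub>1\<^bsup>p\<^sub>1\<^esup> \<cdots> T\<^sub>n\<^bsup>p\<^sub>n\<^esup>\<close>; the factors are composed in the order of the index type.\<close>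

definition op_power :: "('n::{finite,linorder} \<Rightarrow> 'a \<Rightarrow> 'a) \<Rightarrow> ('n \<Rightarrow> nat) \<Rightarrow> 'a \<Rightarrow> 'a"
  where "op_power T p = foldr (\<lambda>i S. (T i ^^ p i) \<circ> S) (sorted_list_of_set UNIV) id"

definition hereditary_op ::
  "'a::complex_vector hspace \<Rightarrow> (('n::{finite,linorder} \<Rightarrow> nat) \<Rightarrow> ('n \<Rightarrow> nat) \<Rightarrow> complex) \<Rightarrow>
   ('n \<Rightarrow> 'a \<Rightarrow> 'a) \<Rightarrow> 'a \<Rightarrow> 'a"
  where "hereditary_op H a T x =
    (\<Sum>(p, q)\<in>{(p, q). a p q \<noteq> 0}.
      a p q *\<^sub>C op_power T p (op_power (\<lambda>i. hadj H H (T i)) q x))"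

end

theory Submission
  imports Defs
begin

text \<open>
  Evaluating at a point \<open>w\<close> and taking the \<open>j\<close>-th coordinate gives vectors \<open>e (w, j)\<close> of the
  quasi-free module \<open>M\<close> that are total and satisfy
  \<open>act \<phi>\<^sup>* e (w, j) = cnj (\<phi> w) e (w, j)\<close>; so \<open>M\<close> may be treated by means of the scalar kernel
  \<open>K p q = \<langle>e p, e q\<rangle>\<close>. For \<open>D = k\<^sup>-\<^sup>1(M, M\<^sup>*)\<close> this yields
  \<open>\<langle>D e p, e q\<rangle> = K p q / k\<close>. If \<open>D\<close> is positive, then \<open>L = K / k\<close> is the kernel of a Hilbert space
  \<open>F\<close>, and \<open>K\<close> is the restriction to the diagonal of the kernel \<open>k L\<close> of \<open>H \<otimes> F\<close>; restriction to
  the diagonal is the coisometry. Conversely \<open>k\<^sup>-\<^sup>1\<close> applied to \<open>H \<otimes> F\<close> is the projection onto the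
  constants tensored with the identity, and its compression to \<open>M\<close> is \<open>D\<close>.
\<close>

section \<open>Semi-inner product spaces\<close>

text \<open>In the hereditary calculus the adjoints act first, so between two joint eigenvectors of
  the adjoints it collapses to the scalar polynomial. Hence identities are tested against a total
  family of kernel vectors, and the decisive operators are not given by formulas but obtained from
  their matrix entries by Riesz representation. What must be supplied each time is a norm bound, and
  that bound is the positivity of some kernel: Schur products give it for
  \<open>h \<otimes> f\<close> and for \<open>A \<otimes> I\<close>. Such kernels may be degenerate,
  which is why definiteness is split off from the inner product axioms. Both spaces of the dilation
  must live in types fixed in advance: \<open>F\<close> is realised by functions of
  \<open>(w, j)\<close>, the tensor product by functions of \<open>(z, w, j)\<close>, and the
  diagonal is \<open>z = w\<close>. The converse faces an arbitrary tensor product in an arbitrary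
  type, so only the inner products of elementary tensors and their density are available; the
  vectors \<open>t (kernel z) x\<close> then replace kernel functions. That \<open>H\<close>
  contains the constants at all is a consequence of the inverse kernel being a polynomial.\<close>

locale semi_inner_product_space =
  fixes H :: "'a::complex_vector hspace"
  assumes carrier_subspace: "cvec.subspace (hcarrier H)"
    and ip_add_left: "\<lbrakk>x \<in> hcarrier H; y \<in> hcarrier H; z \<in> hcarrier H\<rbrakk>
          \<Longrightarrow> hinner H (x + y) z = hinner H x z + hinner H y z"
    and ip_scale_left: "\<lbrakk>x \<in> hcarrier H; y \<in> hcarrier H\<rbrakk>
          \<Longrightarrow> hinner H (c *\<^sub>C x) y = c * hinner H x y"
    and ip_commute: "\<lbrakk>x \<in> hcarrier H; y \<in> hcarrier H\<rbrakk> \<Longrightarrow> hinner H x y = cnj (hinner H y x)"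
    and ip_nonneg: "x \<in> hcarrier H \<Longrightarrow> 0 \<le> Re (hinner H x x)"
begin

lemma zero_in [simp]: "0 \<in> hcarrier H"
  and add_in [simp]: "\<lbrakk>x \<in> hcarrier H; y \<in> hcarrier H\<rbrakk> \<Longrightarrow> x + y \<in> hcarrier H"
  and diff_in [simp]: "\<lbrakk>x \<in> hcarrier H; y \<in> hcarrier H\<rbrakk> \<Longrightarrow> x - y \<in> hcarrier H"
  and scale_in [simp]: "x \<in> hcarrier H \<Longrightarrow> c *\<^sub>C x \<in> hcarrier H"
  and sum_in: "(\<And>i. i \<in> A \<Longrightarrow> f i \<in> hcarrier H) \<Longrightarrow> sum f A \<in> hcarrier H"
  using carrier_subspace
  by (auto intro: cvec.subspace_0 cvec.subspace_add cvec.subspace_diff cvec.subspace_scale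
      cvec.subspace_sum)

lemma ip_zero_left [simp]: "y \<in> hcarrier H \<Longrightarrow> hinner H 0 y = 0"
  using ip_scale_left[of 0 y 0] by simp

lemma ip_zero_right [simp]: "y \<in> hcarrier H \<Longrightarrow> hinner H y 0 = 0"
  using ip_commute[of y 0] by simp

lemma ip_diff_left:
  assumes "x \<in> hcarrier H" "y \<in> hcarrier H" "z \<in> hcarrier H"
  shows "hinner H (x - y) z = hinner H x z - hinner H y z"
  using ip_add_left[of "x - y" y z] assms by simp

lemma ip_add_right:
  assumes "x \<in> hcarrier H" "y \<in> hcarrier H" "z \<in> hcarrier H"
  shows "hinner H z (x + y) = hinner H z x + hinner H z y"
  using assms by (simp add: ip_commute[of z] ip_add_left)

lemma ip_diff_right:
  assumes "x \<in> hcarrier H" "y \<in> hcarrier H" "z \<in> hcarrier H"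
  shows "hinner H z (x - y) = hinner H z x - hinner H z y"
  using assms by (simp add: ip_commute[of z] ip_diff_left)

lemma ip_scale_right:
  assumes "x \<in> hcarrier H" "y \<in> hcarrier H"
  shows "hinner H y (c *\<^sub>C x) = cnj c * hinner H y x"
  using assms by (simp add: ip_commute[of y] ip_scale_left)

lemma ip_sum_left:
  assumes "\<And>i. i \<in> A \<Longrightarrow> f i \<in> hcarrier H" "y \<in> hcarrier H"
  shows "hinner H (sum f A) y = (\<Sum>i\<in>A. hinner H (f i) y)"
  using assms by (induction A rule: infinite_finite_induct) (auto simp: ip_add_left sum_in)

lemma ip_sum_right:
  assumes "\<And>i. i \<in> A \<Longrightarrow> f i \<in> hcarrier H" "y \<in> hcarrier H"
  shows "hinner H y (sum f A) = (\<Sum>i\<in>A. hinner H y (f i))"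
  using assms by (induction A rule: infinite_finite_induct) (auto simp: ip_add_right sum_in)

lemma norm_nonneg [simp]: "x \<in> hcarrier H \<Longrightarrow> 0 \<le> hnorm H x"
  by (simp add: hnorm_def ip_nonneg)

lemma norm_zero [simp]: "hnorm H 0 = 0"
  by (simp add: hnorm_def)

lemma norm_sq: "x \<in> hcarrier H \<Longrightarrow> (hnorm H x)\<^sup>2 = Re (hinner H x x)"
  by (simp add: hnorm_def ip_nonneg)

lemma ip_self:
  assumes "x \<in> hcarrier H"
  shows "hinner H x x = complex_of_real ((hnorm H x)\<^sup>2)"
  using ip_commute[OF assms assms] by (simp add: norm_sq[OF assms] complex_eq_iff)

text \<open>The squared norm as a quadratic function of \<open>c\<close>: Cauchy-Schwarz, the
  parallelogram identity and the variation in \<open>riesz_factor\<close> all come from choices of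
  \<open>c\<close>.\<close>

lemma norm_sq_add_scale:
  assumes "x \<in> hcarrier H" "y \<in> hcarrier H"
  shows "(hnorm H (x + c *\<^sub>C y))\<^sup>2
    = (hnorm H x)\<^sup>2 + 2 * Re (c * hinner H y x) + (cmod c)\<^sup>2 * (hnorm H y)\<^sup>2"
proof -
  have "hinner H (x + c *\<^sub>C y) (x + c *\<^sub>C y)
      = hinner H x x + (c * hinner H y x + cnj (c * hinner H y x)) + c * cnj c * hinner H y y"
    using assms ip_commute[of x y]
    by (simp add: ip_add_left ip_add_right ip_scale_left ip_scale_right algebra_simps)
  moreover have "c * cnj c = complex_of_real ((cmod c)\<^sup>2)"
    by (simp only: complex_norm_square)
  ultimately have "hinner H (x + c *\<^sub>C y) (x + c *\<^sub>C y)
      = hinner H x x + (c * hinner H y x + cnj (c * hinner H y x))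
        + complex_of_real ((cmod c)\<^sup>2) * complex_of_real ((hnorm H y)\<^sup>2)"
    using assms by (simp only: ip_self[of y])
  then show ?thesis
    using assms by (simp add: norm_sq[of "x + c *\<^sub>C y"] norm_sq[of x] del: of_real_power)
qed

lemma norm_scale:
  assumes "x \<in> hcarrier H"
  shows "hnorm H (c *\<^sub>C x) = cmod c * hnorm H x"
proof -
  have "(hnorm H (c *\<^sub>C x))\<^sup>2 = (cmod c * hnorm H x)\<^sup>2"
    using norm_sq_add_scale[of 0 x c] assms by (simp add: power_mult_distrib)
  then show ?thesis
    using assms by (simp add: power2_eq_iff_nonneg)
qed

lemma norm_minus_commute:
  assumes "x \<in> hcarrier H" "y \<in> hcarrier H"
  shows "hnorm H (x - y) = hnorm H (y - x)"
  using norm_scale[of "x - y" "-1"] assms by simp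

text \<open>The form may be degenerate, so \<open>hnorm H y = 0\<close> does not make
  \<open>y\<close> zero. In that case the quadratic in \<open>s\<close> is affine, and it stays
  nonnegative only if \<open>b = 0\<close>.\<close>

lemma cauchy_schwarz:
  assumes x: "x \<in> hcarrier H" and y: "y \<in> hcarrier H"
  shows "cmod (hinner H x y) \<le> hnorm H x * hnorm H y"
proof -
  define b where "b = hinner H y x"
  have key: "0 \<le> (hnorm H x)\<^sup>2 - 2 * s * (cmod b)\<^sup>2 + s\<^sup>2 * (cmod b)\<^sup>2 * (hnorm H y)\<^sup>2" for s :: real
  proof -
    have "(hnorm H (x + (- of_real s * cnj b) *\<^sub>C y))\<^sup>2
        = (hnorm H x)\<^sup>2 - 2 * s * (cmod b)\<^sup>2 + s\<^sup>2 * (cmod b)\<^sup>2 * (hnorm H y)\<^sup>2"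
    proof -
      have "Re (- of_real s * cnj b * b) = - s * (cmod b)\<^sup>2"
        unfolding cmod_power2 by (simp add: power2_eq_square algebra_simps)
      moreover have "(cmod (- of_real s * cnj b))\<^sup>2 = s\<^sup>2 * (cmod b)\<^sup>2"
        by (simp add: norm_mult power_mult_distrib)
      ultimately show ?thesis
        unfolding norm_sq_add_scale[OF x y] b_def[symmetric] by simp
    qed
    then show ?thesis
      by (metis zero_le_power2)
  qed
  have "(cmod b)\<^sup>2 \<le> (hnorm H x)\<^sup>2 * (hnorm H y)\<^sup>2"
  proof (cases "(hnorm H y)\<^sup>2 = 0")
    case True
    have "(cmod b)\<^sup>2 \<le> 0"
    proof (rule ccontr)
      assume "\<not> (cmod b)\<^sup>2 \<le> 0"
      \<comment> \<open>This \<open>s\<close> turns the affine expression into -1.\<close>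
      then show False
        using key[of "((hnorm H x)\<^sup>2 + 1) / (2 * (cmod b)\<^sup>2)"] True by (simp add: field_simps)
    qed
    then show ?thesis
      using True by simp
  next
    case False
    then have pos: "(hnorm H y)\<^sup>2 > 0"
      by simp
    \<comment> \<open>\<open>1 / Y\<close> is the minimiser of the quadratic in
      \<open>s\<close>.\<close>
    have "0 \<le> X - B / Y" if "0 \<le> X - 2 * (1 / Y) * B + (1 / Y)\<^sup>2 * B * Y" "Y > 0" for X Y B :: real
      using that by (simp add: power2_eq_square)
    from this[OF key pos] have "0 \<le> (hnorm H x)\<^sup>2 - (cmod b)\<^sup>2 / (hnorm H y)\<^sup>2" .
    then show ?thesis
      using pos by (simp add: field_simps)
  qed
  then have "cmod b \<le> hnorm H x * hnorm H y"
    using x y by (simp flip: power_mult_distrib)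
  then show ?thesis
    using ip_commute[OF x y] by (simp add: b_def)
qed

lemma norm_triangle:
  assumes x: "x \<in> hcarrier H" and y: "y \<in> hcarrier H"
  shows "hnorm H (x + y) \<le> hnorm H x + hnorm H y"
proof -
  have "(hnorm H (x + y))\<^sup>2 = (hnorm H x)\<^sup>2 + 2 * Re (hinner H y x) + (hnorm H y)\<^sup>2"
    using norm_sq_add_scale[OF x y, of 1] by (simp add: scaleC_one)
  moreover have "Re (hinner H y x) \<le> hnorm H y * hnorm H x"
    using cauchy_schwarz[OF y x] complex_Re_le_cmod order_trans by blast
  ultimately have "(hnorm H (x + y))\<^sup>2 \<le> (hnorm H x + hnorm H y)\<^sup>2"
    by (simp add: power2_sum mult.commute)
  then show ?thesis
    using x y by (meson add_nonneg_nonneg norm_nonneg power2_le_imp_le)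
qed

lemma norm_triangle_diff:
  assumes "x \<in> hcarrier H" "y \<in> hcarrier H" "z \<in> hcarrier H"
  shows "hnorm H (x - z) \<le> hnorm H (x - y) + hnorm H (y - z)"
  using norm_triangle[of "x - y" "y - z"] assms by simp

lemma ip_tendsto_left:
  assumes "\<And>n. X n \<in> hcarrier H" "x \<in> hcarrier H" "y \<in> hcarrier H"
    and lim: "(\<lambda>n. hnorm H (X n - x)) \<longlonglongrightarrow> 0"
  shows "(\<lambda>n. hinner H (X n) y) \<longlonglongrightarrow> hinner H x y"
proof -
  have "(\<lambda>n. hnorm H (X n - x) * hnorm H y) \<longlonglongrightarrow> 0"
    using tendsto_mult_left_zero[OF lim] .
  then have "(\<lambda>n. hinner H (X n - x) y) \<longlonglongrightarrow> 0"
    by (rule Lim_null_comparison[rotated]) (use assms in \<open>simp add: cauchy_schwarz\<close>)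
  then show ?thesis
    using assms by (simp add: ip_diff_left LIM_zero_iff)
qed

text \<open>Shaped for minimising sequences: if the \<open>n\<close>-th value is within
  \<open>inverse (Suc n)\<close> of the infimum, the parallelogram identity delivers exactly such a
  bound on squared distances.\<close>

lemma CauchyI_inv_Suc:
  assumes X: "\<And>n. X n \<in> hcarrier H" and C: "0 \<le> C"
    and le: "\<And>i j. (hnorm H (X i - X j))\<^sup>2 \<le> C * (inverse (Suc i) + inverse (Suc j))"
  shows "hCauchy H X"
  unfolding hCauchy_def
proof (intro allI impI)
  fix e :: real
  assume e: "e > 0"
  have "(\<lambda>n. C * (inverse (real (Suc n)) + inverse (real (Suc n)))) \<longlonglongrightarrow> C * (0 + 0)"
    by (intro tendsto_intros LIMSEQ_inverse_real_of_nat)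
  then have "\<forall>\<^sub>F n in sequentially. C * (inverse (real (Suc n)) + inverse (real (Suc n))) < e\<^sup>2"
    using e by (intro order_tendstoD) auto
  then obtain N where N: "C * (inverse (real (Suc N)) + inverse (real (Suc N))) < e\<^sup>2"
    by (meson eventually_sequentially order_refl)
  show "\<exists>N. \<forall>i\<ge>N. \<forall>j\<ge>N. hnorm H (X i - X j) < e"
  proof (intro exI allI impI)
    fix i j
    assume "N \<le> i" "N \<le> j"
    then have "C * (inverse (real (Suc i)) + inverse (real (Suc j)))
        \<le> C * (inverse (real (Suc N)) + inverse (real (Suc N)))"
      using C by (intro mult_left_mono add_mono le_imp_inverse_le) auto
    then have "(hnorm H (X i - X j))\<^sup>2 < e\<^sup>2"
      using le[of i j] N by linarith
    then show "hnorm H (X i - X j) < e"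
      using e by (simp add: power_less_imp_less_base)
  qed
qed

end

sublocale inner_product_space \<subseteq> semi_inner_product_space
  using subspace inner_add_left inner_scale_left inner_commute inner_nonneg
  by unfold_locales

context inner_product_space
begin

lemma norm_eq_zero:
  assumes "x \<in> hcarrier H" "hnorm H x = 0"
  shows "x = 0"
  using assms inner_definite[of x] by (simp add: ip_self)

lemma eqI_ip_diff:
  assumes "x \<in> hcarrier H" "y \<in> hcarrier H" "\<And>z. z \<in> hcarrier H \<Longrightarrow> hinner H z x = hinner H z y"
  shows "x = y"
proof -
  have "hinner H (x - y) (x - y) = 0"
    using assms by (simp add: ip_diff_right)
  then show ?thesis
    using inner_definite[of "x - y"] assms by simp
qed

end

section \<open>Riesz representation by minimisation\<close>

context hilbert_space
begin

text \<open>
  Minimise \<open>\<parallel>A v\<parallel>\<^sup>2 - 2 Re (\<phi> v)\<close>: by the parallelogram identity the images of a minimising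
  sequence are Cauchy, and their limit represents \<open>\<phi>\<close>.
\<close>

theorem riesz_factor:
  fixes S :: "'v::complex_vector set"
  assumes S: "cvec.subspace S"
    and A_in: "\<And>v. v \<in> S \<Longrightarrow> A v \<in> hcarrier H"
    and A_add: "\<And>v w. \<lbrakk>v \<in> S; w \<in> S\<rbrakk> \<Longrightarrow> A (v + w) = A v + A w"
    and A_scale: "\<And>c v. v \<in> S \<Longrightarrow> A (c *\<^sub>C v) = c *\<^sub>C A v"
    and \<phi>_add: "\<And>v w. \<lbrakk>v \<in> S; w \<in> S\<rbrakk> \<Longrightarrow> \<phi> (v + w) = \<phi> v + \<phi> w"
    and \<phi>_scale: "\<And>c v. v \<in> S \<Longrightarrow> \<phi> (c *\<^sub>C v) = c * \<phi> v"
    and bound: "\<And>v. v \<in> S \<Longrightarrow> cmod (\<phi> v) \<le> C * hnorm H (A v)"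
  shows "\<exists>y\<in>hcarrier H. (\<forall>v\<in>S. \<phi> v = hinner H (A v) y) \<and> (0 \<le> C \<longrightarrow> hnorm H y \<le> C)"
proof -
  \<comment> \<open>Only the images \<open>A v\<close> are measured: \<open>S\<close> has no norm of
    its own and \<open>A\<close> may have a kernel, so \<open>S\<close> can consist of formal
    combinations or of the functions of a dense subspace.\<close>
  define J where "J v = (hnorm H (A v))\<^sup>2 - 2 * Re (\<phi> v)" for v
  have S_add: "v + w \<in> S" and S_scale: "c *\<^sub>C v \<in> S" if "v \<in> S" "w \<in> S" for v w c
    using S that by (auto intro: cvec.subspace_add cvec.subspace_scale)
  have S0: "0 \<in> S"
    using S by (rule cvec.subspace_0)
  \<comment> \<open>Completing the square in \<open>hnorm H (A v) - C\<close>.\<close>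
  have J_lower: "- C\<^sup>2 \<le> J v" if "v \<in> S" for v
  proof -
    have "Re (\<phi> v) \<le> C * hnorm H (A v)"
      using bound[OF that] complex_Re_le_cmod order_trans by blast
    moreover have "0 \<le> (hnorm H (A v) - C)\<^sup>2"
      by simp
    ultimately show ?thesis
      by (simp add: J_def power2_diff algebra_simps)
  qed
  define m where "m = Inf (J ` S)"
  have bdd: "bdd_below (J ` S)"
    using J_lower by (auto simp: bdd_below_def)
  have m_le: "m \<le> J v" if "v \<in> S" for v
    unfolding m_def using bdd that by (simp add: cINF_lower)
  have "\<exists>v\<in>S. J v < m + inverse (Suc n)" for n
  proof -
    have "Inf (J ` S) < m + inverse (real (Suc n))"
      unfolding m_def[symmetric] by simp
    then show ?thesis
      using cInf_lessD[of "J ` S"] S0 by fastforce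
  qed
  then obtain v where v: "\<And>n. v n \<in> S" and Jv: "\<And>n. J (v n) < m + inverse (Suc n)"
    by metis
  have "(hnorm H (A (v i) - A (v j)))\<^sup>2 \<le> 2 * (inverse (Suc i) + inverse (Suc j))" for i j
  proof -
    let ?w = "(1/2) *\<^sub>C (v i + v j)"
    have w: "?w \<in> S"
      using v by (intro S_scale S_add)
    have "Re (\<phi> ?w) = (Re (\<phi> (v i)) + Re (\<phi> (v j))) / 2"
      using v by (simp add: \<phi>_scale \<phi>_add S_add)
    moreover have "A ?w = (1/2) *\<^sub>C (A (v i) + 1 *\<^sub>C A (v j))"
      using v by (simp add: A_scale A_add S_add scaleC_one)
    then have "4 * (hnorm H (A ?w))\<^sup>2 = (hnorm H (A (v i) + 1 *\<^sub>C A (v j)))\<^sup>2"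
      using v A_in by (simp add: norm_scale power_mult_distrib power2_eq_square)
    moreover have "(hnorm H (A (v i) + (-1) *\<^sub>C A (v j)))\<^sup>2 + (hnorm H (A (v i) + 1 *\<^sub>C A (v j)))\<^sup>2
        = 2 * (hnorm H (A (v i)))\<^sup>2 + 2 * (hnorm H (A (v j)))\<^sup>2"
      using v A_in norm_sq_add_scale[of "A (v i)" "A (v j)" 1]
        norm_sq_add_scale[of "A (v i)" "A (v j)" "-1"] by simp
    \<comment> \<open>The midpoint \<open>?w\<close> is admissible, so \<open>J ?w\<close> is at
      least \<open>m\<close>; the values \<open>J (v i)\<close> and \<open>J (v j)\<close> close to
      \<open>m\<close> then force the images together.\<close>
    ultimately have "(hnorm H (A (v i) + (-1) *\<^sub>C A (v j)))\<^sup>2 = 2 * J (v i) + 2 * J (v j) - 4 * J ?w"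
      by (simp add: J_def)
    then show ?thesis
      using m_le[OF w] Jv[of i] Jv[of j] by simp
  qed
  then have "hCauchy H (\<lambda>n. A (v n))"
    using v A_in by (intro CauchyI_inv_Suc[where C = 2]) auto
  then obtain y where y: "y \<in> hcarrier H" and lim: "(\<lambda>n. hnorm H (A (v n) - y)) \<longlonglongrightarrow> 0"
    using complete[of "\<lambda>n. A (v n)"] v A_in by blast
  have limit_ip: "(\<lambda>n. hinner H (A (v n)) x) \<longlonglongrightarrow> hinner H y x" if "x \<in> hcarrier H" for x
    using v A_in y that lim by (intro ip_tendsto_left) auto
  have rep: "\<phi> w = hinner H (A w) y" if w: "w \<in> S" for w
  proof -
    define d where "d = hinner H (A w) y - \<phi> w"
    \<comment> \<open>First variation: moving \<open>v n\<close> by \<open>c *\<^sub>C w\<close>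
      cannot take \<open>J\<close> below \<open>m\<close>, while \<open>J (v n)\<close> exceeds
      \<open>m\<close> by less than \<open>inverse (Suc n)\<close>; let \<open>n\<close>
      grow.\<close>
    have quad: "0 \<le> 2 * Re (c * d) + (cmod c)\<^sup>2 * (hnorm H (A w))\<^sup>2" for c
    proof -
      have "- inverse (Suc n) \<le> 2 * Re (c * cnj (hinner H (A (v n)) (A w)) - c * \<phi> w)
          + (cmod c)\<^sup>2 * (hnorm H (A w))\<^sup>2" for n
      proof -
        have "m \<le> J (v n + c *\<^sub>C w)"
          using v w by (intro m_le S_add S_scale) auto
        also have "\<dots> = J (v n) + 2 * Re (c * hinner H (A w) (A (v n)) - c * \<phi> w)
            + (cmod c)\<^sup>2 * (hnorm H (A w))\<^sup>2"
          using v[of n] w S_scale[OF w w] A_in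
          by (simp add: J_def A_add A_scale \<phi>_add \<phi>_scale norm_sq_add_scale algebra_simps)
        also have "hinner H (A w) (A (v n)) = cnj (hinner H (A (v n)) (A w))"
          using v w A_in by (intro ip_commute) auto
        finally show ?thesis
          using Jv[of n] by linarith
      qed
      moreover have "(\<lambda>n. 2 * Re (c * cnj (hinner H (A (v n)) (A w)) - c * \<phi> w)
          + (cmod c)\<^sup>2 * (hnorm H (A w))\<^sup>2) \<longlonglongrightarrow>
          2 * Re (c * cnj (hinner H y (A w)) - c * \<phi> w) + (cmod c)\<^sup>2 * (hnorm H (A w))\<^sup>2"
        using w A_in by (intro tendsto_intros limit_ip) auto
      moreover have "(\<lambda>n. - inverse (real (Suc n))) \<longlonglongrightarrow> - 0"
        by (intro tendsto_minus LIMSEQ_inverse_real_of_nat)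
      ultimately have "- 0 \<le> 2 * Re (c * cnj (hinner H y (A w)) - c * \<phi> w)
          + (cmod c)\<^sup>2 * (hnorm H (A w))\<^sup>2"
        by (intro tendsto_le[OF sequentially_bot]) auto
      also have "cnj (hinner H y (A w)) = hinner H (A w) y"
        using w A_in y ip_commute by metis
      finally show ?thesis
        by (simp add: d_def algebra_simps)
    qed
    \<comment> \<open>The summand 1 keeps \<open>K\<close> positive when \<open>A w = 0\<close>.
      Testing \<open>quad\<close> at \<open>c = - cnj d / K\<close> and multiplying by
      \<open>K\<^sup>2\<close> leaves \<open>- (K + 1) * (cmod d)\<^sup>2\<close> as a nonnegative
      number.\<close>
    define K where "K = (hnorm H (A w))\<^sup>2 + 1"
    have K: "K \<ge> 1"
      by (simp add: K_def)
    have "Re (- (of_real (1 / K) * cnj d) * d) = - (1 / K) * (cmod d)\<^sup>2"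
      unfolding cmod_power2 by (simp add: power2_eq_square add_divide_distrib)
    then have "0 \<le> - 2 * (1 / K) * (cmod d)\<^sup>2 + (1 / K)\<^sup>2 * (cmod d)\<^sup>2 * (K - 1)"
      using quad[of "- (of_real (1 / K) * cnj d)"] K
      by (simp add: norm_mult norm_divide power_mult_distrib power_divide K_def[symmetric])
        (simp add: K_def)
    then have "0 \<le> K\<^sup>2 * (- 2 * (1 / K) * (cmod d)\<^sup>2 + (1 / K)\<^sup>2 * (cmod d)\<^sup>2 * (K - 1))"
      by simp
    also have "\<dots> = - (K + 1) * (cmod d)\<^sup>2"
      using K by (simp add: power2_eq_square field_simps)
    finally have "(K + 1) * (cmod d)\<^sup>2 \<le> 0"
      by (simp add: algebra_simps)
    then have "(cmod d)\<^sup>2 \<le> 0"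
      using K by (simp add: mult_le_0_iff)
    then show ?thesis
      by (simp add: d_def)
  qed
  \<comment> \<open>The vector \<open>y\<close> is a limit of images and need not be one itself, so
    the bound on \<open>\<phi>\<close> is carried over to it along \<open>A (v n)\<close>.\<close>
  have "hnorm H y \<le> C" if C: "0 \<le> C"
  proof -
    have "(\<lambda>n. C * (hnorm H (A (v n) - y) + hnorm H y)) \<longlonglongrightarrow> C * (0 + hnorm H y)"
      by (intro tendsto_intros lim)
    moreover have "(\<lambda>n. cmod (hinner H (A (v n)) y)) \<longlonglongrightarrow> cmod (hinner H y y)"
      using y by (intro tendsto_intros limit_ip)
    moreover have "cmod (hinner H (A (v n)) y) \<le> C * (hnorm H (A (v n) - y) + hnorm H y)" for n
    proof -
      have "cmod (hinner H (A (v n)) y) \<le> C * hnorm H (A (v n))"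
        using rep[OF v] bound[OF v] by metis
      also have "hnorm H (A (v n)) \<le> hnorm H (A (v n) - y) + hnorm H y"
        using norm_triangle[of "A (v n) - y" y] v A_in y by simp
      finally show ?thesis
        using C by (simp add: mult_left_mono)
    qed
    ultimately have "cmod (hinner H y y) \<le> C * (0 + hnorm H y)"
      by (intro tendsto_le[OF sequentially_bot]) auto
    then have "hnorm H y * hnorm H y \<le> C * hnorm H y"
      using y by (simp add: ip_self power2_eq_square norm_mult)
    then show ?thesis
      using C y norm_nonneg[of y] by (smt (verit) mult_right_le_imp_le)
  qed
  with rep y show ?thesis
    by blast
qed

end

section \<open>Bounded operators and adjoints\<close>

lemma bounded_op_in: "bounded_op H K A \<Longrightarrow> x \<in> hcarrier H \<Longrightarrow> A x \<in> hcarrier K"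
  and bounded_op_add:
    "\<lbrakk>bounded_op H K A; x \<in> hcarrier H; y \<in> hcarrier H\<rbrakk> \<Longrightarrow> A (x + y) = A x + A y"
  and bounded_op_scale: "bounded_op H K A \<Longrightarrow> x \<in> hcarrier H \<Longrightarrow> A (c *\<^sub>C x) = c *\<^sub>C A x"
  by (auto simp: bounded_op_def linear_op_def)

lemma bounded_op_norm:
  assumes "inner_product_space H" "bounded_op H K A"
  obtains C where "0 \<le> C" "\<And>x. x \<in> hcarrier H \<Longrightarrow> hnorm K (A x) \<le> C * hnorm H x"
proof -
  interpret H: inner_product_space H by fact
  obtain C where C: "\<And>x. x \<in> hcarrier H \<Longrightarrow> hnorm K (A x) \<le> C * hnorm H x"
    using assms by (auto simp: bounded_op_def)
  have "hnorm K (A x) \<le> \<bar>C\<bar> * hnorm H x" if "x \<in> hcarrier H" for x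
    using C[OF that] mult_right_mono[of C "\<bar>C\<bar>" "hnorm H x"] that by fastforce
  then show thesis
    by (intro that[of "\<bar>C\<bar>"]) auto
qed

text \<open>\<open>riesz_factor\<close> with \<open>A = id\<close> on the whole carrier gives
  existence; uniqueness makes the definite description in \<open>hadj\<close> meaningful.\<close>

lemma adjoint_ex1:
  assumes "hilbert_space H" "hilbert_space K" and A: "bounded_op H K A" and y: "y \<in> hcarrier K"
  shows "\<exists>!x. x \<in> hcarrier H \<and> (\<forall>u\<in>hcarrier H. hinner K (A u) y = hinner H u x)"
proof -
  interpret H: hilbert_space H by fact
  interpret K: hilbert_space K by fact
  obtain C where C: "0 \<le> C" "\<And>x. x \<in> hcarrier H \<Longrightarrow> hnorm K (A x) \<le> C * hnorm H x"
    using bounded_op_norm[OF H.inner_product_space_axioms A] by metis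
  have "\<exists>x\<in>hcarrier H. (\<forall>u\<in>hcarrier H. hinner K (A u) y = hinner H (id u) x)
      \<and> (0 \<le> C * hnorm K y \<longrightarrow> hnorm H x \<le> C * hnorm K y)"
  proof (rule H.riesz_factor)
    show "cmod (hinner K (A u) y) \<le> C * hnorm K y * hnorm H (id u)" if u: "u \<in> hcarrier H" for u
    proof -
      have "cmod (hinner K (A u) y) \<le> hnorm K (A u) * hnorm K y"
        using u y bounded_op_in[OF A] by (intro K.cauchy_schwarz)
      also have "\<dots> \<le> C * hnorm H u * hnorm K y"
        using C(2)[OF u] y by (intro mult_right_mono) auto
      finally show ?thesis
        by (simp add: mult_ac)
    qed
  qed (use y in \<open>auto simp: H.carrier_subspace bounded_op_in[OF A] bounded_op_add[OF A]
      bounded_op_scale[OF A] K.ip_add_left K.ip_scale_left\<close>)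
  then show ?thesis
    by (auto intro!: H.eqI_ip_diff)
qed

lemma
  assumes "hilbert_space H" "hilbert_space K" "bounded_op H K A" "y \<in> hcarrier K"
  shows hadj_in: "hadj H K A y \<in> hcarrier H"
    and ip_hadj_right: "u \<in> hcarrier H \<Longrightarrow> hinner H u (hadj H K A y) = hinner K (A u) y"
proof -
  have "hadj H K A y \<in> hcarrier H \<and> (\<forall>u\<in>hcarrier H. hinner K (A u) y = hinner H u (hadj H K A y))"
    unfolding hadj_def by (rule theI') (rule adjoint_ex1[OF assms])
  then show "hadj H K A y \<in> hcarrier H"
    and "u \<in> hcarrier H \<Longrightarrow> hinner H u (hadj H K A y) = hinner K (A u) y"
    by auto
qed

lemma ip_hadj_left:
  assumes "hilbert_space H" "hilbert_space K" "bounded_op H K A" "y \<in> hcarrier K" "u \<in> hcarrier H"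
  shows "hinner H (hadj H K A y) u = hinner K y (A u)"
proof -
  interpret H: hilbert_space H by fact
  interpret K: hilbert_space K by fact
  show ?thesis
    using H.ip_commute[of "hadj H K A y" u] K.ip_commute[of y "A u"] assms
    by (simp add: hadj_in ip_hadj_right bounded_op_in)
qed

lemma hadj_norm_le:
  assumes "hilbert_space H" "hilbert_space K" "bounded_op H K A" "y \<in> hcarrier K"
    and C: "0 \<le> C" "\<And>x. x \<in> hcarrier H \<Longrightarrow> hnorm K (A x) \<le> C * hnorm H x"
  shows "hnorm H (hadj H K A y) \<le> C * hnorm K y"
proof -
  interpret H: hilbert_space H by fact
  interpret K: hilbert_space K by fact
  let ?x = "hadj H K A y"
  have x: "?x \<in> hcarrier H"
    by (rule hadj_in[OF assms(1-4)])
  have "hnorm H ?x * hnorm H ?x = cmod (hinner K (A ?x) y)"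
    unfolding ip_hadj_right[OF assms(1-4) x, symmetric]
    using x by (simp add: H.ip_self power2_eq_square norm_mult)
  also have "\<dots> \<le> hnorm K (A ?x) * hnorm K y"
    by (intro K.cauchy_schwarz bounded_op_in[OF assms(3) x] assms(4))
  also have "\<dots> \<le> C * hnorm H ?x * hnorm K y"
    using C(2)[OF x] assms(4) by (intro mult_right_mono) auto
  finally have "hnorm H ?x * hnorm H ?x \<le> (C * hnorm K y) * hnorm H ?x"
    by (simp add: mult_ac)
  then show ?thesis
    using C(1) x assms(4) H.norm_nonneg[OF x] K.norm_nonneg[OF assms(4)]
    by (smt (verit) mult_nonneg_nonneg mult_right_le_imp_le)
qed

lemma bounded_hadj:
  assumes "hilbert_space H" "hilbert_space K" and A: "bounded_op H K A"
  shows "bounded_op K H (hadj H K A)"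
proof -
  interpret H: hilbert_space H by fact
  interpret K: hilbert_space K by fact
  note adj_in = hadj_in[OF assms] and ip_adj = ip_hadj_right[OF assms]
  obtain C where C: "0 \<le> C" "\<And>x. x \<in> hcarrier H \<Longrightarrow> hnorm K (A x) \<le> C * hnorm H x"
    using bounded_op_norm[OF H.inner_product_space_axioms A] by metis
  show ?thesis
    unfolding bounded_op_def linear_op_def
  proof (intro conjI ballI allI exI)
    show "hadj H K A (x + y) = hadj H K A x + hadj H K A y"
      if "x \<in> hcarrier K" "y \<in> hcarrier K" for x y
      using that bounded_op_in[OF A]
      by (intro H.eqI_ip_diff) (simp_all add: adj_in ip_adj H.ip_add_right K.ip_add_right)
    show "hadj H K A (c *\<^sub>C x) = c *\<^sub>C hadj H K A x" if "x \<in> hcarrier K" for c x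
      using that bounded_op_in[OF A]
      by (intro H.eqI_ip_diff) (simp_all add: adj_in ip_adj H.ip_scale_right K.ip_scale_right)
    show "hnorm H (hadj H K A x) \<le> C * hnorm K x" if "x \<in> hcarrier K" for x
      by (rule hadj_norm_le[OF assms that C])
  qed (rule adj_in)
qed

section \<open>Finitely supported coefficients\<close>

definition fsupp :: "('x \<Rightarrow> complex) set"
  where "fsupp = {c. finite {x. c x \<noteq> 0}}"

text \<open>A \<open>sum\<close> over an infinite support is 0, which is why additivity is stated on
  \<open>fsupp\<close>.\<close>

definition lincomb :: "('x \<Rightarrow> 'a::complex_vector) \<Rightarrow> ('x \<Rightarrow> complex) \<Rightarrow> 'a"
  where "lincomb e c = (\<Sum>x | c x \<noteq> 0. c x *\<^sub>C e x)"

definition single :: "'x \<Rightarrow> 'x \<Rightarrow> complex"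
  where "single x = (\<lambda>y. if y = x then 1 else 0)"

text \<open>The inner product that formal combinations must carry if \<open>\<kappa>\<close> is to
  be the Gram matrix of the basis vectors \<open>single x\<close>.\<close>

definition gram_form :: "('x \<Rightarrow> 'x \<Rightarrow> complex) \<Rightarrow> ('x \<Rightarrow> complex) \<Rightarrow> ('x \<Rightarrow> complex) \<Rightarrow> complex"
  where "gram_form \<kappa> c d = (\<Sum>x | c x \<noteq> 0. \<Sum>y | d y \<noteq> 0. c x * cnj (d y) * \<kappa> x y)"

lemma lincomb_eq:
  assumes "finite A" "\<And>x. c x \<noteq> 0 \<Longrightarrow> x \<in> A"
  shows "lincomb e c = (\<Sum>x\<in>A. c x *\<^sub>C e x)"
  unfolding lincomb_def using assms by (intro sum.mono_neutral_left) auto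

lemma single_fsupp [simp]: "single x \<in> fsupp"
  by (simp add: fsupp_def single_def)

lemma lincomb_single [simp]: "lincomb e (single x) = e x"
  by (simp add: lincomb_def single_def scaleC_one)

lemma subspace_fsupp: "cvec.subspace fsupp"
proof (rule cvec.subspaceI)
  show "c + d \<in> fsupp" if "c \<in> fsupp" "d \<in> fsupp" for c d :: "'x \<Rightarrow> complex"
  proof -
    have "{x. (c + d) x \<noteq> 0} \<subseteq> {x. c x \<noteq> 0} \<union> {x. d x \<noteq> 0}"
      by (auto simp: plus_fun_def)
    then show ?thesis
      using that by (auto simp: fsupp_def intro: finite_subset)
  qed
  show "a *\<^sub>C c \<in> fsupp" if "c \<in> fsupp" for a and c :: "'x \<Rightarrow> complex"
  proof -
    have "{x. (a *\<^sub>C c) x \<noteq> 0} \<subseteq> {x. c x \<noteq> 0}"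
      by (auto simp: scaleC_fun_def scaleC_complex_def)
    then show ?thesis
      using that by (auto simp: fsupp_def intro: finite_subset)
  qed
qed (simp add: fsupp_def zero_fun_def)

lemma fsupp_diff [simp]: "\<lbrakk>c \<in> fsupp; d \<in> fsupp\<rbrakk> \<Longrightarrow> c - d \<in> fsupp"
  by (rule cvec.subspace_diff[OF subspace_fsupp])

lemma lincomb_add:
  assumes "c \<in> fsupp" "d \<in> fsupp"
  shows "lincomb e (c + d) = lincomb e c + lincomb e d"
proof -
  let ?A = "{x. c x \<noteq> 0} \<union> {x. d x \<noteq> 0}"
  have "finite ?A"
    using assms by (simp add: fsupp_def)
  then show ?thesis
    using lincomb_eq[of ?A c e] lincomb_eq[of ?A d e] lincomb_eq[of ?A "c + d" e]
    by (fastforce simp: plus_fun_def scaleC_add_left sum.distrib)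
qed

lemma lincomb_scale:
  assumes "c \<in> fsupp"
  shows "lincomb e (a *\<^sub>C c) = a *\<^sub>C lincomb e c"
proof -
  let ?A = "{x. c x \<noteq> 0}"
  have "finite ?A"
    using assms by (simp add: fsupp_def)
  then show ?thesis
    using lincomb_eq[of ?A "a *\<^sub>C c" e]
    by (auto simp: lincomb_def[of e c] scaleC_fun_def scaleC_complex_def scaleC_scaleC cvec.scale_sum_right)
qed

text \<open>As two nested combinations the form inherits its linearity from
  \<open>lincomb\<close>.\<close>

lemma gram_form_lincomb:
  "gram_form \<kappa> c d = lincomb (\<lambda>x. cnj (lincomb (\<lambda>y. cnj (\<kappa> x y)) d)) c"
  by (simp add: gram_form_def lincomb_def scaleC_complex_def sum_distrib_left mult_ac)

lemma gram_form_single: "gram_form \<kappa> c (single y) = lincomb (\<lambda>x. \<kappa> x y) c"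
  by (simp add: gram_form_lincomb)

context semi_inner_product_space
begin

lemma lincomb_in:
  assumes "\<And>x. e x \<in> hcarrier H"
  shows "lincomb e c \<in> hcarrier H"
  unfolding lincomb_def by (intro sum_in scale_in assms)

lemma ip_lincomb_left:
  assumes "\<And>x. e x \<in> hcarrier H" "y \<in> hcarrier H"
  shows "hinner H (lincomb e c) y = lincomb (\<lambda>x. hinner H (e x) y) c"
  using assms by (simp add: lincomb_def ip_sum_left ip_scale_left scaleC_complex_def)

lemma ip_lincomb_right:
  assumes "\<And>x. e x \<in> hcarrier H" "y \<in> hcarrier H"
  shows "hinner H y (lincomb e c) = cnj (lincomb (\<lambda>x. hinner H (e x) y) c)"
  using assms ip_commute[of y] by (simp add: lincomb_in ip_lincomb_left)

lemma ip_lincomb: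
  assumes "\<And>x. e x \<in> hcarrier H" "\<And>x. g x \<in> hcarrier H"
  shows "hinner H (lincomb e c) (lincomb g d) = gram_form (\<lambda>x y. hinner H (e x) (g y)) c d"
proof -
  have "(\<lambda>x. hinner H (e x) (lincomb g d)) = (\<lambda>x. cnj (lincomb (\<lambda>y. cnj (hinner H (e x) (g y))) d))"
    by (simp only: ip_lincomb_right[OF assms(2,1)] ip_commute[OF assms(2,1), symmetric])
  then show ?thesis
    unfolding gram_form_lincomb by (simp only: ip_lincomb_left[OF assms(1) lincomb_in[OF assms(2)]])
qed

end

text \<open>Norms of combinations depend on the Gram matrix alone. By this principle
  \<open>e x \<mapsto> g x\<close> is isometric on combinations as soon as the inner products
  match.\<close>

lemma norm_lincomb_eq:
  assumes "semi_inner_product_space H" "semi_inner_product_space K"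
    and "\<And>x. e x \<in> hcarrier H" "\<And>x. g x \<in> hcarrier K"
    and "\<And>x y. hinner H (e x) (e y) = hinner K (g x) (g y)"
  shows "hnorm H (lincomb e c) = hnorm K (lincomb g c)"
  using assms semi_inner_product_space.ip_lincomb[of H e e c c]
    semi_inner_product_space.ip_lincomb[of K g g c c]
  by (simp add: hnorm_def)

section \<open>Total families\<close>

text \<open>Totality is phrased through the orthogonal complement, so that inner products with the
  family act as coordinates: \<open>eqI\<close> compares vectors without any approximation.\<close>

locale total_family = hilbert_space H for H :: "'a::complex_vector hspace" +
  fixes e :: "'x \<Rightarrow> 'a"
  assumes family_in [simp]: "e x \<in> hcarrier H"
    and orthogonal_zero: "\<lbrakk>f \<in> hcarrier H; \<And>x. hinner H f (e x) = 0\<rbrakk> \<Longrightarrow> f = 0"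
begin

lemma eqI:
  assumes "f \<in> hcarrier H" "g \<in> hcarrier H" "\<And>x. hinner H f (e x) = hinner H g (e x)"
  shows "f = g"
  using orthogonal_zero[of "f - g"] assms by (simp add: ip_diff_left)

lemma eqI':
  assumes "f \<in> hcarrier H" "g \<in> hcarrier H" "\<And>x. hinner H (e x) f = hinner H (e x) g"
  shows "f = g"
proof (rule eqI)
  show "hinner H f (e x) = hinner H g (e x)" for x
    using assms(3)[of x] ip_commute[OF assms(1), of "e x"] ip_commute[OF assms(2), of "e x"] by simp
qed (use assms in auto)

text \<open>A moment problem, solved by \<open>riesz_factor\<close> with
  \<open>A = lincomb e\<close> on \<open>fsupp\<close>. The conjugates appear because
  \<open>e x\<close> stands in the antilinear argument of \<open>hinner H y (e x)\<close>.\<close>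

lemma represent:
  assumes "0 \<le> C"
    and bound: "\<And>c. c \<in> fsupp \<Longrightarrow> cmod (lincomb (\<lambda>x. cnj (b x)) c) \<le> C * hnorm H (lincomb e c)"
  shows "\<exists>y\<in>hcarrier H. (\<forall>x. hinner H y (e x) = b x) \<and> hnorm H y \<le> C"
proof -
  have "\<exists>y\<in>hcarrier H. (\<forall>c\<in>fsupp. lincomb (\<lambda>x. cnj (b x)) c = hinner H (lincomb e c) y)
      \<and> (0 \<le> C \<longrightarrow> hnorm H y \<le> C)"
    by (rule riesz_factor)
      (auto simp: subspace_fsupp lincomb_in lincomb_add lincomb_scale scaleC_complex_def bound)
  then obtain y where y: "y \<in> hcarrier H" "hnorm H y \<le> C"
    "\<And>c. c \<in> fsupp \<Longrightarrow> lincomb (\<lambda>x. cnj (b x)) c = hinner H (lincomb e c) y"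
    using assms(1) by blast
  have "hinner H y (e x) = b x" for x
    using y(3)[of "single x"] ip_commute[of y "e x"] y(1) by simp (metis complex_cnj_cnj)
  then show ?thesis
    using y by blast
qed

text \<open>The operator below is the adjoint of \<open>e x \<mapsto> g x\<close>.\<close>

lemma coefficient_operator:
  assumes "hilbert_space T" and g: "\<And>x. g x \<in> hcarrier T" and C: "0 \<le> C"
    and bound: "\<And>c. c \<in> fsupp \<Longrightarrow> hnorm T (lincomb g c) \<le> C * hnorm H (lincomb e c)"
  shows "\<exists>B. bounded_op T H B \<and> (\<forall>u\<in>hcarrier T. \<forall>x. hinner H (B u) (e x) = hinner T u (g x))"
proof -
  interpret T: hilbert_space T by fact
  have "\<exists>y\<in>hcarrier H. (\<forall>x. hinner H y (e x) = hinner T u (g x)) \<and> hnorm H y \<le> C * hnorm T u"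
    if u: "u \<in> hcarrier T" for u
  proof (rule represent)
    fix c :: "'x \<Rightarrow> complex"
    assume c: "c \<in> fsupp"
    have "lincomb (\<lambda>x. cnj (hinner T u (g x))) c = hinner T (lincomb g c) u"
      using u g T.ip_commute[of _ u] by (simp add: T.ip_lincomb_left)
    also have "cmod \<dots> \<le> hnorm T (lincomb g c) * hnorm T u"
      using u g by (intro T.cauchy_schwarz T.lincomb_in)
    also have "\<dots> \<le> C * hnorm H (lincomb e c) * hnorm T u"
      using bound[OF c] u by (intro mult_right_mono) auto
    finally show "cmod (lincomb (\<lambda>x. cnj (hinner T u (g x))) c) \<le> C * hnorm T u * hnorm H (lincomb e c)"
      by (simp add: mult_ac)
  qed (use u C in auto)
  then obtain B where B: "\<And>u. u \<in> hcarrier T \<Longrightarrow> B u \<in> hcarrier H"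
    "\<And>u x. u \<in> hcarrier T \<Longrightarrow> hinner H (B u) (e x) = hinner T u (g x)"
    "\<And>u. u \<in> hcarrier T \<Longrightarrow> hnorm H (B u) \<le> C * hnorm T u"
    by metis
  have "B (u + v) = B u + B v" if "u \<in> hcarrier T" "v \<in> hcarrier T" for u v
    using that B g by (intro eqI) (auto simp: ip_add_left T.ip_add_left)
  moreover have "B (a *\<^sub>C u) = a *\<^sub>C B u" if "u \<in> hcarrier T" for u a
    using that B g by (intro eqI) (auto simp: ip_scale_left T.ip_scale_left)
  ultimately have "bounded_op T H B"
    using B unfolding bounded_op_def linear_op_def by blast
  then show ?thesis
    using B by blast
qed

end

section \<open>Schur products\<close>

text \<open>
  Induction on the number of vectors: splitting off the components along the last \<open>h\<close> reduces the
  form to one with fewer vectors plus the square of a norm.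
\<close>

lemma schur_product:
  assumes "semi_inner_product_space H" "semi_inner_product_space F" "finite A"
    and "\<And>i. i \<in> A \<Longrightarrow> h i \<in> hcarrier H" "\<And>i. i \<in> A \<Longrightarrow> f i \<in> hcarrier F"
  shows "0 \<le> Re (\<Sum>i\<in>A. \<Sum>j\<in>A. hinner H (h i) (h j) * hinner F (f i) (f j))"
  using assms(3-)
proof (induction A arbitrary: h rule: finite_induct)
  case empty
  then show ?case by simp
next
  case (insert n A)
  interpret H: semi_inner_product_space H by fact
  interpret F: semi_inner_product_space F by fact
  define N where "N = hinner H (h n) (h n)"
  \<comment> \<open>If \<open>N = 0\<close> the division yields 0, and \<open>hn\<close> below
    persists because Cauchy-Schwarz makes its left side 0.\<close>
  define \<alpha> where "\<alpha> i = hinner H (h i) (h n) / N" for i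
  define p where "p i = h i - \<alpha> i *\<^sub>C h n" for i
  have h_in: "h i \<in> hcarrier H" and f_in: "f i \<in> hcarrier F" if "i \<in> insert n A" for i
    using insert.prems that by auto
  have p_in: "p i \<in> hcarrier H" if "i \<in> insert n A" for i
    using h_in that by (auto simp: p_def)
  have N: "N = complex_of_real ((hnorm H (h n))\<^sup>2)"
    using h_in by (simp add: N_def H.ip_self)
  have hn: "hinner H (h i) (h n) = \<alpha> i * N" if "i \<in> insert n A" for i
  proof (cases "N = 0")
    case True
    then show ?thesis
      using H.cauchy_schwarz[of "h i" "h n"] h_in that N by simp
  qed (simp add: \<alpha>_def)
  have nh: "hinner H (h n) (h i) = cnj (\<alpha> i) * N" if "i \<in> insert n A" for i
    using hn[OF that] H.ip_commute[of "h n" "h i"] h_in that N by simp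
  have split: "hinner H (h i) (h j) = hinner H (p i) (p j) + \<alpha> i * cnj (\<alpha> j) * N"
    if "i \<in> insert n A" "j \<in> insert n A" for i j
  proof -
    have "hinner H (p i) (p j) = hinner H (h i) (h j) - cnj (\<alpha> j) * hinner H (h i) (h n)
        - \<alpha> i * hinner H (h n) (h j) + \<alpha> i * cnj (\<alpha> j) * N"
      using that h_in
      by (simp add: p_def H.ip_diff_left H.ip_diff_right H.ip_scale_left H.ip_scale_right N_def
          algebra_simps)
    then show ?thesis
      using hn[OF that(1)] nh[OF that(2)] by simp
  qed
  have \<alpha>n: "\<alpha> n * N = N" "cnj (\<alpha> n) * N = N"
    by (rule hn[OF insertI1, folded N_def, symmetric], rule nh[OF insertI1, folded N_def, symmetric])
  \<comment> \<open>\<open>p n\<close> pairs to 0 with every \<open>p j\<close>, so row and column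
    \<open>n\<close> drop out of the reduced form and the induction hypothesis applies to
    \<open>p\<close> on \<open>A\<close>.\<close>
  have pn: "hinner H (p n) (p j) = 0" "hinner H (p j) (p n) = 0" if "j \<in> insert n A" for j
  proof -
    have "cnj (\<alpha> j) * N = \<alpha> n * cnj (\<alpha> j) * N" "\<alpha> j * N = \<alpha> j * cnj (\<alpha> n) * N"
      using \<alpha>n by (metis mult.commute mult.left_commute)+
    then show "hinner H (p n) (p j) = 0" "hinner H (p j) (p n) = 0"
      using split[OF insertI1 that] split[OF that insertI1] nh[OF that] hn[OF that]
      by (metis add_cancel_left_left)+
  qed
  \<comment> \<open>The part split off has rank one in \<open>H\<close>, hence is a nonnegative
    multiple of a squared norm in \<open>F\<close>.\<close>
  have sq: "(\<Sum>i\<in>insert n A. \<Sum>j\<in>insert n A. \<alpha> i * cnj (\<alpha> j) * N * hinner F (f i) (f j))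
      = N * hinner F (\<Sum>i\<in>insert n A. \<alpha> i *\<^sub>C f i) (\<Sum>i\<in>insert n A. \<alpha> i *\<^sub>C f i)"
    (is "_ = N * hinner F ?s ?s")
  proof -
    have s: "?s \<in> hcarrier F"
      by (intro F.sum_in F.scale_in f_in)
    have "hinner F ?s ?s = (\<Sum>i\<in>insert n A. hinner F (\<alpha> i *\<^sub>C f i) ?s)"
      by (intro F.ip_sum_left F.scale_in f_in s)
    also have "\<dots> = (\<Sum>i\<in>insert n A. \<Sum>j\<in>insert n A. hinner F (\<alpha> i *\<^sub>C f i) (\<alpha> j *\<^sub>C f j))"
      by (intro sum.cong F.ip_sum_right F.scale_in f_in) auto
    also have "\<dots> = (\<Sum>i\<in>insert n A. \<Sum>j\<in>insert n A. \<alpha> i * cnj (\<alpha> j) * hinner F (f i) (f j))"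
      by (intro sum.cong refl) (simp only: F.ip_scale_left F.ip_scale_right f_in F.scale_in mult_ac)
    finally have "hinner F ?s ?s = (\<Sum>i\<in>insert n A. \<Sum>j\<in>insert n A. \<alpha> i * cnj (\<alpha> j) * hinner F (f i) (f j))" .
    then show ?thesis
      by (simp only: sum_distrib_left) (simp only: mult_ac)
  qed
  have "(\<Sum>i\<in>insert n A. \<Sum>j\<in>insert n A. hinner H (h i) (h j) * hinner F (f i) (f j))
      = (\<Sum>i\<in>insert n A. \<Sum>j\<in>insert n A. hinner H (p i) (p j) * hinner F (f i) (f j))
        + (\<Sum>i\<in>insert n A. \<Sum>j\<in>insert n A. \<alpha> i * cnj (\<alpha> j) * N * hinner F (f i) (f j))"
    unfolding sum.distrib[symmetric]
    by (intro sum.cong refl) (simp add: split algebra_simps)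
  also have "(\<Sum>i\<in>insert n A. \<Sum>j\<in>insert n A. hinner H (p i) (p j) * hinner F (f i) (f j))
      = (\<Sum>i\<in>A. \<Sum>j\<in>A. hinner H (p i) (p j) * hinner F (f i) (f j))"
    using insert.hyps by (simp add: pn)
  finally have "Re (\<Sum>i\<in>insert n A. \<Sum>j\<in>insert n A. hinner H (h i) (h j) * hinner F (f i) (f j))
      = Re (\<Sum>i\<in>A. \<Sum>j\<in>A. hinner H (p i) (p j) * hinner F (f i) (f j)) + Re (N * hinner F
          (\<Sum>i\<in>insert n A. \<alpha> i *\<^sub>C f i) (\<Sum>i\<in>insert n A. \<alpha> i *\<^sub>C f i))"
    by (simp only: sq plus_complex.simps)
  moreover have "0 \<le> Re (\<Sum>i\<in>A. \<Sum>j\<in>A. hinner H (p i) (p j) * hinner F (f i) (f j))"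
    using p_in f_in by (intro insert.IH) auto
  moreover have "0 \<le> Re (N * hinner F (\<Sum>i\<in>insert n A. \<alpha> i *\<^sub>C f i) (\<Sum>i\<in>insert n A. \<alpha> i *\<^sub>C f i))"
  proof -
    have "0 \<le> Re (hinner F (\<Sum>i\<in>insert n A. \<alpha> i *\<^sub>C f i) (\<Sum>i\<in>insert n A. \<alpha> i *\<^sub>C f i))"
      by (intro F.ip_nonneg F.sum_in F.scale_in f_in)
    then show ?thesis
      unfolding N by (simp del: sum.insert of_real_power)
  qed
  ultimately show ?case
    by linarith
qed

section \<open>Cauchy and null sequences for a possibly degenerate form\<close>

context semi_inner_product_space
begin

lemma hCauchy_bounded:
  assumes X: "\<And>n. X n \<in> hcarrier H" and "hCauchy H X"
  obtains B where "0 < B" "\<And>n. hnorm H (X n) \<le> B"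
proof -
  obtain N where N: "\<And>i j. \<lbrakk>N \<le> i; N \<le> j\<rbrakk> \<Longrightarrow> hnorm H (X i - X j) < 1"
    using assms(2) unfolding hCauchy_def by (meson zero_less_one)
  define B where "B = (\<Sum>i\<le>N. hnorm H (X i)) + 1"
  have le: "hnorm H (X i) \<le> B - 1" if "i \<le> N" for i
    using that X by (auto simp: B_def intro!: member_le_sum)
  have "hnorm H (X n) \<le> B" for n
  proof (cases "n \<le> N")
    case True
    then show ?thesis
      using le by fastforce
  next
    case False
    have "hnorm H (X n) \<le> hnorm H (X n - X N) + hnorm H (X N)"
      using norm_triangle[of "X n - X N" "X N"] X by simp
    then show ?thesis
      using N[of n N] le[of N] False by simp
  qed
  moreover have "0 < B"
    using X by (simp add: B_def add_nonneg_pos sum_nonneg)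
  ultimately show thesis
    using that by blast
qed

lemma hCauchy_add:
  assumes X: "\<And>n. X n \<in> hcarrier H" "hCauchy H X" and Y: "\<And>n. Y n \<in> hcarrier H" "hCauchy H Y"
  shows "hCauchy H (\<lambda>n. X n + Y n)"
  unfolding hCauchy_def
proof (intro allI impI)
  fix r :: real
  assume "r > 0"
  then have "r / 2 > 0"
    by simp
  then obtain N M where N: "\<And>i j. \<lbrakk>N \<le> i; N \<le> j\<rbrakk> \<Longrightarrow> hnorm H (X i - X j) < r / 2"
    and M: "\<And>i j. \<lbrakk>M \<le> i; M \<le> j\<rbrakk> \<Longrightarrow> hnorm H (Y i - Y j) < r / 2"
    using X(2) Y(2) unfolding hCauchy_def by meson
  have "hnorm H (X i + Y i - (X j + Y j)) < r" if "max N M \<le> i" "max N M \<le> j" for i j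
  proof -
    have "hnorm H ((X i - X j) + (Y i - Y j)) \<le> hnorm H (X i - X j) + hnorm H (Y i - Y j)"
      using X Y by (intro norm_triangle) auto
    then show ?thesis
      using N[of i j] M[of i j] that by (simp add: algebra_simps)
  qed
  then show "\<exists>N. \<forall>i\<ge>N. \<forall>j\<ge>N. hnorm H (X i + Y i - (X j + Y j)) < r"
    by blast
qed

lemma hCauchy_scale:
  assumes X: "\<And>n. X n \<in> hcarrier H" "hCauchy H X"
  shows "hCauchy H (\<lambda>n. a *\<^sub>C X n)"
  unfolding hCauchy_def
proof (intro allI impI)
  fix r :: real
  assume "r > 0"
  then have "r / (cmod a + 1) > 0"
    by (simp add: add_nonneg_pos)
  then obtain N where N: "\<And>i j. \<lbrakk>N \<le> i; N \<le> j\<rbrakk> \<Longrightarrow> hnorm H (X i - X j) < r / (cmod a + 1)"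
    using X(2) unfolding hCauchy_def by meson
  have "hnorm H (a *\<^sub>C X i - a *\<^sub>C X j) < r" if "N \<le> i" "N \<le> j" for i j
  proof -
    have "hnorm H (a *\<^sub>C X i - a *\<^sub>C X j) = cmod a * hnorm H (X i - X j)"
      using X norm_scale[of "X i - X j" a] by (simp add: cvec.scale_right_diff_distrib)
    also have "\<dots> \<le> (cmod a + 1) * hnorm H (X i - X j)"
      using X by (simp add: mult_right_mono)
    also have "\<dots> < r"
      using N[OF that] by (simp add: add_nonneg_pos pos_less_divide_eq mult.commute)
    finally show ?thesis .
  qed
  then show "\<exists>N. \<forall>i\<ge>N. \<forall>j\<ge>N. hnorm H (a *\<^sub>C X i - a *\<^sub>C X j) < r"
    by blast
qed

lemma hCauchy_const: "hCauchy H (\<lambda>n. x)"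
  by (simp add: hCauchy_def)

lemma ip_convergent:
  assumes X: "\<And>n. X n \<in> hcarrier H" "hCauchy H X" and Y: "\<And>n. Y n \<in> hcarrier H" "hCauchy H Y"
  shows "convergent (\<lambda>n. hinner H (X n) (Y n))"
  unfolding Cauchy_convergent_iff[symmetric]
proof (rule CauchyI)
  fix r :: real
  assume r: "0 < r"
  obtain A where A: "0 < A" "\<And>n. hnorm H (X n) \<le> A"
    using hCauchy_bounded[OF X] by metis
  obtain B where B: "0 < B" "\<And>n. hnorm H (Y n) \<le> B"
    using hCauchy_bounded[OF Y] by metis
  obtain N where N: "\<And>i j. \<lbrakk>N \<le> i; N \<le> j\<rbrakk> \<Longrightarrow> hnorm H (X i - X j) < r / 2 / B"
    using X(2) r B unfolding hCauchy_def by (meson half_gt_zero divide_pos_pos)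
  obtain M where M: "\<And>i j. \<lbrakk>M \<le> i; M \<le> j\<rbrakk> \<Longrightarrow> hnorm H (Y i - Y j) < r / 2 / A"
    using Y(2) r A unfolding hCauchy_def by (meson half_gt_zero divide_pos_pos)
  show "\<exists>M. \<forall>m\<ge>M. \<forall>n\<ge>M. cmod (hinner H (X m) (Y m) - hinner H (X n) (Y n)) < r"
  proof (intro exI allI impI)
    fix m n
    assume mn: "max N M \<le> m" "max N M \<le> n"
    have "hinner H (X m) (Y m) - hinner H (X n) (Y n)
        = hinner H (X m - X n) (Y m) + hinner H (X n) (Y m - Y n)"
      using X Y by (simp add: ip_diff_left ip_diff_right)
    also have "cmod \<dots> \<le> cmod (hinner H (X m - X n) (Y m)) + cmod (hinner H (X n) (Y m - Y n))"
      by (rule norm_triangle_ineq)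
    also have "\<dots> \<le> hnorm H (X m - X n) * hnorm H (Y m) + hnorm H (X n) * hnorm H (Y m - Y n)"
      using X Y by (intro add_mono cauchy_schwarz) auto
    also have "\<dots> \<le> hnorm H (X m - X n) * B + A * hnorm H (Y m - Y n)"
      using X Y A B by (intro add_mono mult_mono) (auto intro: less_imp_le)
    also have "\<dots> < r / 2 + r / 2"
      using N[of m n] M[of m n] mn A B by (intro add_strict_mono) (auto simp: field_simps)
    finally show "cmod (hinner H (X m) (Y m) - hinner H (X n) (Y n)) < r"
      by simp
  qed
qed

text \<open>Split \<open>hinner H (X n) (X n)\<close> at a fixed late index \<open>N\<close>: the
  part against \<open>X N\<close> tends to 0 by weak convergence, the part against
  \<open>X n - X N\<close> is small since \<open>X\<close> is bounded and Cauchy.\<close>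

lemma norm_null_of_weak_null:
  assumes X: "\<And>n. X n \<in> hcarrier H" "hCauchy H X"
    and weak: "\<And>m. (\<lambda>n. hinner H (X n) (X m)) \<longlonglongrightarrow> 0"
  shows "(\<lambda>n. hnorm H (X n)) \<longlonglongrightarrow> 0"
proof (rule LIMSEQ_I)
  fix r :: real
  assume r: "0 < r"
  obtain B where B: "0 < B" "\<And>n. hnorm H (X n) \<le> B"
    using hCauchy_bounded[OF X] by metis
  have "0 < r\<^sup>2 / 2 / B"
    using r B by simp
  then obtain N where N: "\<And>i j. \<lbrakk>N \<le> i; N \<le> j\<rbrakk> \<Longrightarrow> hnorm H (X i - X j) < r\<^sup>2 / 2 / B"
    using X(2) unfolding hCauchy_def by meson
  obtain M where M: "\<And>n. M \<le> n \<Longrightarrow> cmod (hinner H (X n) (X N)) < r\<^sup>2 / 2"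
    using LIMSEQ_D[OF weak[of N], of "r\<^sup>2 / 2"] r by auto
  show "\<exists>no. \<forall>n\<ge>no. norm (hnorm H (X n) - 0) < r"
  proof (intro exI allI impI)
    fix n
    assume n: "max N M \<le> n"
    have "(hnorm H (X n))\<^sup>2 = cmod (hinner H (X n) (X n))"
      using X(1)[of n] by (simp add: ip_self norm_power)
    also have "hinner H (X n) (X n) = hinner H (X n) (X N) + hinner H (X n) (X n - X N)"
      using X(1) by (simp add: ip_diff_right)
    also have "cmod \<dots> \<le> cmod (hinner H (X n) (X N)) + cmod (hinner H (X n) (X n - X N))"
      by (rule norm_triangle_ineq)
    also have "\<dots> \<le> cmod (hinner H (X n) (X N)) + hnorm H (X n) * hnorm H (X n - X N)"
      using X(1) by (intro add_left_mono cauchy_schwarz) auto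
    also have "\<dots> \<le> cmod (hinner H (X n) (X N)) + B * hnorm H (X n - X N)"
      using X(1) B by (intro add_left_mono mult_right_mono) auto
    also have "\<dots> < r\<^sup>2 / 2 + r\<^sup>2 / 2"
      using N[of n N] M[of n] n B by (intro add_strict_mono) (auto simp: field_simps)
    finally have "(hnorm H (X n))\<^sup>2 < r\<^sup>2"
      by simp
    then show "norm (hnorm H (X n) - 0) < r"
      using r X(1)[of n] by (simp add: power_less_imp_less_base)
  qed
qed

lemma ip_null:
  assumes X: "\<And>n. X n \<in> hcarrier H" "(\<lambda>n. hnorm H (X n)) \<longlonglongrightarrow> 0"
    and Y: "\<And>n. Y n \<in> hcarrier H" "hCauchy H Y"
  shows "(\<lambda>n. hinner H (X n) (Y n)) \<longlonglongrightarrow> 0"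
proof -
  obtain B where B: "0 < B" "\<And>n. hnorm H (Y n) \<le> B"
    using hCauchy_bounded[OF Y] by metis
  have le: "cmod (hinner H (X n) (Y n)) \<le> hnorm H (X n) * B" for n
    using cauchy_schwarz[OF X(1) Y(1), of n n] mult_left_mono[OF B(2) norm_nonneg[OF X(1)], of n n]
    by linarith
  show ?thesis
    by (rule Lim_null_comparison[OF always_eventually tendsto_mult_left_zero[OF X(2)]])
      (use le in blast)
qed

end

section \<open>The Hilbert space of a positive kernel\<close>

text \<open>\<open>positive\<close> constrains real parts only, so Hermitian symmetry is a separate
  axiom.\<close>

locale positive_kernel =
  fixes \<kappa> :: "'x \<Rightarrow> 'x \<Rightarrow> complex"
  assumes hermitian: "\<kappa> x y = cnj (\<kappa> y x)"
    and positive: "c \<in> fsupp \<Longrightarrow> 0 \<le> Re (gram_form \<kappa> c c)"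

begin

text \<open>The degenerate pre-Hilbert space of formal combinations, in which
  \<open>single x\<close> plays the kernel function at \<open>x\<close>.\<close>

definition pre :: "('x \<Rightarrow> complex) hspace"
  where "pre = \<lparr>hcarrier = fsupp, hinner = gram_form \<kappa>\<rparr>"

lemma pre_carrier [simp]: "hcarrier pre = fsupp" and pre_inner: "hinner pre = gram_form \<kappa>"
  by (simp_all add: pre_def)

sublocale pre: semi_inner_product_space pre
proof
  show "cvec.subspace (hcarrier pre)"
    by (simp add: subspace_fsupp)
  show "hinner pre (c + d) g = hinner pre c g + hinner pre d g"
    if "c \<in> hcarrier pre" "d \<in> hcarrier pre" "g \<in> hcarrier pre" for c d g
    using that by (simp add: pre_inner gram_form_lincomb lincomb_add)
  show "hinner pre (a *\<^sub>C c) g = a * hinner pre c g"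
    if "c \<in> hcarrier pre" "g \<in> hcarrier pre" for a c g
    using that by (simp add: pre_inner gram_form_lincomb lincomb_scale scaleC_complex_def)
  show "hinner pre c d = cnj (hinner pre d c)"
    if "c \<in> hcarrier pre" "d \<in> hcarrier pre" for c d
    unfolding pre_inner gram_form_def cnj_sum complex_cnj_mult hermitian[symmetric] complex_cnj_cnj
    by (subst sum.swap) (simp add: mult_ac)
  show "0 \<le> Re (hinner pre c c)" if "c \<in> hcarrier pre" for c
    using that by (simp add: pre_inner positive)
qed

end

text \<open>
  The elements of the reproducing kernel Hilbert space are functions on \<open>'x\<close>, stored in a type \<open>'b\<close>
  that is linearly isomorphic to \<open>'x \<Rightarrow> complex\<close>.
\<close>

locale kernel_completion = positive_kernel \<kappa> for \<kappa> :: "'x \<Rightarrow> 'x \<Rightarrow> complex" +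
  fixes ev :: "'x \<Rightarrow> 'b::complex_vector \<Rightarrow> complex" and mk :: "('x \<Rightarrow> complex) \<Rightarrow> 'b"
  assumes ev_add: "ev x (f + g) = ev x f + ev x g"
    and ev_scale: "ev x (a *\<^sub>C f) = a * ev x f"
    and ev_mk: "ev x (mk \<phi>) = \<phi> x"
    and ev_eqI: "(\<And>x. ev x f = ev x g) \<Longrightarrow> f = g"
begin

text \<open>The value at \<open>x\<close> of the kernel combination coded by \<open>c\<close>,
  anticipating the reproducing property.\<close>

definition point :: "('x \<Rightarrow> complex) \<Rightarrow> 'x \<Rightarrow> complex"
  where "point c x = hinner pre c (single x)"

text \<open>The completion consists of functions, not of classes of Cauchy sequences:
  \<open>f\<close> belongs to it if it is the pointwise limit of a Cauchy sequence of kernel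
  combinations. That different sequences for \<open>f\<close> are equivalent is
  \<open>represents_unique\<close>.\<close>

definition represents :: "(nat \<Rightarrow> 'x \<Rightarrow> complex) \<Rightarrow> 'b \<Rightarrow> bool"
  where "represents u f \<longleftrightarrow>
    (\<forall>n. u n \<in> fsupp) \<and> hCauchy pre u \<and> (\<forall>x. (\<lambda>n. point (u n) x) \<longlonglongrightarrow> ev x f)"

definition rep :: "'b \<Rightarrow> nat \<Rightarrow> 'x \<Rightarrow> complex"
  where "rep f = (SOME u. represents u f)"

text \<open>The inner product is taken along chosen sequences \<open>rep f\<close>,
  \<open>rep g\<close>; \<open>inner_limit\<close> shows that the choice does not matter.\<close>

definition space :: "'b hspace"
  where "space = \<lparr>hcarrier = {f. \<exists>u. represents u f},
    hinner = (\<lambda>f g. lim (\<lambda>n. hinner pre (rep f n) (rep g n)))\<rparr>"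

definition embed :: "('x \<Rightarrow> complex) \<Rightarrow> 'b"
  where "embed c = mk (point c)"

lemma representsD:
  assumes "represents u f"
  shows "u n \<in> fsupp" "hCauchy pre u" "(\<lambda>n. point (u n) x) \<longlonglongrightarrow> ev x f"
  using assms by (auto simp: represents_def)

lemma represents_in: "represents u f \<Longrightarrow> f \<in> hcarrier space"
  by (auto simp: space_def)

lemma represents_rep: "f \<in> hcarrier space \<Longrightarrow> represents (rep f) f"
  using someI_ex[of "\<lambda>u. represents u f"] by (simp add: space_def rep_def)

lemma ev_zero: "ev x 0 = 0"
  using ev_scale[of x 0 0] by simp

lemma ev_diff: "ev x (f - g) = ev x f - ev x g"
  using ev_add[of x "f - g" g] by simp

lemma represents_add:
  assumes "represents u f" "represents v g"
  shows "represents (\<lambda>n. u n + v n) (f + g)"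
  using assms subspace_fsupp pre.hCauchy_add[of u v]
  by (auto simp: represents_def point_def pre.ip_add_left ev_add
      intro!: cvec.subspace_add[OF subspace_fsupp] tendsto_add)

lemma represents_scale:
  assumes "represents u f"
  shows "represents (\<lambda>n. a *\<^sub>C u n) (a *\<^sub>C f)"
  using assms pre.hCauchy_scale[of u a]
  by (auto simp: represents_def point_def pre.ip_scale_left ev_scale
      intro!: cvec.subspace_scale[OF subspace_fsupp] tendsto_mult_left)

lemma represents_diff:
  assumes "represents u f" "represents v g"
  shows "represents (\<lambda>n. u n - v n) (f - g)"
  using represents_add[OF assms(1) represents_scale[OF assms(2), of "-1"]] by simp

lemma represents_const: "c \<in> fsupp \<Longrightarrow> represents (\<lambda>n. c) (embed c)"
  by (simp add: represents_def pre.hCauchy_const embed_def ev_mk)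

lemma represents_zero: "represents (\<lambda>n. 0) 0"
  using pre.zero_in by (simp add: represents_def pre.hCauchy_const point_def ev_zero del: pre.zero_in)

text \<open>Pairing with a fixed combination is a finite sum of point values, so pointwise
  convergence implies weak convergence against combinations.\<close>

lemma pre_expand_right:
  "hinner pre c d = (\<Sum>y | d y \<noteq> 0. cnj (d y) * point c y)"
proof -
  have "point c y = (\<Sum>x | c x \<noteq> 0. c x * \<kappa> x y)" for y
    by (simp add: point_def pre_inner gram_form_single lincomb_def scaleC_complex_def)
  then show ?thesis
    unfolding pre_inner gram_form_def by (subst sum.swap) (simp add: sum_distrib_left mult_ac)
qed

text \<open>The difference is Cauchy with pointwise limit 0, hence weakly null, hence null in norm.
  This is what allows elements of the completion to be functions.\<close>

lemma represents_unique:
  assumes "represents u f" "represents v f"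
  shows "(\<lambda>n. hnorm pre (u n - v n)) \<longlonglongrightarrow> 0"
proof -
  have d: "represents (\<lambda>n. u n - v n) 0"
    using represents_diff[OF assms] by simp
  show ?thesis
  proof (rule pre.norm_null_of_weak_null)
    fix m
    have "(\<lambda>n. \<Sum>y | (u m - v m) y \<noteq> 0. cnj ((u m - v m) y) * point (u n - v n) y)
        \<longlonglongrightarrow> (\<Sum>y | (u m - v m) y \<noteq> 0. cnj ((u m - v m) y) * 0)"
      using representsD(3)[OF d] by (intro tendsto_intros) (simp add: ev_zero)
    then show "(\<lambda>n. hinner pre (u n - v n) (u m - v m)) \<longlonglongrightarrow> 0"
      using representsD(1)[OF d] by (simp add: pre_expand_right)
  qed (use representsD[OF d] in auto)
qed

text \<open>Replace \<open>u\<close> by \<open>rep f\<close> and then \<open>v\<close> by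
  \<open>rep g\<close>; each replacement costs the pairing of a null sequence with a Cauchy
  sequence.\<close>

lemma inner_limit:
  assumes "represents u f" "represents v g"
  shows "(\<lambda>n. hinner pre (u n) (v n)) \<longlonglongrightarrow> hinner space f g"
proof -
  have f: "represents (rep f) f" and g: "represents (rep g) g"
    using assms represents_in represents_rep by blast+
  note in_pre = representsD(1)[OF assms(1)] representsD(1)[OF assms(2)] representsD(1)[OF f]
    representsD(1)[OF g]
  have "(\<lambda>n. hinner pre (rep f n) (rep g n)) \<longlonglongrightarrow> hinner space f g"
    using pre.ip_convergent[of "rep f" "rep g"] representsD[OF f] representsD[OF g]
    by (simp add: convergent_LIMSEQ_iff space_def)
  moreover have "(\<lambda>n. hinner pre (u n - rep f n) (v n)) \<longlonglongrightarrow> 0"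
    using represents_unique[OF assms(1) f] in_pre representsD(2)[OF assms(2)]
    by (intro pre.ip_null) auto
  moreover have "(\<lambda>n. hinner pre (rep f n) (v n - rep g n)) \<longlonglongrightarrow> 0"
  proof -
    have "(\<lambda>n. cnj (hinner pre (v n - rep g n) (rep f n))) \<longlonglongrightarrow> cnj 0"
      using represents_unique[OF assms(2) g] in_pre representsD(2)[OF f]
      by (intro tendsto_cnj pre.ip_null) auto
    moreover have "cnj (hinner pre (v n - rep g n) (rep f n)) = hinner pre (rep f n) (v n - rep g n)" for n
      using in_pre pre.diff_in by (intro pre.ip_commute[symmetric]) auto
    ultimately show ?thesis
      by simp
  qed
  ultimately have "(\<lambda>n. hinner pre (u n - rep f n) (v n) + hinner pre (rep f n) (v n - rep g n)
      + hinner pre (rep f n) (rep g n)) \<longlonglongrightarrow> 0 + 0 + hinner space f g"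
    by (intro tendsto_add)
  then show ?thesis
    using in_pre by (simp add: pre.ip_diff_left pre.ip_diff_right)
qed

lemma space_subspace: "cvec.subspace (hcarrier space)"
proof (rule cvec.subspaceI)
  show "0 \<in> hcarrier space"
    by (rule represents_in[OF represents_zero])
  show "f + g \<in> hcarrier space" if "f \<in> hcarrier space" "g \<in> hcarrier space" for f g
    using represents_add[OF represents_rep represents_rep, OF that] represents_in by blast
  show "a *\<^sub>C f \<in> hcarrier space" if "f \<in> hcarrier space" for a f
    using represents_scale[OF represents_rep, OF that] represents_in by blast
qed

sublocale space: inner_product_space space
proof
  note lims = inner_limit[OF represents_rep represents_rep]
  show "cvec.subspace (hcarrier space)"
    by (rule space_subspace)
  show "hinner space (f + g) h = hinner space f h + hinner space g h"
    if "f \<in> hcarrier space" "g \<in> hcarrier space" "h \<in> hcarrier space" for f g h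
  proof (rule LIMSEQ_unique)
    show "(\<lambda>n. hinner pre (rep f n + rep g n) (rep h n)) \<longlonglongrightarrow> hinner space (f + g) h"
      using that by (intro inner_limit represents_add represents_rep)
    show "(\<lambda>n. hinner pre (rep f n + rep g n) (rep h n)) \<longlonglongrightarrow> hinner space f h + hinner space g h"
      using tendsto_add[OF lims lims, of f h g h] that representsD(1)[OF represents_rep]
      by (simp add: pre.ip_add_left)
  qed
  show "hinner space (a *\<^sub>C f) g = a * hinner space f g"
    if "f \<in> hcarrier space" "g \<in> hcarrier space" for a f g
  proof (rule LIMSEQ_unique)
    show "(\<lambda>n. hinner pre (a *\<^sub>C rep f n) (rep g n)) \<longlonglongrightarrow> hinner space (a *\<^sub>C f) g"
      using that by (intro inner_limit represents_scale represents_rep)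
    show "(\<lambda>n. hinner pre (a *\<^sub>C rep f n) (rep g n)) \<longlonglongrightarrow> a * hinner space f g"
      using tendsto_mult_left[OF lims, of f g a] that representsD(1)[OF represents_rep]
      by (simp add: pre.ip_scale_left)
  qed
  show "hinner space f g = cnj (hinner space g f)"
    if "f \<in> hcarrier space" "g \<in> hcarrier space" for f g
  proof (rule LIMSEQ_unique)
    show "(\<lambda>n. hinner pre (rep f n) (rep g n)) \<longlonglongrightarrow> hinner space f g"
      using that by (intro lims)
    show "(\<lambda>n. hinner pre (rep f n) (rep g n)) \<longlonglongrightarrow> cnj (hinner space g f)"
      using tendsto_cnj[OF lims, of g f] that representsD(1)[OF represents_rep]
      by (simp add: pre.ip_commute[symmetric])
  qed
  show "0 \<le> Re (hinner space f f)" if "f \<in> hcarrier space" for f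
    by (rule LIMSEQ_le_const[OF tendsto_Re[OF lims, OF that that]])
      (use pre.ip_nonneg representsD(1)[OF represents_rep[OF that]] in auto)
  \<comment> \<open>Zero norm makes \<open>rep f\<close> a null sequence, so its point values tend
    to 0; but they tend to \<open>ev x f\<close>.\<close>
  show "f = 0" if f: "f \<in> hcarrier space" and zero: "hinner space f f = 0" for f
  proof (rule ev_eqI)
    fix x
    note r = represents_rep[OF f]
    have "(\<lambda>n. (hnorm pre (rep f n))\<^sup>2) \<longlonglongrightarrow> 0"
      using tendsto_Re[OF lims, OF f f] zero representsD(1)[OF r] by (simp add: pre.norm_sq)
    then have "(\<lambda>n. hnorm pre (rep f n)) \<longlonglongrightarrow> 0"
      using tendsto_real_sqrt[of "\<lambda>n. (hnorm pre (rep f n))\<^sup>2" 0] representsD(1)[OF r] by simp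
    then have "(\<lambda>n. hinner pre (rep f n) (single x)) \<longlonglongrightarrow> 0"
      using representsD(1)[OF r] by (intro pre.ip_null pre.hCauchy_const) auto
    then show "ev x f = ev x 0"
      using representsD(3)[OF r, of x] unfolding point_def ev_zero by (metis LIMSEQ_unique)
  qed
qed

lemma inner_embed:
  assumes "c \<in> fsupp" "d \<in> fsupp"
  shows "hinner space (embed c) (embed d) = gram_form \<kappa> c d"
  using inner_limit[OF represents_const represents_const, OF assms]
  by (simp add: LIMSEQ_const_iff pre_inner)

lemma embed_in: "c \<in> fsupp \<Longrightarrow> embed c \<in> hcarrier space"
  using represents_const represents_in by blast

lemma embed_diff:
  assumes "c \<in> fsupp" "d \<in> fsupp"
  shows "embed (c - d) = embed c - embed d"
  using assms by (intro ev_eqI) (simp add: embed_def ev_diff ev_mk point_def pre.ip_diff_left)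

lemma norm_embed: "c \<in> fsupp \<Longrightarrow> hnorm space (embed c) = hnorm pre c"
  by (simp add: hnorm_def inner_embed pre_inner)

text \<open>The distance from \<open>f\<close> to \<open>embed (u n)\<close> is the limit over
  \<open>m\<close> of the norms of \<open>u m - u n\<close>, which the Cauchy property
  controls.\<close>

lemma embed_approx:
  assumes "represents u f"
  shows "(\<lambda>n. hnorm space (f - embed (u n))) \<longlonglongrightarrow> 0"
proof (rule LIMSEQ_I)
  fix r :: real
  assume r: "0 < r"
  have u: "u n \<in> fsupp" for n
    using representsD(1)[OF assms] .
  obtain N where N: "\<And>i j. \<lbrakk>N \<le> i; N \<le> j\<rbrakk> \<Longrightarrow> hnorm pre (u i - u j) < r / 2"
    using representsD(2)[OF assms] r unfolding hCauchy_def by (meson half_gt_zero)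
  show "\<exists>no. \<forall>n\<ge>no. norm (hnorm space (f - embed (u n)) - 0) < r"
  proof (intro exI allI impI)
    fix n
    assume n: "N \<le> n"
    have rd: "represents (\<lambda>m. u m - u n) (f - embed (u n))"
      by (rule represents_diff[OF assms represents_const[OF u]])
    have in_space: "f - embed (u n) \<in> hcarrier space"
      using represents_in[OF rd] .
    have d: "u m - u n \<in> fsupp" for m
      using representsD(1)[OF rd] .
    have "(\<lambda>m. (hnorm pre (u m - u n))\<^sup>2) \<longlonglongrightarrow> (hnorm space (f - embed (u n)))\<^sup>2"
      using tendsto_Re[OF inner_limit[OF rd rd]] d in_space by (simp add: pre.norm_sq space.norm_sq)
    then have "(hnorm space (f - embed (u n)))\<^sup>2 \<le> (r / 2)\<^sup>2"
    proof (rule LIMSEQ_le_const2)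
      have "(hnorm pre (u m - u n))\<^sup>2 \<le> (r / 2)\<^sup>2" if "N \<le> m" for m
        using N[OF that n] pre.norm_nonneg[of "u m - u n"] d by (intro power_mono) auto
      then show "\<exists>N. \<forall>m\<ge>N. (hnorm pre (u m - u n))\<^sup>2 \<le> (r / 2)\<^sup>2"
        by blast
    qed
    then have "hnorm space (f - embed (u n)) \<le> r / 2"
      by (rule power2_le_imp_le) (use r in simp)
    then show "norm (hnorm space (f - embed (u n)) - 0) < r"
      using r in_space by simp
  qed
qed

text \<open>Approximate \<open>X i\<close> by a combination \<open>embed (c i)\<close> up to
  \<open>inverse (Suc i)\<close>. Then \<open>c\<close> is itself Cauchy, its point values converge,
  and the function of these limits is the limit of \<open>X\<close>.\<close>

sublocale space: hilbert_space space
proof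
  fix X
  assume X: "\<And>i. X i \<in> hcarrier space" and Cauchy: "hCauchy space X"
  have "\<exists>c\<in>fsupp. hnorm space (X i - embed c) < inverse (Suc i)" for i
  proof -
    note r = represents_rep[OF X[of i]]
    have "\<forall>\<^sub>F n in sequentially. hnorm space (X i - embed (rep (X i) n)) < inverse (real (Suc i))"
      by (rule order_tendstoD[OF embed_approx[OF r]]) simp
    then show ?thesis
      using representsD(1)[OF r] eventually_happens' sequentially_bot by blast
  qed
  then obtain c where c: "\<And>i. c i \<in> fsupp"
    and close: "\<And>i. hnorm space (X i - embed (c i)) < inverse (Suc i)"
    by metis
  have e_in: "embed (c i) \<in> hcarrier space" for i
    by (rule embed_in[OF c])
  have inv: "(\<lambda>i. inverse (real (Suc i))) \<longlonglongrightarrow> 0"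
    by (rule LIMSEQ_inverse_real_of_nat)
  have "hCauchy pre c"
    unfolding hCauchy_def
  proof (intro allI impI)
    fix r :: real
    assume r: "0 < r"
    obtain N where N: "\<And>i j. \<lbrakk>N \<le> i; N \<le> j\<rbrakk> \<Longrightarrow> hnorm space (X i - X j) < r / 3"
      using Cauchy r unfolding hCauchy_def by (meson divide_pos_pos zero_less_numeral)
    obtain M where M: "\<And>i. M \<le> i \<Longrightarrow> inverse (real (Suc i)) < r / 3"
      using order_tendstoD(2)[OF inv, of "r / 3"] r unfolding eventually_sequentially by auto
    have "hnorm pre (c i - c j) < r" if "max N M \<le> i" "max N M \<le> j" for i j
    proof -
      have "hnorm pre (c i - c j) = hnorm space (embed (c i) - embed (c j))"
        using c by (simp add: norm_embed[symmetric] embed_diff)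
      also have "\<dots> \<le> hnorm space (embed (c i) - X i) + hnorm space (X i - embed (c j))"
        using X e_in by (intro space.norm_triangle_diff)
      also have "\<dots> \<le> hnorm space (embed (c i) - X i) + (hnorm space (X i - X j)
          + hnorm space (X j - embed (c j)))"
        using X e_in by (intro add_left_mono space.norm_triangle_diff)
      also have "hnorm space (embed (c i) - X i) = hnorm space (X i - embed (c i))"
        using X e_in by (intro space.norm_minus_commute)
      finally show ?thesis
        using N[of i j] M[of i] M[of j] close[of i] close[of j] that unfolding max.bounded_iff
        by linarith
    qed
    then show "\<exists>N. \<forall>i\<ge>N. \<forall>j\<ge>N. hnorm pre (c i - c j) < r"
      by blast
  qed
  define f where "f = mk (\<lambda>x. lim (\<lambda>n. point (c n) x))"
  have f: "represents c f"
    unfolding represents_def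
  proof (intro conjI allI)
    fix x
    have "convergent (\<lambda>n. point (c n) x)"
      unfolding point_def using c \<open>hCauchy pre c\<close>
      by (intro pre.ip_convergent pre.hCauchy_const) auto
    then show "(\<lambda>n. point (c n) x) \<longlonglongrightarrow> ev x f"
      by (simp add: f_def ev_mk convergent_LIMSEQ_iff)
  qed (use c \<open>hCauchy pre c\<close> in auto)
  have f_in: "f \<in> hcarrier space"
    by (rule represents_in[OF f])
  have "(\<lambda>i. hnorm space (X i - f)) \<longlonglongrightarrow> 0"
  proof (rule Lim_null_comparison)
    show "(\<lambda>i. inverse (real (Suc i)) + hnorm space (f - embed (c i))) \<longlonglongrightarrow> 0"
      using tendsto_add[OF inv embed_approx[OF f]] by simp
    have "norm (hnorm space (X i - f)) \<le> inverse (real (Suc i)) + hnorm space (f - embed (c i))" for i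
    proof -
      have "hnorm space (X i - f) \<le> hnorm space (X i - embed (c i)) + hnorm space (embed (c i) - f)"
        using X e_in f_in by (intro space.norm_triangle_diff)
      also have "hnorm space (embed (c i) - f) = hnorm space (f - embed (c i))"
        using f_in e_in by (intro space.norm_minus_commute)
      finally show ?thesis
        using close[of i] X f_in by simp
    qed
    then show "\<forall>\<^sub>F i in sequentially. norm (hnorm space (X i - f))
        \<le> inverse (real (Suc i)) + hnorm space (f - embed (c i))"
      by simp
  qed
  with f_in show "\<exists>x\<in>hcarrier space. (\<lambda>i. hnorm space (X i - x)) \<longlonglongrightarrow> 0"
    by blast
qed

sublocale space: total_family space "\<lambda>x. embed (single x)"
proof
  show "embed (single x) \<in> hcarrier space" for x
    by (simp add: embed_in)
  show "f = 0" if f: "f \<in> hcarrier space" and zero: "\<And>x. hinner space f (embed (single x)) = 0" for f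
  proof (rule ev_eqI)
    fix x
    have "(\<lambda>n. hinner pre (rep f n) (single x)) \<longlonglongrightarrow> 0"
      using inner_limit[OF represents_rep[OF f] represents_const[OF single_fsupp], of x] zero by simp
    then show "ev x f = ev x 0"
      using representsD(3)[OF represents_rep[OF f], of x] unfolding point_def ev_zero
      by (metis LIMSEQ_unique)
  qed
qed

lemma gram: "hinner space (embed (single x)) (embed (single y)) = \<kappa> x y"
  by (simp add: inner_embed gram_form_single)

lemma embed_eq_lincomb:
  assumes "c \<in> fsupp"
  shows "embed c = lincomb (\<lambda>x. embed (single x)) c"
proof (rule space.eqI)
  show "hinner space (embed c) (embed (single y))
      = hinner space (lincomb (\<lambda>x. embed (single x)) c) (embed (single y))" for y
    using assms by (simp add: space.ip_lincomb_left gram) (simp add: inner_embed gram_form_single)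
qed (use assms in \<open>auto simp: embed_in intro: space.lincomb_in\<close>)

lemma dense_span: "hdense space (cvec.span (range (\<lambda>x. embed (single x))))"
  unfolding hdense_def
proof (intro conjI ballI allI impI)
  show "cvec.span (range (\<lambda>x. embed (single x))) \<subseteq> hcarrier space"
    by (intro cvec.span_minimal space.carrier_subspace) auto
  fix f and r :: real
  assume f: "f \<in> hcarrier space" and r: "0 < r"
  note rf = represents_rep[OF f]
  obtain n where n: "hnorm space (f - embed (rep f n)) < r"
    using order_tendstoD(2)[OF embed_approx[OF rf] r] eventually_happens' sequentially_bot by blast
  have "embed (rep f n) \<in> cvec.span (range (\<lambda>x. embed (single x)))"
    unfolding embed_eq_lincomb[OF representsD(1)[OF rf]] lincomb_def
    by (intro cvec.span_sum cvec.span_scale cvec.span_base) auto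
  then show "\<exists>y\<in>cvec.span (range (\<lambda>x. embed (single x))). hnorm space (f - y) < r"
    using n by blast
qed

end

text \<open>\<open>ev\<close> and \<open>mk\<close> leave the storage type to the caller, who can
  thus place the space in the type that the final statement names.\<close>

theorem moore_aronszajn:
  fixes \<kappa> :: "'x \<Rightarrow> 'x \<Rightarrow> complex" and ev :: "'x \<Rightarrow> 'b::complex_vector \<Rightarrow> complex"
  assumes "positive_kernel \<kappa>"
    and "\<And>x f g. ev x (f + g) = ev x f + ev x g" "\<And>x a f. ev x (a *\<^sub>C f) = a * ev x f"
    and "\<And>\<phi> x. ev x (mk \<phi>) = \<phi> x" "\<And>f g. (\<And>x. ev x f = ev x g) \<Longrightarrow> f = g"
  obtains R :: "'b hspace" and e where "total_family R e"
    "\<And>x y. hinner R (e x) (e y) = \<kappa> x y" "hdense R (cvec.span (range e))"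
proof -
  interpret kernel_completion \<kappa> ev mk
  proof (intro kernel_completion.intro kernel_completion_axioms.intro)
    show "f = g" if "\<And>x. ev x f = ev x g" for f g
      using that by (rule assms(5))
  qed (simp_all add: assms(1-4))
  show thesis
    using that[OF space.total_family_axioms gram dense_span] .
qed

section \<open>Tensor products\<close>

text \<open>The coefficients of the quadratic form are absorbed into the vectors \<open>h i\<close>,
  after which \<open>schur_product\<close> applies as it stands.\<close>

lemma product_kernel:
  assumes "semi_inner_product_space H" "semi_inner_product_space F"
    and h: "\<And>i. h i \<in> hcarrier H" and f: "\<And>i. f i \<in> hcarrier F"
  shows "positive_kernel (\<lambda>i j. hinner H (h i) (h j) * hinner F (f i) (f j))"
proof -
  interpret H: semi_inner_product_space H by fact
  interpret F: semi_inner_product_space F by fact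
  show ?thesis
  proof
    show "hinner H (h i) (h j) * hinner F (f i) (f j)
        = cnj (hinner H (h j) (h i) * hinner F (f j) (f i))" for i j
      using H.ip_commute[OF h h] F.ip_commute[OF f f] by (metis complex_cnj_mult)
    show "0 \<le> Re (gram_form (\<lambda>i j. hinner H (h i) (h j) * hinner F (f i) (f j)) c c)"
      if c: "c \<in> fsupp" for c
    proof -
      have "gram_form (\<lambda>i j. hinner H (h i) (h j) * hinner F (f i) (f j)) c c
          = (\<Sum>i | c i \<noteq> 0. \<Sum>j | c j \<noteq> 0.
              hinner H (c i *\<^sub>C h i) (c j *\<^sub>C h j) * hinner F (f i) (f j))"
        unfolding gram_form_def using h
        by (simp add: H.ip_scale_left H.ip_scale_right mult_ac)
      also have "0 \<le> Re \<dots>"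
        using c h f by (intro schur_product[OF assms(1,2)]) (auto simp: fsupp_def)
      finally show ?thesis .
    qed
  qed
qed

text \<open>\<open>T\<close> is not assumed to be a tensor product: a product Gram matrix and
  density of the span are enough to construct the bilinear map and to prove that it is one.\<close>

locale tensor_family =
  H: total_family H k + F: total_family F l + T: total_family T E
  for H :: "'h::complex_vector hspace" and k :: "'x \<Rightarrow> 'h"
    and F :: "'f::complex_vector hspace" and l :: "'y \<Rightarrow> 'f"
    and T :: "'t::complex_vector hspace" and E :: "'x \<times> 'y \<Rightarrow> 't" +
  assumes gram: "hinner T (E p) (E q)
      = hinner H (k (fst p)) (k (fst q)) * hinner F (l (snd p)) (l (snd q))"
    and dense: "hdense T (cvec.span (range E))"
begin

text \<open>Cauchy-Schwarz in the space of formal combinations of the \<open>E p\<close> and of one further vector.\<close>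

lemma tensor_bound:
  assumes h: "h \<in> hcarrier H" and f: "f \<in> hcarrier F"
  shows "cmod (lincomb (\<lambda>p. cnj (hinner H h (k (fst p)) * hinner F f (l (snd p)))) c)
    \<le> hnorm H h * hnorm F f * hnorm T (lincomb E c)"
proof -
  define h' where "h' = case_option h (\<lambda>p::'x \<times> 'y. k (fst p))"
  define f' where "f' = case_option f (\<lambda>p::'x \<times> 'y. l (snd p))"
  define \<kappa> where "\<kappa> = (\<lambda>i j. hinner H (h' i) (h' j) * hinner F (f' i) (f' j))"
  interpret positive_kernel \<kappa>
    unfolding \<kappa>_def
    by (intro product_kernel H.semi_inner_product_space_axioms F.semi_inner_product_space_axioms)
      (use h f in \<open>auto simp: h'_def f'_def split: option.split\<close>)
  have pre_single: "hinner pre (single i) (single j) = \<kappa> i j" for i j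
    by (simp add: pre_inner gram_form_single)
  have \<kappa>_simps: "\<kappa> (Some p) (Some q) = hinner T (E p) (E q)"
    "\<kappa> (Some p) None = hinner H (k (fst p)) h * hinner F (l (snd p)) f"
    "\<kappa> None None = hinner H h h * hinner F f f" for p q
    by (simp_all add: \<kappa>_def h'_def f'_def gram)
  let ?c = "lincomb (\<lambda>p. single (Some p)) c :: ('x \<times> 'y) option \<Rightarrow> complex"
  have c_in: "?c \<in> hcarrier pre"
    by (rule pre.lincomb_in) simp
  have "hnorm pre ?c = hnorm T (lincomb E c)"
    by (rule norm_lincomb_eq[OF pre.semi_inner_product_space_axioms T.semi_inner_product_space_axioms])
      (simp_all add: pre_single \<kappa>_simps)
  moreover have "hnorm pre (single None) = hnorm H h * hnorm F f"
    using h f by (simp add: hnorm_def[of pre] pre_single \<kappa>_simps H.ip_self F.ip_self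
        real_sqrt_mult)
  moreover have "hinner pre ?c (single None)
      = lincomb (\<lambda>p. cnj (hinner H h (k (fst p)) * hinner F f (l (snd p)))) c"
    using H.ip_commute[OF h H.family_in] F.ip_commute[OF f F.family_in]
    by (simp add: pre.ip_lincomb_left pre_single \<kappa>_simps)
  ultimately show ?thesis
    using pre.cauchy_schwarz[OF c_in, of "single None"] by (simp add: mult_ac)
qed

text \<open>The entries against \<open>E\<close> determine the vector because the family is total.
  The norm bound is carried along since boundedness in each factor is needed before
  \<open>inner_tensor\<close> is available.\<close>

definition tensor :: "'h \<Rightarrow> 'f \<Rightarrow> 't"
  where "tensor h f = (SOME y. y \<in> hcarrier T \<and>
    (\<forall>p. hinner T y (E p) = hinner H h (k (fst p)) * hinner F f (l (snd p))) \<and>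
    hnorm T y \<le> hnorm H h * hnorm F f)"

lemma
  assumes "h \<in> hcarrier H" "f \<in> hcarrier F"
  shows tensor_in [simp]: "tensor h f \<in> hcarrier T"
    and ip_tensor: "hinner T (tensor h f) (E p) = hinner H h (k (fst p)) * hinner F f (l (snd p))"
    and tensor_norm_le: "hnorm T (tensor h f) \<le> hnorm H h * hnorm F f"
proof -
  have "\<exists>y\<in>hcarrier T. (\<forall>p. hinner T y (E p) = hinner H h (k (fst p)) * hinner F f (l (snd p)))
      \<and> hnorm T y \<le> hnorm H h * hnorm F f"
    by (rule T.represent) (use assms tensor_bound in auto)
  then have "\<exists>y. y \<in> hcarrier T
      \<and> (\<forall>p. hinner T y (E p) = hinner H h (k (fst p)) * hinner F f (l (snd p)))
      \<and> hnorm T y \<le> hnorm H h * hnorm F f"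
    by blast
  from someI_ex[OF this, folded tensor_def]
  show "tensor h f \<in> hcarrier T"
    and "hinner T (tensor h f) (E p) = hinner H h (k (fst p)) * hinner F f (l (snd p))"
    and "hnorm T (tensor h f) \<le> hnorm H h * hnorm F f"
    by blast+
qed

lemma tensor_family_eq: "tensor (k z) (l x) = E (z, x)"
  by (rule T.eqI) (simp_all add: ip_tensor gram)

lemma bounded_tensor_left:
  assumes "f \<in> hcarrier F"
  shows "bounded_op H T (\<lambda>h. tensor h f)"
  unfolding bounded_op_def linear_op_def
proof (intro conjI ballI allI exI)
  show "tensor (h + g) f = tensor h f + tensor g f" if "h \<in> hcarrier H" "g \<in> hcarrier H" for h g
    using that assms
    by (intro T.eqI) (simp_all add: ip_tensor T.ip_add_left H.ip_add_left algebra_simps)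
  show "tensor (a *\<^sub>C h) f = a *\<^sub>C tensor h f" if "h \<in> hcarrier H" for h a
    using that assms by (intro T.eqI) (simp_all add: ip_tensor T.ip_scale_left H.ip_scale_left)
  show "hnorm T (tensor h f) \<le> hnorm F f * hnorm H h" if "h \<in> hcarrier H" for h
    using tensor_norm_le[OF that assms] by (simp add: mult.commute)
qed (use assms in simp)

lemma bounded_tensor_right:
  assumes "h \<in> hcarrier H"
  shows "bounded_op F T (tensor h)"
  unfolding bounded_op_def linear_op_def
proof (intro conjI ballI allI exI)
  show "tensor h (f + g) = tensor h f + tensor h g" if "f \<in> hcarrier F" "g \<in> hcarrier F" for f g
    using that assms
    by (intro T.eqI) (simp_all add: ip_tensor T.ip_add_left F.ip_add_left algebra_simps)
  show "tensor h (a *\<^sub>C f) = a *\<^sub>C tensor h f" if "f \<in> hcarrier F" for f a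
    using that assms by (intro T.eqI) (simp_all add: ip_tensor T.ip_scale_left F.ip_scale_left)
  show "hnorm T (tensor h f) \<le> hnorm H h * hnorm F f" if "f \<in> hcarrier F" for f
    using tensor_norm_le[OF assms that] .
qed (use assms in simp)

text \<open>\<open>tensor h f\<close> is known only against the \<open>E p\<close>. The adjoint of
  \<open>\<lambda>g. tensor g (l x)\<close> sends it to a multiple of \<open>h\<close>, which frees
  the first factor; then the adjoint of \<open>tensor g\<close> sends it to a multiple of
  \<open>f\<close> and frees the second.\<close>

lemma inner_tensor:
  assumes g: "g \<in> hcarrier H" and h: "h \<in> hcarrier H" and e: "e \<in> hcarrier F" and f: "f \<in> hcarrier F"
  shows "hinner T (tensor g e) (tensor h f) = hinner H g h * hinner F e f"
proof -
  note hilbert = H.hilbert_space_axioms F.hilbert_space_axioms T.hilbert_space_axioms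
  have u: "tensor h f \<in> hcarrier T"
    using h f by simp
  have left: "hinner T (tensor g (l x)) (tensor h f) = hinner H g h * hinner F (l x) f" for x
  proof -
    let ?m = "hadj H T (\<lambda>g. tensor g (l x)) (tensor h f)"
    note A = bounded_tensor_left[OF F.family_in, of x]
    have "?m = hinner F f (l x) *\<^sub>C h"
    proof (rule H.eqI')
      fix z
      have "hinner H (k z) ?m = hinner T (E (z, x)) (tensor h f)"
        using ip_hadj_right[OF hilbert(1,3) A u, of "k z"] by (simp add: tensor_family_eq)
      also have "\<dots> = cnj (hinner H h (k z) * hinner F f (l x))"
        using T.ip_commute[OF T.family_in u] by (simp add: ip_tensor h f)
      also have "\<dots> = hinner H (k z) (hinner F f (l x) *\<^sub>C h)"
        using h H.ip_commute[OF H.family_in h] by (simp add: H.ip_scale_right)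
      finally show "hinner H (k z) ?m = hinner H (k z) (hinner F f (l x) *\<^sub>C h)" .
    qed (use hadj_in[OF hilbert(1,3) A u] h in auto)
    then show ?thesis
      using ip_hadj_right[OF hilbert(1,3) A u g] g h F.ip_commute[OF F.family_in f]
      by (simp add: H.ip_scale_right mult.commute)
  qed
  let ?m = "hadj F T (tensor g) (tensor h f)"
  note A = bounded_tensor_right[OF g]
  have "?m = hinner H h g *\<^sub>C f"
  proof (rule F.eqI')
    fix x
    show "hinner F (l x) ?m = hinner F (l x) (hinner H h g *\<^sub>C f)"
      using ip_hadj_right[OF hilbert(2,3) A u, of "l x"] H.ip_commute[OF g h] f
      by (simp add: left F.ip_scale_right)
  qed (use hadj_in[OF hilbert(2,3) A u] f in auto)
  then show ?thesis
    using ip_hadj_right[OF hilbert(2,3) A u e] e f H.ip_commute[OF g h]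
    by (simp add: F.ip_scale_right)
qed

theorem tensor_product: "hilbert_tensor_product H F T tensor"
proof
  show "linear_op H T (\<lambda>h. tensor h x)" if "x \<in> hcarrier F" for x
    using bounded_tensor_left[OF that] by (simp add: bounded_op_def)
  show "linear_op F T (tensor h)" if "h \<in> hcarrier H" for h
    using bounded_tensor_right[OF that] by (simp add: bounded_op_def)
  show "hinner T (tensor h x) (tensor g y) = hinner H h g * hinner F x y"
    if "h \<in> hcarrier H" "g \<in> hcarrier H" "x \<in> hcarrier F" "y \<in> hcarrier F" for h g x y
    using that by (intro inner_tensor)
  let ?S = "cvec.span {tensor h x |h x. h \<in> hcarrier H \<and> x \<in> hcarrier F}"
  have "range E \<subseteq> {tensor h x |h x. h \<in> hcarrier H \<and> x \<in> hcarrier F}"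
  proof (intro image_subsetI)
    show "E p \<in> {tensor h x |h x. h \<in> hcarrier H \<and> x \<in> hcarrier F}" for p
      using tensor_family_eq[of "fst p" "snd p"] H.family_in F.family_in by (simp, metis)
  qed
  then have "cvec.span (range E) \<subseteq> ?S"
    by (rule cvec.span_mono)
  moreover have "?S \<subseteq> hcarrier T"
    by (intro cvec.span_minimal T.carrier_subspace) auto
  ultimately show "hdense T ?S"
    using dense unfolding hdense_def by (meson subsetD)
qed

text \<open>The operator \<open>A \<otimes> I\<close> is obtained as the adjoint of
  \<open>E (z, x) \<mapsto> tensor (hadj H H A (k z)) (l x)\<close>; the work is to bound that map
  by the constant of \<open>A\<close>.\<close>

lemma tensor_operator:
  assumes A: "bounded_op H H A"
  obtains AT where "bounded_op T T AT"
    "\<And>h f. \<lbrakk>h \<in> hcarrier H; f \<in> hcarrier F\<rbrakk> \<Longrightarrow> AT (tensor h f) = tensor (A h) f"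
    "\<And>u z x. u \<in> hcarrier T \<Longrightarrow> hinner T (AT u) (E (z, x)) = hinner T u (tensor (hadj H H A (k z)) (l x))"
proof -
  note hilbert = H.hilbert_space_axioms
  let ?B = "hadj H H A"
  obtain C where C: "0 \<le> C" "\<And>x. x \<in> hcarrier H \<Longrightarrow> hnorm H (A x) \<le> C * hnorm H x"
    using bounded_op_norm[OF H.inner_product_space_axioms A] by metis
  have B_in: "?B h \<in> hcarrier H" if "h \<in> hcarrier H" for h
    using hadj_in[OF hilbert hilbert A that] .
  have B_norm: "hnorm H (?B h) \<le> C * hnorm H h" if "h \<in> hcarrier H" for h
    using hadj_norm_le[OF hilbert hilbert A that C] .
  have ip_B: "hinner H u (?B h) = hinner H (A u) h" if "h \<in> hcarrier H" "u \<in> hcarrier H" for h u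
    using ip_hadj_right[OF hilbert hilbert A that] .
  \<comment> \<open>Semidefinite because \<open>?B\<close> is bounded by \<open>C\<close>, and
    possibly degenerate. Its Schur product with the form of \<open>F\<close> supplies the
    bound.\<close>
  define G where "G = \<lparr>hcarrier = hcarrier H,
    hinner = (\<lambda>h g. of_real (C\<^sup>2) * hinner H h g - hinner H (?B h) (?B g))\<rparr>"
  note B = bounded_hadj[OF hilbert hilbert A]
  have "semi_inner_product_space G"
  proof
    show "0 \<le> Re (hinner G h h)" if "h \<in> hcarrier G" for h
    proof -
      have "(hnorm H (?B h))\<^sup>2 \<le> (C * hnorm H h)\<^sup>2"
        using that B_in B_norm by (intro power_mono) (auto simp: G_def)
      then show ?thesis
        using that B_in by (simp add: G_def H.ip_self power_mult_distrib flip: of_real_power)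
    qed
    show "hinner G h g = cnj (hinner G g h)" if "h \<in> hcarrier G" "g \<in> hcarrier G" for h g
      using that H.ip_commute[of h g] H.ip_commute[of "?B h" "?B g"] B_in by (simp add: G_def)
  qed (simp_all add: G_def H.carrier_subspace H.ip_add_left H.ip_scale_left
      bounded_op_add[OF B] bounded_op_scale[OF B] B_in
      algebra_simps)
  then interpret K: positive_kernel "\<lambda>p q. hinner G (k (fst p)) (k (fst q)) * hinner F (l (snd p)) (l (snd q))"
    by (intro product_kernel F.semi_inner_product_space_axioms) (auto simp: G_def)
  define g where "g p = tensor (?B (k (fst p))) (l (snd p))" for p
  have g_in: "g p \<in> hcarrier T" for p
    by (simp add: g_def B_in)
  have "\<exists>AT. bounded_op T T AT \<and> (\<forall>u\<in>hcarrier T. \<forall>p. hinner T (AT u) (E p) = hinner T u (g p))"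
  proof (rule T.coefficient_operator[OF T.hilbert_space_axioms g_in C(1)])
    fix c :: "'x \<times> 'y \<Rightarrow> complex"
    assume c: "c \<in> fsupp"
    \<comment> \<open>Written out, positivity of the Schur product is the wanted inequality between
      squared norms.\<close>
    have "gram_form (\<lambda>p q. hinner G (k (fst p)) (k (fst q)) * hinner F (l (snd p)) (l (snd q))) c c
        = of_real (C\<^sup>2) * gram_form (\<lambda>p q. hinner T (E p) (E q)) c c
          - gram_form (\<lambda>p q. hinner T (g p) (g q)) c c"
      unfolding gram_form_def sum_distrib_left sum_subtractf[symmetric]
      by (intro sum.cong refl) (simp add: G_def gram g_def inner_tensor B_in algebra_simps)
    also have "\<dots> = of_real ((C * hnorm T (lincomb E c))\<^sup>2 - (hnorm T (lincomb g c))\<^sup>2)"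
      using T.ip_lincomb[of E E c c] T.ip_lincomb[of g g c c] g_in
      by (simp add: T.lincomb_in power_mult_distrib flip: T.ip_self)
        (simp add: T.lincomb_in T.ip_self)
    finally have "(hnorm T (lincomb g c))\<^sup>2 \<le> (C * hnorm T (lincomb E c))\<^sup>2"
      using K.positive[OF c] by simp
    then show "hnorm T (lincomb g c) \<le> C * hnorm T (lincomb E c)"
      by (rule power2_le_imp_le) (simp add: C(1) T.lincomb_in)
  qed
  then obtain AT where AT: "bounded_op T T AT"
    and ip_AT: "\<And>u p. u \<in> hcarrier T \<Longrightarrow> hinner T (AT u) (E p) = hinner T u (g p)"
    by blast
  have "AT (tensor h f) = tensor (A h) f" if h: "h \<in> hcarrier H" and f: "f \<in> hcarrier F" for h f
  proof (rule T.eqI)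
    have Ah: "A h \<in> hcarrier H"
      by (rule bounded_op_in[OF A h])
    show "AT (tensor h f) \<in> hcarrier T" "tensor (A h) f \<in> hcarrier T"
      using h f Ah by (simp_all add: bounded_op_in[OF AT])
    show "hinner T (AT (tensor h f)) (E p) = hinner T (tensor (A h) f) (E p)" for p
      using h f Ah by (simp add: ip_AT g_def inner_tensor B_in ip_B ip_tensor)
  qed
  then show thesis
    using that AT ip_AT by (simp add: g_def)
qed

end

section \<open>Combining bounded operators\<close>

lemma hadj_eigen:
  assumes "hilbert_space H" "bounded_op H H A" "e \<in> hcarrier H"
    and "\<And>u. u \<in> hcarrier H \<Longrightarrow> hinner H (A u) e = c * hinner H u e"
  shows "hadj H H A e = cnj c *\<^sub>C e"
proof -
  interpret hilbert_space H by fact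
  show ?thesis
    using assms
    by (intro eqI_ip_diff) (simp_all add: hadj_in ip_hadj_right ip_scale_right)
qed

lemma bounded_op_id: "bounded_op H H id"
  by (auto simp: bounded_op_def linear_op_def intro: exI[of _ 1])

lemma bounded_op_comp:
  assumes "inner_product_space H" "inner_product_space K"
    and A: "bounded_op H K A" and B: "bounded_op K L B"
  shows "bounded_op H L (B \<circ> A)"
proof -
  obtain C where C: "0 \<le> C" "\<And>x. x \<in> hcarrier H \<Longrightarrow> hnorm K (A x) \<le> C * hnorm H x"
    using bounded_op_norm[OF assms(1) A] by metis
  obtain D where D: "0 \<le> D" "\<And>x. x \<in> hcarrier K \<Longrightarrow> hnorm L (B x) \<le> D * hnorm K x"
    using bounded_op_norm[OF assms(2) B] by metis
  have "hnorm L ((B \<circ> A) x) \<le> (D * C) * hnorm H x" if x: "x \<in> hcarrier H" for x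
    using D(2)[OF bounded_op_in[OF A x]] mult_left_mono[OF C(2)[OF x] D(1)] by (simp add: mult.assoc)
  moreover have "linear_op H L (B \<circ> A)"
    using A B by (simp add: bounded_op_def linear_op_def)
  ultimately show ?thesis
    unfolding bounded_op_def by blast
qed

lemma bounded_op_zero:
  assumes "inner_product_space K"
  shows "bounded_op H K (\<lambda>x. 0)"
proof -
  interpret K: inner_product_space K by fact
  show ?thesis
    by (auto simp: bounded_op_def linear_op_def intro: exI[of _ 0])
qed

lemma bounded_op_plus:
  assumes "inner_product_space H" "inner_product_space K"
    and A: "bounded_op H K A" and B: "bounded_op H K B"
  shows "bounded_op H K (\<lambda>x. A x + B x)"
proof -
  interpret K: inner_product_space K by fact
  obtain C where C: "0 \<le> C" "\<And>x. x \<in> hcarrier H \<Longrightarrow> hnorm K (A x) \<le> C * hnorm H x"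
    using bounded_op_norm[OF assms(1) A] by metis
  obtain D where D: "0 \<le> D" "\<And>x. x \<in> hcarrier H \<Longrightarrow> hnorm K (B x) \<le> D * hnorm H x"
    using bounded_op_norm[OF assms(1) B] by metis
  have "hnorm K (A x + B x) \<le> (C + D) * hnorm H x" if x: "x \<in> hcarrier H" for x
    using K.norm_triangle[OF bounded_op_in[OF A x] bounded_op_in[OF B x]] C(2)[OF x] D(2)[OF x]
    by (simp add: distrib_right)
  moreover have "linear_op H K (\<lambda>x. A x + B x)"
    using A B by (simp add: bounded_op_def linear_op_def scaleC_add_right algebra_simps)
  ultimately show ?thesis
    unfolding bounded_op_def by blast
qed

lemma bounded_op_scaleC:
  assumes "inner_product_space H" "inner_product_space K" and A: "bounded_op H K A"
  shows "bounded_op H K (\<lambda>x. c *\<^sub>C A x)"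
proof -
  interpret K: inner_product_space K by fact
  obtain C where C: "0 \<le> C" "\<And>x. x \<in> hcarrier H \<Longrightarrow> hnorm K (A x) \<le> C * hnorm H x"
    using bounded_op_norm[OF assms(1) A] by metis
  have "hnorm K (c *\<^sub>C A x) \<le> (cmod c * C) * hnorm H x" if x: "x \<in> hcarrier H" for x
    using K.norm_scale[OF bounded_op_in[OF A x], of c] mult_left_mono[OF C(2)[OF x], of "cmod c"]
    by (simp add: mult.assoc)
  moreover have "linear_op H K (\<lambda>x. c *\<^sub>C A x)"
    using A by (simp add: bounded_op_def linear_op_def scaleC_add_right scaleC_scaleC mult.commute)
  ultimately show ?thesis
    unfolding bounded_op_def by blast
qed

lemma bounded_op_sum:
  assumes "inner_product_space H" "inner_product_space K"
    and "\<And>i. i \<in> I \<Longrightarrow> bounded_op H K (A i)"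
  shows "bounded_op H K (\<lambda>x. \<Sum>i\<in>I. A i x)"
  using assms(3)
proof (induction I rule: infinite_finite_induct)
  case (insert i I)
  then show ?case
    using bounded_op_plus[OF assms(1,2), of "A i" "\<lambda>x. \<Sum>i\<in>I. A i x"] by simp
qed (simp_all add: bounded_op_zero assms)

text \<open>If \<open>g\<close> in the span is close to \<open>f\<close>, then \<open>f\<close> is
  orthogonal to \<open>g\<close>, so the squared norm of \<open>f\<close> equals
  \<open>hinner H f (f - g)\<close> and Cauchy-Schwarz makes \<open>f\<close> small.\<close>

lemma total_of_dense:
  assumes "hilbert_space H" and S: "hdense H (cvec.span S)"
    and f: "f \<in> hcarrier H" and orth: "\<And>s. s \<in> S \<Longrightarrow> hinner H f s = 0"
  shows "f = 0"
proof -
  interpret hilbert_space H by fact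
  have "S \<subseteq> hcarrier H"
    using S cvec.span_superset unfolding hdense_def by blast
  moreover have "cvec.subspace {g \<in> hcarrier H. hinner H f g = 0}"
    using f by (intro cvec.subspaceI) (auto simp: ip_add_right ip_scale_right)
  ultimately have span: "cvec.span S \<subseteq> {g \<in> hcarrier H. hinner H f g = 0}"
    using orth by (intro cvec.span_minimal) auto
  have "hnorm H f \<le> 0 + r" if r: "0 < r" for r
  proof -
    obtain g where g: "g \<in> hcarrier H" "hinner H f g = 0" "hnorm H (f - g) < r"
      using S f r span unfolding hdense_def by blast
    have "hnorm H f * hnorm H f = cmod (hinner H f (f - g))"
      using f g by (simp add: ip_diff_right ip_self power2_eq_square norm_mult)
    also have "\<dots> \<le> hnorm H f * hnorm H (f - g)"
      using f g by (intro cauchy_schwarz) auto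
    finally have "hnorm H f \<le> hnorm H (f - g) \<or> hnorm H f = 0"
      using f norm_nonneg[OF f] by (auto simp: mult_le_cancel_left order_less_le)
    then show ?thesis
      using g(3) r by auto
  qed
  then have "hnorm H f \<le> 0"
    by (rule field_le_epsilon)
  then show ?thesis
    using norm_eq_zero[OF f] norm_nonneg[OF f] by linarith
qed

section \<open>Hereditary functional calculus\<close>

text \<open>Used with three kinds of \<open>\<pi>\<close>: module maps and their adjoints, linear
  functionals, and \<open>c \<mapsto> c *\<^sub>C e\<close> for an eigenvector \<open>e\<close>. The
  set \<open>S\<close> confines the hypotheses to a carrier.\<close>

lemma op_power_intertwine:
  assumes A_in: "\<And>i x. x \<in> S \<Longrightarrow> A i x \<in> S"
    and intertwine: "\<And>i x. x \<in> S \<Longrightarrow> \<pi> (A i x) = B i (\<pi> x)"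
    and x: "x \<in> S"
  shows "op_power A p x \<in> S" and "\<pi> (op_power A p x) = op_power B p (\<pi> x)"
proof -
  have pow: "(A i ^^ m) y \<in> S \<and> \<pi> ((A i ^^ m) y) = (B i ^^ m) (\<pi> y)" if "y \<in> S" for i m y
    using that by (induction m) (auto simp: A_in intertwine)
  have "foldr (\<lambda>i S. (A i ^^ p i) \<circ> S) is id x \<in> S
    \<and> \<pi> (foldr (\<lambda>i S. (A i ^^ p i) \<circ> S) is id x) = foldr (\<lambda>i S. (B i ^^ p i) \<circ> S) is id (\<pi> x)" for "is"
    using x by (induction "is") (simp_all add: pow)
  then show "op_power A p x \<in> S" and "\<pi> (op_power A p x) = op_power B p (\<pi> x)"
    unfolding op_power_def by blast+
qed

text \<open>For operators that multiply by scalars, the composition along the sorted index list is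
  the unordered product of \<open>multi_power\<close>.\<close>

lemma op_power_mult: "op_power (\<lambda>i. (*) (z $ i)) p c = multi_power z p * c"
proof -
  have pow: "((*) a ^^ m) b = a ^ m * b" for a b :: complex and m
    by (induction m) simp_all
  have "foldr (\<lambda>i S. ((*) (z $ i) ^^ p i) \<circ> S) is id c = prod_list (map (\<lambda>i. (z $ i) ^ p i) is) * c" for "is"
    by (induction "is") (simp_all add: pow mult.assoc)
  then show ?thesis
    unfolding op_power_def multi_power_def
    using prod.distinct_set_conv_list[of "sorted_list_of_set UNIV" "\<lambda>i. (z $ i) ^ p i"] by simp
qed

lemma op_power_functional:
  fixes \<phi> :: "'a \<Rightarrow> complex"
  assumes "\<And>i x. x \<in> S \<Longrightarrow> A i x \<in> S" "\<And>i x. x \<in> S \<Longrightarrow> \<phi> (A i x) = z $ i * \<phi> x" "x \<in> S"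
  shows "\<phi> (op_power A p x) = multi_power z p * \<phi> x"
  using op_power_intertwine(2)[of S A \<phi> "\<lambda>i. (*) (z $ i)" x p] assms by (simp add: op_power_mult)

text \<open>Intertwining along \<open>c \<mapsto> c *\<^sub>C e\<close>, from multiplication of
  scalars to the operators; hence the hypothesis about all multiples of \<open>e\<close>.\<close>

lemma op_power_eigen:
  fixes e :: "'a::complex_vector"
  assumes "\<And>i c. A i (c *\<^sub>C e) = c *\<^sub>C (cnj (w $ i) *\<^sub>C e)"
  shows "op_power A p e = cnj (multi_power w p) *\<^sub>C e"
proof -
  have "op_power A p (1 *\<^sub>C e) = op_power (\<lambda>i. (*) ((\<chi> i. cnj (w $ i)) $ i)) p 1 *\<^sub>C e"
    by (rule op_power_intertwine(2)[symmetric, where S = UNIV and \<pi> = "\<lambda>c. c *\<^sub>C e"])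
      (simp_all add: assms scaleC_scaleC mult.commute)
  then show ?thesis
    unfolding op_power_mult by (simp add: scaleC_one multi_power_def)
qed

lemma bounded_op_power:
  assumes H: "inner_product_space H" and A: "\<And>i. bounded_op H H (A i)"
  shows "bounded_op H H (op_power A p)"
proof -
  have "bounded_op H H (A i ^^ m)" for i m
    by (induction m) (simp_all only: funpow.simps bounded_op_id bounded_op_comp[OF H H] A)
  then have "bounded_op H H (foldr (\<lambda>i S. (A i ^^ p i) \<circ> S) is id)" for "is"
    by (induction "is") (simp_all add: bounded_op_id bounded_op_comp[OF H H])
  then show ?thesis
    unfolding op_power_def by blast
qed

lemma bounded_hereditary_op:
  assumes "hilbert_space H" and A: "\<And>i. bounded_op H H (A i)"
  shows "bounded_op H H (hereditary_op H a A)"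
proof -
  interpret hilbert_space H by fact
  note H = inner_product_space_axioms
  have "bounded_op H H (\<lambda>x. a p q *\<^sub>C (op_power A p \<circ> op_power (\<lambda>i. hadj H H (A i)) q) x)" for p q
    using assms bounded_hadj[OF assms(1) assms(1) A]
    by (intro bounded_op_scaleC[OF H H] bounded_op_comp[OF H H] bounded_op_power[OF H])
  then show ?thesis
    unfolding hereditary_op_def case_prod_beta by (intro bounded_op_sum[OF H H]) (simp add: o_def)
qed

lemma ip_hereditary_op:
  assumes "hilbert_space H" and A: "\<And>i. bounded_op H H (A i)"
    and x: "x \<in> hcarrier H" and y: "y \<in> hcarrier H"
  shows "hinner H (hereditary_op H a A x) y = (\<Sum>(p, q)\<in>{(p, q). a p q \<noteq> 0}.
    a p q * hinner H (op_power A p (op_power (\<lambda>i. hadj H H (A i)) q x)) y)"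
proof -
  interpret hilbert_space H by fact
  have op_in: "op_power A p (op_power (\<lambda>i. hadj H H (A i)) q x) \<in> hcarrier H" for p q
    by (intro op_power_intertwine(1)[where \<pi> = id] bounded_op_in[OF A]
        bounded_op_in[OF bounded_hadj[OF assms(1) assms(1) A]] x) auto
  show ?thesis
    unfolding hereditary_op_def using y
    by (subst ip_sum_left) (auto simp: op_in ip_scale_left intro!: sum.cong)
qed

text \<open>The adjoint powers act on \<open>e\<close> first and contribute
  \<open>cnj (multi_power w q)\<close>; the remaining powers are absorbed by pairing with
  \<open>f\<close> and contribute \<open>multi_power z p\<close>.\<close>

lemma hereditary_op_eigen:
  assumes "hilbert_space H" and A: "\<And>i. bounded_op H H (A i)"
    and e: "e \<in> hcarrier H" "\<And>i u. u \<in> hcarrier H \<Longrightarrow> hinner H (A i u) e = w $ i * hinner H u e"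
    and f: "f \<in> hcarrier H" "\<And>i u. u \<in> hcarrier H \<Longrightarrow> hinner H (A i u) f = z $ i * hinner H u f"
  shows "hinner H (hereditary_op H a A e) f = hereditary_poly a z w * hinner H e f"
proof -
  interpret hilbert_space H by fact
  have "hadj H H (A i) (c *\<^sub>C e) = c *\<^sub>C (cnj (w $ i) *\<^sub>C e)" for i c
    using bounded_op_scale[OF bounded_hadj[OF assms(1) assms(1) A] e(1)]
      hadj_eigen[OF assms(1) A e(1,2)] by simp
  then have eigen: "op_power (\<lambda>i. hadj H H (A i)) q e = cnj (multi_power w q) *\<^sub>C e" for q
    by (rule op_power_eigen)
  have "hinner H (op_power A p u) f = multi_power z p * hinner H u f" if "u \<in> hcarrier H" for p u
    using that by (intro op_power_functional[where S = "hcarrier H"] bounded_op_in[OF A] f(2))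
  then show ?thesis
    using e f unfolding ip_hereditary_op[OF assms(1) A e(1) f(1)] hereditary_poly_def sum_distrib_right
    by (intro sum.cong) (auto simp: eigen ip_scale_left)
qed

section \<open>Modules over the polydisc algebra\<close>

lemma polydisc_subset: "polydisc \<subseteq> cpolydisc"
  by (auto simp: polydisc_def cpolydisc_def intro: less_imp_le)

lemma open_polydisc: "open (polydisc :: (complex ^ 'n) set)"
proof -
  have "polydisc = (\<Inter>i\<in>UNIV. (\<lambda>z :: complex ^ 'n. z $ i) -` ball 0 1)"
    by (auto simp: polydisc_def)
  also have "open \<dots>"
    by (intro open_INT ballI continuous_open_vimage continuous_intros) auto
  finally show ?thesis .
qed

lemma coord_in_algebra: "coord i \<in> polydisc_algebra"
  unfolding polydisc_algebra_def
proof (intro CollectI conjI allI impI)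
  have "continuous_on cpolydisc (\<lambda>z. z $ i)"
    by (intro continuous_intros)
  then show "continuous_on cpolydisc (coord i)"
    by (rule continuous_on_eq) (simp add: coord_def)
  show "holomorphic_cvec (coord i) polydisc"
    unfolding holomorphic_cvec_def
  proof (intro ballI exI conjI allI)
    fix z :: "complex ^ 'a"
    assume "z \<in> polydisc"
    have "((\<lambda>z. z $ i) has_derivative (\<lambda>v. v $ i)) (at z)"
      by (intro bounded_linear_imp_has_derivative bounded_linear_vec_nth)
    then show "(coord i has_derivative (\<lambda>v. v $ i)) (at z)"
      using open_polydisc \<open>z \<in> polydisc\<close>
      by (rule has_derivative_transform_within_open)
        (use polydisc_subset in \<open>auto simp: coord_def\<close>)
  qed simp
qed (simp add: coord_def)

lemma polydisc_algebra_mult: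
  assumes "\<phi> \<in> polydisc_algebra" "\<psi> \<in> polydisc_algebra"
  shows "\<phi> * \<psi> \<in> polydisc_algebra"
proof -
  have "holomorphic_cvec (\<phi> * \<psi>) polydisc"
    unfolding holomorphic_cvec_def
  proof
    fix z :: "complex ^ 'a"
    assume z: "z \<in> polydisc"
    obtain \<phi>' where \<phi>': "(\<phi> has_derivative \<phi>') (at z)" "\<And>c v. \<phi>' (c *s v) = c * \<phi>' v"
      using assms(1) z unfolding polydisc_algebra_def holomorphic_cvec_def by blast
    obtain \<psi>' where \<psi>': "(\<psi> has_derivative \<psi>') (at z)" "\<And>c v. \<psi>' (c *s v) = c * \<psi>' v"
      using assms(2) z unfolding polydisc_algebra_def holomorphic_cvec_def by blast
    have "((\<phi> * \<psi>) has_derivative (\<lambda>v. \<phi> z * \<psi>' v + \<phi>' v * \<psi> z)) (at z)"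
      unfolding times_fun_def by (rule has_derivative_mult[OF \<phi>'(1) \<psi>'(1)])
    moreover have "\<phi> z * \<psi>' (c *s v) + \<phi>' (c *s v) * \<psi> z = c * (\<phi> z * \<psi>' v + \<phi>' v * \<psi> z)" for c v
      by (simp add: \<phi>'(2) \<psi>'(2) algebra_simps)
    ultimately show "\<exists>f'. ((\<phi> * \<psi>) has_derivative f') (at z) \<and> (\<forall>c v. f' (c *s v) = c * f' v)"
      by blast
  qed
  then show ?thesis
    using assms by (auto simp: polydisc_algebra_def times_fun_def intro: continuous_on_mult)
qed

lemma (in hilbert_module) bounded_act: "\<phi> \<in> polydisc_algebra \<Longrightarrow> bounded_op M M (act \<phi>)"
  using act_linear act_bounded unfolding bounded_op_def by blast

section \<open>Kernel functions of the scalar module\<close>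

context rk_hilbert_module
begin

text \<open>Extended by the zero vector off the polydisc, so that the family is indexed by a whole
  type.\<close>

definition kernel :: "complex ^ 'n \<Rightarrow> complex ^ 'n \<Rightarrow> complex"
  where "kernel w = (if w \<in> polydisc then (\<lambda>z. if z \<in> polydisc then k z w else 0) else 0)"

lemma kernel_family_in: "kernel w \<in> hcarrier H"
  by (simp add: kernel_def kernel_in)

lemma ip_kernel: "h \<in> hcarrier H \<Longrightarrow> hinner H h (kernel w) = h w"
  by (simp add: kernel_def zero_outside flip: reproducing)

sublocale kernel: total_family H kernel
  by unfold_locales (auto simp: kernel_family_in ip_kernel)

lemma ip_act_kernel:
  assumes "h \<in> hcarrier H" "\<phi> \<in> polydisc_algebra"
  shows "hinner H (\<phi> * h) (kernel z) = \<phi> z * hinner H h (kernel z)"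
proof -
  have "\<phi> * h \<in> hcarrier H"
    using act_linear[OF assms(2)] assms(1) by (simp add: linear_op_def)
  then show ?thesis
    using assms by (simp add: ip_kernel)
qed

end

section \<open>Dilations force positivity\<close>

text \<open>Since \<open>1 / 0 = 0\<close>, the equation for \<open>1 / k z w\<close> would not
  express that \<open>k\<close> has an inverse; nonvanishing is therefore stated with it.\<close>

locale inverse_polynomial_module = rk_hilbert_module H k
  for H :: "(complex ^ 'n::{finite,linorder} \<Rightarrow> complex) hspace" and k +
  fixes a :: "('n \<Rightarrow> nat) \<Rightarrow> ('n \<Rightarrow> nat) \<Rightarrow> complex"
  assumes inverse_kernel: "\<lbrakk>z \<in> polydisc; w \<in> polydisc\<rbrakk>
    \<Longrightarrow> k z w \<noteq> 0 \<and> 1 / k z w = hereditary_poly a z w"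
begin

lemma ip_coord_kernel:
  assumes "h \<in> hcarrier H"
  shows "hinner H (coord i * h) (kernel z) = z $ i * hinner H h (kernel z)"
proof (cases "z \<in> polydisc")
  case True
  then show ?thesis
    using ip_act_kernel[OF assms coord_in_algebra] polydisc_subset by (auto simp: coord_def)
next
  case False
  then have "kernel z = 0"
    by (simp add: kernel_def)
  then show ?thesis
    using assms act_linear[OF coord_in_algebra, of i] by (simp add: linear_op_def)
qed

text \<open>The arguments swap: \<open>kernel w\<close> fixes the second argument of
  \<open>k\<close>, so pairing it with \<open>kernel z\<close> gives \<open>k z w\<close>.\<close>

lemma hereditary_poly_kernel:
  assumes "z \<in> polydisc" "w \<in> polydisc"
  shows "hereditary_poly a z w * hinner H (kernel w) (kernel z) = 1"
proof -
  have "hinner H (kernel w) (kernel z) = k z w"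
    using assms by (simp add: ip_kernel kernel_family_in) (simp add: kernel_def)
  then show ?thesis
    using inverse_kernel[OF assms] by (simp flip: conjunct2[OF inverse_kernel[OF assms]])
qed

text \<open>\<open>H\<close> is not assumed to contain the constants. The hereditary operator
  applied to \<open>kernel 0\<close> has the value \<open>hereditary_poly a z 0 * k z 0\<close>,
  which is 1, at every \<open>z\<close> in the polydisc.\<close>

lemma obtain_one:
  obtains one where "one \<in> hcarrier H" "\<And>z. z \<in> polydisc \<Longrightarrow> hinner H one (kernel z) = 1"
proof
  define A where "A = (\<lambda>i h. coord i * h :: (complex, 'n) vec \<Rightarrow> complex)"
  have A: "bounded_op H H (A i)" for i
    unfolding A_def by (rule bounded_act[OF coord_in_algebra])
  show "hereditary_op H a A (kernel 0) \<in> hcarrier H"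
    by (intro bounded_op_in[OF bounded_hereditary_op[OF hilbert_space_axioms A]]
        kernel_family_in)
  fix z :: "(complex, 'n) vec"
  assume "z \<in> polydisc"
  moreover have "0 \<in> (polydisc :: (complex, 'n) vec set)"
    by (simp add: polydisc_def)
  moreover have "hinner H (hereditary_op H a A (kernel 0)) (kernel z)
      = hereditary_poly a z 0 * hinner H (kernel 0) (kernel z)"
    by (rule hereditary_op_eigen[OF hilbert_space_axioms A])
      (simp_all only: A_def ip_coord_kernel kernel_family_in)
  ultimately show "hinner H (hereditary_op H a A (kernel 0)) (kernel z) = 1"
    by (simp add: hereditary_poly_kernel)
qed

text \<open>
  If \<open>\<pi>\<close> is a coisometric module map and \<open>u = \<pi>\<^sup>* x\<close>, then \<open>\<langle>D x, x\<rangle> = \<langle>D' u, u\<rangle>\<close> for the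
  hereditary operators \<open>D\<close> of \<open>M\<close> and \<open>D'\<close> of \<open>T\<close>. Since \<open>D'\<close> is the projection onto the constant
  functions tensored with the identity, \<open>\<langle>D' u, u\<rangle> = \<parallel>B u\<parallel>\<^sup>2\<close> where \<open>B\<close> is the adjoint of
  \<open>x \<mapsto> 1 \<otimes> x\<close>.
\<close>

theorem positive_of_dilation:
  assumes "hilbert_module M act" and dilation: "is_dilation H F T t M act"
  shows "positive_op M (hereditary_op M a (\<lambda>i. act (coord i)))"
proof -
  interpret M: hilbert_module M act by fact
  obtain actT \<pi> where "hilbert_tensor_product H F T t" and TA: "tensor_action H F T t actT"
    and map: "module_map T actT M act \<pi>" and coisometry: "coisometry T M \<pi>"
    using dilation unfolding is_dilation_def by blast
  interpret tensor: hilbert_tensor_product H F T t by fact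
  note hilbert = hilbert_space_axioms tensor.F.hilbert_space_axioms
    tensor.T.hilbert_space_axioms M.hilbert_space_axioms
  have t_in: "t h x \<in> hcarrier T" if "h \<in> hcarrier H" "x \<in> hcarrier F" for h x
    using tensor.linear_left[OF that(2)] that(1) by (simp add: linear_op_def)
  have norm_t: "hnorm T (t h x) = hnorm H h * hnorm F x" if "h \<in> hcarrier H" "x \<in> hcarrier F" for h x
    using that by (simp add: hnorm_def[of T] tensor.inner_tensor ip_self tensor.F.ip_self
        real_sqrt_mult)
  have left: "bounded_op H T (\<lambda>h. t h x)" if "x \<in> hcarrier F" for x
    unfolding bounded_op_def using tensor.linear_left[OF that]
    by (auto simp: norm_t that intro!: exI[of _ "hnorm F x"])
  have right: "bounded_op F T (t h)" if "h \<in> hcarrier H" for h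
    unfolding bounded_op_def using tensor.linear_right[OF that]
    by (auto simp: norm_t that intro!: exI[of _ "hnorm H h"])

  \<comment> \<open>Indices with \<open>snd p\<close> outside the carrier of \<open>F\<close> get
    the vector 0, so that the family is again indexed by a whole type.\<close>
  define E where "E p = (if snd p \<in> hcarrier F then t (kernel (fst p)) (snd p) else 0)" for p
  interpret T: total_family T E
  proof
    show E_in: "E p \<in> hcarrier T" for p
      by (simp add: E_def t_in kernel_family_in)
    fix f
    assume f: "f \<in> hcarrier T" and orth: "\<And>p. hinner T f (E p) = 0"
    \<comment> \<open>Orthogonality to \<open>t (kernel z) x\<close> for all \<open>z\<close> means
      that the adjoint of \<open>\<lambda>h. t h x\<close> sends \<open>f\<close> to a function
      vanishing everywhere.\<close>
    have slice: "hinner T (t h x) f = 0" if h: "h \<in> hcarrier H" and x: "x \<in> hcarrier F" for h x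
    proof -
      let ?m = "hadj H T (\<lambda>h. t h x) f"
      have "?m = 0"
      proof (rule kernel.eqI')
        fix z
        have "hinner H (kernel z) ?m = hinner T (t (kernel z) x) f"
          by (rule ip_hadj_right[OF hilbert(1,3) left[OF x] f kernel_family_in])
        also have "\<dots> = cnj (hinner T f (E (z, x)))"
          using tensor.T.ip_commute[OF _ f, of "t (kernel z) x"] x
          by (simp add: E_def t_in kernel_family_in)
        finally show "hinner H (kernel z) ?m = hinner H (kernel z) 0"
          by (simp add: orth kernel_family_in)
      qed (use hadj_in[OF hilbert(1,3) left[OF x] f] in auto)
      then show ?thesis
        using ip_hadj_right[OF hilbert(1,3) left[OF x] f h] h by simp
    qed
    show "f = 0"
    proof (rule total_of_dense[OF hilbert(3) tensor.total f])
      fix s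
      assume "s \<in> {t h x |h x. h \<in> hcarrier H \<and> x \<in> hcarrier F}"
      then show "hinner T f s = 0"
        using slice tensor.T.ip_commute[OF f] t_in by fastforce
    qed
  qed

  define A where "A i = actT (coord i)" for i
  have A: "bounded_op T T (A i)" for i
    using TA coord_in_algebra unfolding tensor_action_def A_def by blast
  have A_t: "A i (t h x) = t (coord i * h) x" if "h \<in> hcarrier H" "x \<in> hcarrier F" for i h x
    using TA coord_in_algebra that unfolding tensor_action_def A_def by blast
  have coord_mult: "coord i * h \<in> hcarrier H" if "h \<in> hcarrier H" for i h
    using act_linear[OF coord_in_algebra] that by (simp add: linear_op_def)
  \<comment> \<open>The action is known on elementary tensors only. Testing on the family shows that
    \<open>E p\<close> is an eigenvector of the adjoint, and this yields the relation for every
    \<open>u\<close>.\<close>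
  have A_eigen: "hinner T (A i u) (E p) = fst p $ i * hinner T u (E p)"
    if u: "u \<in> hcarrier T" for i u p
  proof -
    have "hadj T T (A i) (E p) = cnj (fst p $ i) *\<^sub>C E p"
    proof (rule T.eqI')
      fix q
      have "hinner T (A i (E q)) (E p) = fst p $ i * hinner T (E q) (E p)"
        using bounded_op_scale[OF A tensor.T.zero_in, of i 0]
        by (auto simp: E_def A_t kernel_family_in tensor.inner_tensor coord_mult ip_coord_kernel t_in)
      then show "hinner T (E q) (hadj T T (A i) (E p)) = hinner T (E q) (cnj (fst p $ i) *\<^sub>C E p)"
        by (simp add: ip_hadj_right[OF hilbert(3,3) A] tensor.T.ip_scale_right)
    qed (simp_all add: hadj_in[OF hilbert(3,3) A])
    then show ?thesis
      using ip_hadj_right[OF hilbert(3,3) A, of "E p" u i] u by (simp add: tensor.T.ip_scale_right)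
  qed
  define D where "D = hereditary_op T a A"
  have D: "bounded_op T T D"
    unfolding D_def by (rule bounded_hereditary_op[OF hilbert(3) A])
  obtain one where one: "one \<in> hcarrier H"
    and one_eval: "\<And>z. z \<in> polydisc \<Longrightarrow> hinner H one (kernel z) = 1"
    using obtain_one by blast
  have kernel_one: "hinner H (kernel z) one = 1" if "z \<in> polydisc" for z
    using ip_commute[OF kernel_family_in one] one_eval[OF that] by simp
  define B where "B = hadj F T (t one)"
  have B_in: "B u \<in> hcarrier F" if "u \<in> hcarrier T" for u
    unfolding B_def by (rule hadj_in[OF hilbert(2,3) right[OF one] that])
  \<comment> \<open>Against \<open>E q\<close> the polynomial cancels the kernel factor and only the
    inner product in \<open>F\<close> remains; \<open>t one x\<close> has the same entries.\<close>
  have adj_D: "hadj T T D (t (kernel z) x) = t one x" if z: "z \<in> polydisc" and x: "x \<in> hcarrier F" for z x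
  proof (rule T.eqI')
    fix q
    have tz: "t (kernel z) x = E (z, x)"
      by (simp add: E_def x)
    have "hinner T (D (E q)) (E (z, x)) = hereditary_poly a z (fst q) * hinner T (E q) (E (z, x))"
      unfolding D_def by (rule hereditary_op_eigen[OF hilbert(3) A]) (simp_all add: A_eigen)
    also have "\<dots> = hinner T (E q) (t one x)"
    proof (cases "fst q \<in> polydisc \<and> snd q \<in> hcarrier F")
      case True
      then show ?thesis
        using x hereditary_poly_kernel[OF z, of "fst q"]
        by (simp add: E_def tensor.inner_tensor kernel_family_in one kernel_one flip: mult.assoc)
    next
      case False
      then have "E q = 0"
        using bounded_op_scale[OF left zero_in, of "snd q" 0]
        by (auto simp: E_def kernel_def)
      then show ?thesis
        using x one by (simp add: t_in)
    qed
    finally show "hinner T (E q) (hadj T T D (t (kernel z) x)) = hinner T (E q) (t one x)"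
      by (simp add: ip_hadj_right[OF hilbert(3,3) D] tz)
  qed (use x one in \<open>simp_all add: hadj_in[OF hilbert(3,3) D] t_in kernel_family_in\<close>)
  have D_eq: "D u = t one (B u)" if u: "u \<in> hcarrier T" for u
  proof (rule T.eqI)
    fix p
    show "hinner T (D u) (E p) = hinner T (t one (B u)) (E p)"
    proof (cases "fst p \<in> polydisc \<and> snd p \<in> hcarrier F")
      case True
      have "hinner T (D u) (E p) = hinner T u (t one (snd p))"
        using True ip_hadj_right[OF hilbert(3,3) D, of "E p" u] u adj_D[of "fst p" "snd p"]
        by (simp add: E_def t_in kernel_family_in)
      also have "\<dots> = hinner F (B u) (snd p)"
        unfolding B_def using True ip_hadj_left[OF hilbert(2,3) right[OF one] u] by simp
      also have "\<dots> = hinner T (t one (B u)) (E p)"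
        using True by (simp add: E_def tensor.inner_tensor kernel_family_in one one_eval B_in u)
      finally show ?thesis .
    next
      case False
      then have "E p = 0"
        using bounded_op_scale[OF left zero_in, of "snd p" 0]
        by (auto simp: E_def kernel_def)
      then show ?thesis
        using u by (simp add: t_in one B_in bounded_op_in[OF D])
    qed
  qed (simp_all add: t_in one B_in u bounded_op_in[OF D u])
  have D_pos: "hinner T (D u) u = of_real ((hnorm F (B u))\<^sup>2)" if u: "u \<in> hcarrier T" for u
    using ip_hadj_right[OF hilbert(2,3) right[OF one] u B_in[OF u]] B_in[OF u]
    by (simp add: D_eq[OF u] tensor.F.ip_self flip: B_def)

  have \<pi>: "bounded_op T M \<pi>"
    using map by (simp add: module_map_def)
  have \<pi>_act: "\<pi> (A i v) = act (coord i) (\<pi> v)" if "v \<in> hcarrier T" for i v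
    using map coord_in_algebra that unfolding module_map_def A_def by blast
  have M_act: "bounded_op M M (act (coord i))" for i
    by (rule M.bounded_act[OF coord_in_algebra])
  let ?\<pi>' = "hadj T M \<pi>"
  have \<pi>'_in: "?\<pi>' y \<in> hcarrier T" if "y \<in> hcarrier M" for y
    by (rule hadj_in[OF hilbert(3,4) \<pi> that])
  have \<pi>\<pi>': "\<pi> (?\<pi>' y) = y" if "y \<in> hcarrier M" for y
    using coisometry that by (simp add: coisometry_def)
  have adj_in: "hadj M M (act (coord i)) y \<in> hcarrier M" if "y \<in> hcarrier M" for i y
    by (rule hadj_in[OF hilbert(4,4) M_act that])
  have adj_A_in: "hadj T T (A i) u \<in> hcarrier T" if "u \<in> hcarrier T" for i u
    by (rule hadj_in[OF hilbert(3,3) A that])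
  \<comment> \<open>\<open>\<pi>\<close> intertwines the actions, so its adjoint intertwines the
    adjoints in the opposite direction.\<close>
  have \<pi>'_adj: "?\<pi>' (hadj M M (act (coord i)) y) = hadj T T (A i) (?\<pi>' y)" if y: "y \<in> hcarrier M" for i y
  proof (rule tensor.T.eqI_ip_diff)
    fix v
    assume v: "v \<in> hcarrier T"
    show "hinner T v (?\<pi>' (hadj M M (act (coord i)) y)) = hinner T v (hadj T T (A i) (?\<pi>' y))"
      using v y
      by (simp add: ip_hadj_right[OF hilbert(3,4) \<pi>] ip_hadj_right[OF hilbert(3,3) A]
          ip_hadj_right[OF hilbert(4,4) M_act] adj_in \<pi>'_in \<pi>_act bounded_op_in[OF \<pi>] bounded_op_in[OF A])
  qed (simp_all add: \<pi>'_in adj_in adj_A_in y)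
  show ?thesis
    unfolding positive_op_def
  proof
    fix x
    assume x: "x \<in> hcarrier M"
    let ?u = "?\<pi>' x"
    have u: "?u \<in> hcarrier T"
      by (rule \<pi>'_in[OF x])
    \<comment> \<open>Adjoint powers are lifted to \<open>T\<close> along \<open>?\<pi>'\<close> and
      ordinary powers brought down along \<open>\<pi>\<close>; the coisometry identity
      \<open>\<pi> (?\<pi>' y) = y\<close> joins the two.\<close>
    have summand: "hinner M (op_power (\<lambda>i. act (coord i)) p (op_power (\<lambda>i. hadj M M (act (coord i))) q x)) x
        = hinner T (op_power A p (op_power (\<lambda>i. hadj T T (A i)) q ?u)) ?u" for p q
    proof -
      let ?y = "op_power (\<lambda>i. hadj M M (act (coord i))) q x"
      let ?v = "op_power (\<lambda>i. hadj T T (A i)) q ?u"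
      have y: "?y \<in> hcarrier M" and "?\<pi>' ?y = ?v"
        using op_power_intertwine[where S = "hcarrier M" and \<pi> = ?\<pi>'
          and A = "\<lambda>i. hadj M M (act (coord i))" and B = "\<lambda>i. hadj T T (A i)", OF adj_in \<pi>'_adj x]
        by auto
      then have yv: "?y = \<pi> ?v" and v: "?v \<in> hcarrier T"
        using \<pi>\<pi>' \<pi>'_in by metis+
      have "op_power A p ?v \<in> hcarrier T"
        and "\<pi> (op_power A p ?v) = op_power (\<lambda>i. act (coord i)) p (\<pi> ?v)"
        using op_power_intertwine[where S = "hcarrier T" and \<pi> = \<pi>
          and A = A and B = "\<lambda>i. act (coord i)", OF bounded_op_in[OF A] \<pi>_act v]
        by auto
      then show ?thesis
        using ip_hadj_right[OF hilbert(3,4) \<pi> x] by (simp add: yv)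
    qed
    have "hinner M (hereditary_op M a (\<lambda>i. act (coord i)) x) x = hinner T (D ?u) ?u"
      unfolding D_def ip_hereditary_op[OF hilbert(3) A u u] ip_hereditary_op[OF hilbert(4) M_act x x]
      by (simp add: summand)
    then show "hinner M (hereditary_op M a (\<lambda>i. act (coord i)) x) x \<in> \<real>
        \<and> 0 \<le> Re (hinner M (hereditary_op M a (\<lambda>i. act (coord i)) x) x)"
      by (simp add: D_pos[OF u])
  qed
qed

end

section \<open>Quasi-free modules\<close>

lemma ell2_subspace: "cvec.subspace (hcarrier ell2 :: ('m \<Rightarrow> complex) set)"
proof (rule cvec.subspaceI)
  show "u + v \<in> hcarrier ell2" if "u \<in> hcarrier ell2" "v \<in> hcarrier ell2" for u v :: "'m \<Rightarrow> complex"
  proof -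
    have le: "(cmod (u i + v i))\<^sup>2 \<le> 2 * (cmod (u i))\<^sup>2 + 2 * (cmod (v i))\<^sup>2" for i
    proof -
      have "(cmod (u i + v i))\<^sup>2 \<le> (cmod (u i) + cmod (v i))\<^sup>2"
        by (intro power_mono norm_triangle_ineq) simp
      also have "\<dots> \<le> 2 * (cmod (u i))\<^sup>2 + 2 * (cmod (v i))\<^sup>2"
        using sum_squares_bound[of "cmod (u i)" "cmod (v i)"] by (simp add: power2_sum)
      finally show ?thesis .
    qed
    have "(\<lambda>i. 2 * (cmod (u i))\<^sup>2 + 2 * (cmod (v i))\<^sup>2) summable_on UNIV"
      using that by (intro summable_on_add summable_on_cmult_right) (auto simp: ell2_def)
    then have "(\<lambda>i. (cmod (u i + v i))\<^sup>2) summable_on UNIV"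
      by (rule summable_on_comparison_test) (use le in auto)
    then show ?thesis
      by (simp add: ell2_def plus_fun_def)
  qed
  show "c *\<^sub>C v \<in> hcarrier ell2" if "v \<in> hcarrier ell2" for c and v :: "'m \<Rightarrow> complex"
    using that summable_on_cmult_right[of "\<lambda>i. (cmod (v i))\<^sup>2" UNIV "(cmod c)\<^sup>2"]
    by (simp add: ell2_def scaleC_fun_def scaleC_complex_def norm_mult power_mult_distrib)
qed (simp add: ell2_def zero_fun_def)

lemma ell2_norm:
  assumes "v \<in> hcarrier ell2"
  shows "hnorm ell2 v = sqrt (\<Sum>\<^sub>\<infinity>i. (cmod (v i))\<^sup>2)"
proof -
  have "((\<lambda>i. complex_of_real ((cmod (v i))\<^sup>2)) has_sum complex_of_real (\<Sum>\<^sub>\<infinity>i. (cmod (v i))\<^sup>2)) UNIV"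
    using assms by (intro has_sum_of_real has_sum_infsum) (simp add: ell2_def)
  then have "hinner ell2 v v = complex_of_real (\<Sum>\<^sub>\<infinity>i. (cmod (v i))\<^sup>2)"
    by (simp add: ell2_def infsumI flip: complex_norm_square)
  then show ?thesis
    by (simp add: hnorm_def)
qed

lemma ell2_norm_nonneg: "v \<in> hcarrier ell2 \<Longrightarrow> 0 \<le> hnorm ell2 v"
  by (simp add: ell2_norm infsum_nonneg)

lemma ell2_norm_sq: "v \<in> hcarrier ell2 \<Longrightarrow> (hnorm ell2 v)\<^sup>2 = (\<Sum>\<^sub>\<infinity>i. (cmod (v i))\<^sup>2)"
  by (simp add: ell2_norm infsum_nonneg)

lemma ell2_sum_le:
  assumes "v \<in> hcarrier ell2" "finite J"
  shows "(\<Sum>j\<in>J. (cmod (v j))\<^sup>2) \<le> (hnorm ell2 v)\<^sup>2"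
  unfolding ell2_norm_sq[OF assms(1)] using assms
  by (intro finite_sum_le_infsum) (auto simp: ell2_def)

lemma ell2_coordinate_le:
  assumes "v \<in> hcarrier ell2"
  shows "cmod (v j) \<le> hnorm ell2 v"
  by (rule power2_le_imp_le[OF _ ell2_norm_nonneg[OF assms]])
    (use ell2_sum_le[OF assms, of "{j}"] in simp)

text \<open>The index type may be infinite, so coordinatewise limits need the Cauchy property: it
  bounds every finite partial sum for \<open>X n - X m\<close>, uniformly in the finite set, and
  \<open>m\<close> is then sent to infinity.\<close>

lemma ell2_null:
  assumes X: "\<And>n. X n \<in> hcarrier ell2" and "hCauchy ell2 X"
    and lim: "\<And>j. (\<lambda>n. X n j) \<longlonglongrightarrow> 0"
  shows "(\<lambda>n. hnorm ell2 (X n)) \<longlonglongrightarrow> 0"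
proof (rule LIMSEQ_I)
  fix r :: real
  assume r: "0 < r"
  then obtain N where N: "\<And>i j. \<lbrakk>N \<le> i; N \<le> j\<rbrakk> \<Longrightarrow> hnorm ell2 (X i - X j) < r / 2"
    using assms(2) unfolding hCauchy_def by (meson half_gt_zero)
  have le: "hnorm ell2 (X n) \<le> r / 2" if n: "N \<le> n" for n
  proof -
    have fin: "(\<Sum>j\<in>J. (cmod (X n j))\<^sup>2) \<le> (r / 2)\<^sup>2" if J: "finite J" for J
    proof (rule LIMSEQ_le_const2)
      show "(\<lambda>m. \<Sum>j\<in>J. (cmod (X n j - X m j))\<^sup>2) \<longlonglongrightarrow> (\<Sum>j\<in>J. (cmod (X n j))\<^sup>2)"
      proof (intro tendsto_sum tendsto_power tendsto_norm)
        show "(\<lambda>m. X n j - X m j) \<longlonglongrightarrow> X n j" for j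
          using tendsto_diff[OF tendsto_const lim, of "X n j" j] by simp
      qed
      have "(\<Sum>j\<in>J. (cmod (X n j - X m j))\<^sup>2) \<le> (r / 2)\<^sup>2" if m: "N \<le> m" for m
      proof -
        have "(\<Sum>j\<in>J. (cmod ((X n - X m) j))\<^sup>2) \<le> (hnorm ell2 (X n - X m))\<^sup>2"
          by (intro ell2_sum_le J cvec.subspace_diff[OF ell2_subspace] X)
        also have "\<dots> \<le> (r / 2)\<^sup>2"
          using N[OF n m] by (intro power_mono ell2_norm_nonneg cvec.subspace_diff[OF ell2_subspace] X) auto
        finally show ?thesis
          by simp
      qed
      then show "\<exists>N. \<forall>m\<ge>N. (\<Sum>j\<in>J. (cmod (X n j - X m j))\<^sup>2) \<le> (r / 2)\<^sup>2"
        by blast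
    qed
    have "(hnorm ell2 (X n))\<^sup>2 \<le> (r / 2)\<^sup>2"
      unfolding ell2_norm_sq[OF X] using X[of n] fin
      by (intro infsum_le_finite_sums) (auto simp: ell2_def)
    then show ?thesis
      by (rule power2_le_imp_le) (use r in simp)
  qed
  have "norm (hnorm ell2 (X n) - 0) < r" if "N \<le> n" for n
    using le[OF that] r ell2_norm_nonneg[OF X, of n] by simp
  then show "\<exists>no. \<forall>n\<ge>no. norm (hnorm ell2 (X n) - 0) < r"
    by blast
qed

section \<open>The algebraic tensor product as a space of functions\<close>

lemma polydisc_tensor_subspace: "cvec.subspace polydisc_tensor"
  unfolding polydisc_tensor_def by (rule cvec.subspace_span)

lemma polydisc_tensor_eval_in:
  fixes f :: "complex ^ 'n \<Rightarrow> 'm \<Rightarrow> complex"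
  assumes "f \<in> polydisc_tensor"
  shows "f z \<in> hcarrier ell2"
proof -
  have "polydisc_tensor \<subseteq> {f :: complex ^ 'n \<Rightarrow> 'm \<Rightarrow> complex. f z \<in> hcarrier ell2}"
    unfolding polydisc_tensor_def
  proof (rule cvec.span_minimal)
    show "cvec.subspace {f :: complex ^ 'n \<Rightarrow> 'm \<Rightarrow> complex. f z \<in> hcarrier ell2}"
    proof (rule cvec.subspaceI, unfold mem_Collect_eq)
      have "(0 :: complex ^ 'n \<Rightarrow> 'm \<Rightarrow> complex) z = 0"
        by (simp add: zero_fun_def)
      then show "(0 :: complex ^ 'n \<Rightarrow> 'm \<Rightarrow> complex) z \<in> hcarrier ell2"
        using cvec.subspace_0[OF ell2_subspace] by (simp only:)
    next
      fix f g :: "complex ^ 'n \<Rightarrow> 'm \<Rightarrow> complex"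
      assume "f z \<in> hcarrier ell2" "g z \<in> hcarrier ell2"
      moreover have "(f + g) z = f z + g z"
        by (simp add: plus_fun_def)
      ultimately show "(f + g) z \<in> hcarrier ell2"
        using cvec.subspace_add[OF ell2_subspace] by (simp only:)
    next
      fix c and f :: "complex ^ 'n \<Rightarrow> 'm \<Rightarrow> complex"
      assume "f z \<in> hcarrier ell2"
      moreover have "(c *\<^sub>C f) z = c *\<^sub>C f z"
        by (simp add: scaleC_fun_def)
      ultimately show "(c *\<^sub>C f) z \<in> hcarrier ell2"
        using cvec.subspace_scale[OF ell2_subspace] by (simp only:)
    qed
  qed (auto intro: cvec.subspace_scale[OF ell2_subspace])
  then show ?thesis
    using assms by blast
qed

lemma polydisc_tensor_mult:
  fixes f :: "complex ^ 'n \<Rightarrow> 'm \<Rightarrow> complex"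
  assumes \<phi>: "\<phi> \<in> polydisc_algebra" and "f \<in> polydisc_tensor"
  shows "(\<lambda>z. \<phi> z *\<^sub>C f z) \<in> polydisc_tensor"
proof -
  let ?G = "{(\<lambda>z :: complex ^ 'n. \<phi> z *\<^sub>C (v :: 'm \<Rightarrow> complex)) |\<phi> v. \<phi> \<in> polydisc_algebra \<and> v \<in> hcarrier ell2}"
  have "cvec.span ?G \<subseteq> {f. (\<lambda>z. \<phi> z *\<^sub>C f z) \<in> cvec.span ?G}"
  proof (rule cvec.span_minimal)
    show "?G \<subseteq> {f. (\<lambda>z. \<phi> z *\<^sub>C f z) \<in> cvec.span ?G}"
    proof clarify
      fix \<psi> :: "complex ^ 'n \<Rightarrow> complex" and v :: "'m \<Rightarrow> complex"
      assume "\<psi> \<in> polydisc_algebra" "v \<in> hcarrier ell2"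
      moreover from this have "\<phi> * \<psi> \<in> polydisc_algebra"
        using \<phi> by (intro polydisc_algebra_mult)
      ultimately show "(\<lambda>z. \<phi> z *\<^sub>C \<psi> z *\<^sub>C v) \<in> cvec.span ?G"
        by (intro cvec.span_base CollectI exI[of _ "\<phi> * \<psi>"] exI[of _ v])
          (simp add: scaleC_scaleC times_fun_def)
    qed
    show "cvec.subspace {f. (\<lambda>z. \<phi> z *\<^sub>C f z) \<in> cvec.span ?G}"
    proof (rule cvec.subspaceI, unfold mem_Collect_eq)
      show "(\<lambda>z. \<phi> z *\<^sub>C (0 :: complex ^ 'n \<Rightarrow> 'm \<Rightarrow> complex) z) \<in> cvec.span ?G"
      proof -
        have "(\<lambda>z. \<phi> z *\<^sub>C (0 :: complex ^ 'n \<Rightarrow> 'm \<Rightarrow> complex) z) = 0"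
          by (simp add: fun_eq_iff zero_fun_def scaleC_fun_def)
        then show ?thesis
          using cvec.span_zero[of ?G] by (simp only:)
      qed
    next
      fix f g :: "complex ^ 'n \<Rightarrow> 'm \<Rightarrow> complex"
      assume "(\<lambda>z. \<phi> z *\<^sub>C f z) \<in> cvec.span ?G" "(\<lambda>z. \<phi> z *\<^sub>C g z) \<in> cvec.span ?G"
      from cvec.span_add[OF this] show "(\<lambda>z. \<phi> z *\<^sub>C (f + g) z) \<in> cvec.span ?G"
        by (simp add: plus_fun_def scaleC_fun_def scaleC_add_right)
    next
      fix c and f :: "complex ^ 'n \<Rightarrow> 'm \<Rightarrow> complex"
      assume "(\<lambda>z. \<phi> z *\<^sub>C f z) \<in> cvec.span ?G"
      from cvec.span_scale[OF this, of c] show "(\<lambda>z. \<phi> z *\<^sub>C (c *\<^sub>C f) z) \<in> cvec.span ?G"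
        by (simp add: scaleC_fun_def scaleC_scaleC mult.commute)
    qed
  qed
  then show ?thesis
    using assms(2) unfolding polydisc_tensor_def by blast
qed

section \<open>Evaluation vectors of a quasi-free module\<close>

context quasi_free_module
begin

lemma iota_in: "f \<in> polydisc_tensor \<Longrightarrow> \<iota> f \<in> hcarrier M"
  using linear by (simp add: linear_op_def carrier_eq)

lemma iota_diff:
  assumes "f \<in> polydisc_tensor" "g \<in> polydisc_tensor"
  shows "\<iota> (f - g) = \<iota> f - \<iota> g"
proof -
  have "\<iota> ((f - g) + g) = \<iota> (f - g) + \<iota> g"
    using linear assms cvec.subspace_diff[OF polydisc_tensor_subspace assms]
    unfolding linear_op_def carrier_eq by blast
  then show ?thesis
    by simp
qed

lemma norm_iota: "f \<in> polydisc_tensor \<Longrightarrow> hnorm M (\<iota> f) = hnorm Q f"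
  by (simp add: hnorm_def isometric carrier_eq)

lemma iota_orthogonal_zero:
  assumes "g \<in> hcarrier M" "\<And>f. f \<in> polydisc_tensor \<Longrightarrow> hinner M g (\<iota> f) = 0"
  shows "g = 0"
proof (rule total_of_dense[OF H.hilbert_space_axioms _ assms(1)])
  have "cvec.span (\<iota> ` polydisc_tensor) \<subseteq> hcarrier M"
    using iota_in by (intro cvec.span_minimal H.carrier_subspace) auto
  then show "hdense M (cvec.span (\<iota> ` polydisc_tensor))"
    using dense_image cvec.span_superset unfolding hdense_def carrier_eq by (meson subsetD)
qed (use assms(2) in blast)

text \<open>\<open>riesz_factor\<close> with \<open>A = \<iota>\<close> represents the evaluation
  directly from the dense subspace, without extending it to \<open>M\<close> first.\<close>

lemma ex_evaluation_vector:
  assumes w: "w \<in> polydisc"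
  shows "\<exists>e\<in>hcarrier M. \<forall>f\<in>polydisc_tensor. f w j = hinner M (\<iota> f) e"
proof -
  obtain C where C: "\<And>f. f \<in> polydisc_tensor \<Longrightarrow> hnorm ell2 (f w) \<le> C * hnorm Q f"
    using eval_bounded[OF w] by metis
  have "\<exists>e\<in>hcarrier M. (\<forall>f\<in>polydisc_tensor. f w j = hinner M (\<iota> f) e) \<and> (0 \<le> C \<longrightarrow> hnorm M e \<le> C)"
  proof (rule H.riesz_factor[OF polydisc_tensor_subspace])
    show "cmod (f w j) \<le> C * hnorm M (\<iota> f)" if "f \<in> polydisc_tensor" for f
      using ell2_coordinate_le[OF polydisc_tensor_eval_in[OF that], of w j] C[OF that] norm_iota[OF that]
      by simp
  qed (use linear in \<open>auto simp: linear_op_def carrier_eq plus_fun_def scaleC_fun_def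
      scaleC_complex_def\<close>)
  then show ?thesis
    by blast
qed

text \<open>Indices off the polydisc get 0, in parallel with \<open>kernel\<close>, so that
  identities between the two families need no side condition.\<close>

definition evaluation :: "(complex ^ 'n) \<times> 'm \<Rightarrow> 'a"
  where "evaluation p = (if fst p \<in> polydisc
    then SOME e. e \<in> hcarrier M \<and> (\<forall>f\<in>polydisc_tensor. f (fst p) (snd p) = hinner M (\<iota> f) e)
    else 0)"

lemma evaluation:
  assumes "w \<in> polydisc"
  shows "evaluation (w, j) \<in> hcarrier M"
    and "f \<in> polydisc_tensor \<Longrightarrow> hinner M (\<iota> f) (evaluation (w, j)) = f w j"
proof -
  have "\<exists>e. e \<in> hcarrier M \<and> (\<forall>f\<in>polydisc_tensor. f w j = hinner M (\<iota> f) e)"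
    using ex_evaluation_vector[OF assms] by blast
  from someI_ex[OF this] show "evaluation (w, j) \<in> hcarrier M"
    and "f \<in> polydisc_tensor \<Longrightarrow> hinner M (\<iota> f) (evaluation (w, j)) = f w j"
    using assms by (simp_all add: evaluation_def)
qed

lemma evaluation_in: "evaluation p \<in> hcarrier M"
  using evaluation(1)[of "fst p" "snd p"] by (cases "fst p \<in> polydisc") (simp_all add: evaluation_def)

text \<open>The last axiom of quasi-free modules is what makes the evaluations separate points.\<close>

sublocale evaluation: total_family M evaluation
proof
  show "evaluation p \<in> hcarrier M" for p
    by (rule evaluation_in)
  fix x
  assume x: "x \<in> hcarrier M" and orth: "\<And>p. hinner M x (evaluation p) = 0"
  have "\<exists>f\<in>polydisc_tensor. hnorm M (x - \<iota> f) < inverse (Suc n)" for n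
  proof -
    have "0 < inverse (real (Suc n))"
      by simp
    then obtain y where "y \<in> \<iota> ` polydisc_tensor" "hnorm M (x - y) < inverse (real (Suc n))"
      using dense_image x unfolding hdense_def carrier_eq by blast
    then show ?thesis
      by blast
  qed
  then obtain f where f: "\<And>n. f n \<in> polydisc_tensor"
    and close: "\<And>n. hnorm M (x - \<iota> (f n)) < inverse (Suc n)"
    by metis
  have lim: "(\<lambda>n. hnorm M (\<iota> (f n) - x)) \<longlonglongrightarrow> 0"
  proof (rule Lim_null_comparison[OF always_eventually LIMSEQ_inverse_real_of_nat], rule allI)
    show "norm (hnorm M (\<iota> (f n) - x)) \<le> inverse (real (Suc n))" for n
      using close[of n] H.norm_minus_commute[OF x iota_in[OF f], of n] x iota_in[OF f, of n] by simp
  qed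
  have "hCauchy M (\<lambda>n. \<iota> (f n))"
    unfolding hCauchy_def
  proof (intro allI impI)
    fix r :: real
    assume "0 < r"
    then obtain N where N: "\<And>n. N \<le> n \<Longrightarrow> hnorm M (\<iota> (f n) - x) < r / 2"
      using order_tendstoD(2)[OF lim, of "r / 2"] unfolding eventually_sequentially by auto
    have "hnorm M (\<iota> (f i) - \<iota> (f j)) < r" if "N \<le> i" "N \<le> j" for i j
      using H.norm_triangle_diff[OF iota_in[OF f] x iota_in[OF f], of i j] N[OF that(1)] N[OF that(2)]
        H.norm_minus_commute[OF x iota_in[OF f], of j] by linarith
    then show "\<exists>N. \<forall>i\<ge>N. \<forall>j\<ge>N. hnorm M (\<iota> (f i) - \<iota> (f j)) < r"
      by blast
  qed
  moreover have "hnorm Q (f i - f j) = hnorm M (\<iota> (f i) - \<iota> (f j))" for i j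
    using norm_iota[OF cvec.subspace_diff[OF polydisc_tensor_subspace f f]] iota_diff[OF f f] by simp
  ultimately have Cauchy: "hCauchy Q f"
    by (simp add: hCauchy_def)
  \<comment> \<open>Each coordinate tends to the pairing of \<open>x\<close> with an evaluation
    vector, which is 0; boundedness of evaluation makes the values Cauchy, and
    \<open>ell2_null\<close> passes to the norm.\<close>
  have "(\<lambda>n. hnorm ell2 (f n w)) \<longlonglongrightarrow> 0" if w: "w \<in> polydisc" for w
  proof (rule ell2_null)
    show "f n w \<in> hcarrier ell2" for n
      by (rule polydisc_tensor_eval_in[OF f])
    show "(\<lambda>n. f n w j) \<longlonglongrightarrow> 0" for j
      using H.ip_tendsto_left[OF iota_in[OF f] x evaluation_in lim, of "(w, j)"] orth[of "(w, j)"]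
      by (simp add: evaluation(2)[OF w f])
    obtain C where C: "\<And>f. f \<in> polydisc_tensor \<Longrightarrow> hnorm ell2 (f w) \<le> C * hnorm Q f"
      using eval_bounded[OF w] by metis
    show "hCauchy ell2 (\<lambda>n. f n w)"
      unfolding hCauchy_def
    proof (intro allI impI)
      fix r :: real
      assume r: "0 < r"
      then have "0 < r / (\<bar>C\<bar> + 1)"
        by simp
      then obtain N where N: "\<And>i j. \<lbrakk>N \<le> i; N \<le> j\<rbrakk> \<Longrightarrow> hnorm Q (f i - f j) < r / (\<bar>C\<bar> + 1)"
        using Cauchy unfolding hCauchy_def by meson
      have "hnorm ell2 (f i w - f j w) < r" if "N \<le> i" "N \<le> j" for i j
      proof -
        have d: "f i - f j \<in> polydisc_tensor"
          by (rule cvec.subspace_diff[OF polydisc_tensor_subspace f f])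
        have "0 \<le> hnorm Q (f i - f j)"
          using norm_iota[OF d] H.norm_nonneg[OF iota_in[OF d]] by simp
        then have "C * hnorm Q (f i - f j) \<le> (\<bar>C\<bar> + 1) * hnorm Q (f i - f j)"
          by (intro mult_right_mono) auto
        also have "\<dots> < r"
          using N[OF that] by (simp add: pos_less_divide_eq mult.commute)
        finally show ?thesis
          using C[OF d] by simp
      qed
      then show "\<exists>N. \<forall>i\<ge>N. \<forall>j\<ge>N. hnorm ell2 (f i w - f j w) < r"
        by blast
    qed
  qed
  then have "(\<lambda>n. hnorm Q (f n)) \<longlonglongrightarrow> 0"
    using null_iff[OF f Cauchy] by blast
  then have "(\<lambda>n. hnorm M (\<iota> (f n) - x) + hnorm M (\<iota> (f n))) \<longlonglongrightarrow> 0 + 0"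
    by (intro tendsto_add lim) (simp add: norm_iota[OF f])
  moreover have "hnorm M x \<le> hnorm M (\<iota> (f n) - x) + hnorm M (\<iota> (f n))" for n
    using H.norm_triangle[of "x - \<iota> (f n)" "\<iota> (f n)"] H.norm_minus_commute[OF x iota_in[OF f], of n]
      x iota_in[OF f, of n] by simp
  ultimately have "hnorm M x \<le> 0 + 0"
    by (intro LIMSEQ_le_const) auto
  then show "x = 0"
    using H.norm_eq_zero[OF x] H.norm_nonneg[OF x] by linarith
qed

text \<open>On images of \<open>\<iota>\<close> this is pointwise multiplication. It extends to
  \<open>M\<close> because the adjoint applied to the evaluation vector, minus
  \<open>cnj (\<phi> w)\<close> times that vector, is orthogonal to all images and hence 0.\<close>

lemma ip_act_evaluation:
  assumes \<phi>: "\<phi> \<in> polydisc_algebra" and x: "x \<in> hcarrier M"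
  shows "hinner M (act \<phi> x) (evaluation p) = \<phi> (fst p) * hinner M x (evaluation p)"
proof (cases "fst p \<in> polydisc")
  case True
  obtain w j where p: "p = (w, j)"
    by (cases p)
  have w: "w \<in> polydisc"
    using True p by simp
  let ?e = "evaluation (w, j)"
  note A = bounded_act[OF \<phi>]
  note adj_in = hadj_in[OF H.hilbert_space_axioms H.hilbert_space_axioms A]
  note ip_adj = ip_hadj_right[OF H.hilbert_space_axioms H.hilbert_space_axioms A]
  have e: "?e \<in> hcarrier M"
    by (rule evaluation_in)
  have "hadj M M (act \<phi>) ?e - cnj (\<phi> w) *\<^sub>C ?e = 0"
  proof (rule iota_orthogonal_zero)
    fix f :: "complex ^ 'n \<Rightarrow> 'm \<Rightarrow> complex"
    assume f: "f \<in> polydisc_tensor"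
    have "hinner M (\<iota> f) (hadj M M (act \<phi>) ?e) = hinner M (\<iota> (\<lambda>z. \<phi> z *\<^sub>C f z)) ?e"
      using ip_adj[OF e iota_in[OF f]] act_pointwise[OF \<phi> f] by simp
    also have "\<dots> = hinner M (\<iota> f) (cnj (\<phi> w) *\<^sub>C ?e)"
      using e iota_in[OF f] evaluation(2)[OF w polydisc_tensor_mult[OF \<phi> f]] evaluation(2)[OF w f]
      by (simp add: H.ip_scale_right scaleC_fun_def scaleC_complex_def)
    finally have "hinner M (\<iota> f) (hadj M M (act \<phi>) ?e - cnj (\<phi> w) *\<^sub>C ?e) = 0"
      using e iota_in[OF f] adj_in[OF e] by (simp add: H.ip_diff_right)
    then show "hinner M (hadj M M (act \<phi>) ?e - cnj (\<phi> w) *\<^sub>C ?e) (\<iota> f) = 0"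
      using H.ip_commute[OF iota_in[OF f], of "hadj M M (act \<phi>) ?e - cnj (\<phi> w) *\<^sub>C ?e"]
        e adj_in[OF e] by simp
  qed (use e adj_in[OF e] in simp)
  then show ?thesis
    using ip_adj[OF e x] e x by (simp add: p H.ip_scale_right)
next
  case False
  then show ?thesis
    using x bounded_op_in[OF bounded_act[OF \<phi>] x] by (simp add: evaluation_def)
qed

end

corollary (in inverse_polynomial_module) positive_of_has_dilation:
  assumes "hilbert_module M act" "has_dilation TYPE('f::complex_vector) TYPE('t::complex_vector) H M act"
  shows "positive_op M (hereditary_op M a (\<lambda>i. act (coord i)))"
  using assms(2) positive_of_dilation[OF assms(1)] unfolding has_dilation_def by blast

section \<open>Positivity yields a dilation\<close>

lemma bounded_op_lincomb:
  assumes "inner_product_space H" "bounded_op H K A" "\<And>x. e x \<in> hcarrier H"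
  shows "A (lincomb e c) = lincomb (\<lambda>x. A (e x)) c"
proof -
  interpret inner_product_space H by fact
  have A0: "A 0 = 0"
    using bounded_op_scale[OF assms(2) zero_in, of 0] by simp
  have "A (\<Sum>x\<in>X. c x *\<^sub>C e x) = (\<Sum>x\<in>X. c x *\<^sub>C A (e x))" for X
    using assms(3)
    by (induction X rule: infinite_finite_induct)
      (simp_all add: A0 bounded_op_add[OF assms(2)] bounded_op_scale[OF assms(2)] sum_in)
  then show ?thesis
    by (simp add: lincomb_def)
qed

locale quasi_free_dilation =
  inverse_polynomial_module H k a + M: quasi_free_module Q M act \<iota>
  for H :: "(complex ^ 'n::{finite,linorder} \<Rightarrow> complex) hspace" and k a
    and Q :: "((complex, 'n) vec \<Rightarrow> 'm::countable \<Rightarrow> complex) hspace"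
    and M :: "'a::complex_vector hspace" and act and \<iota>
begin

definition defect :: "'a \<Rightarrow> 'a"
  where "defect = hereditary_op M a (\<lambda>i. act (coord i))"

lemmas hilbert_M = M.H.hilbert_space_axioms

lemma bounded_coord: "bounded_op M M (act (coord i))"
  by (rule M.bounded_act[OF coord_in_algebra])

lemma bounded_defect: "bounded_op M M defect"
  unfolding defect_def by (rule bounded_hereditary_op[OF hilbert_M bounded_coord])

abbreviation e where "e \<equiv> M.evaluation"

lemma e_outside: "fst p \<notin> polydisc \<Longrightarrow> e p = 0"
  by (simp add: M.evaluation_def)

lemma ip_coord_evaluation:
  assumes "u \<in> hcarrier M"
  shows "hinner M (act (coord i) u) (e p) = fst p $ i * hinner M u (e p)"
proof (cases "fst p \<in> polydisc")
  case True
  then show ?thesis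
    using M.ip_act_evaluation[OF coord_in_algebra assms] polydisc_subset by (auto simp: coord_def)
next
  case False
  then show ?thesis
    using assms bounded_op_in[OF bounded_coord assms] by (simp add: e_outside)
qed

text \<open>\<open>defect\<close> multiplies the Gram entries of the evaluation vectors by the
  polynomial, the inverse of \<open>k\<close>. In product form the identity also holds at indices
  off the polydisc, where both sides vanish.\<close>

lemma kernel_factorization:
  "hinner H (kernel (fst p)) (kernel (fst q)) * hinner M (defect (e p)) (e q) = hinner M (e p) (e q)"
proof (cases "fst p \<in> polydisc \<and> fst q \<in> polydisc")
  case True
  have "hinner M (defect (e p)) (e q) = hereditary_poly a (fst q) (fst p) * hinner M (e p) (e q)"
    unfolding defect_def
    by (rule hereditary_op_eigen[OF hilbert_M bounded_coord])
      (simp_all add: M.evaluation_in ip_coord_evaluation)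
  then show ?thesis
    using hereditary_poly_kernel[of "fst q" "fst p"] True
    by (simp add: mult_ac)
next
  case False
  then have "e p = 0 \<or> e q = 0"
    using e_outside by blast
  moreover have "defect 0 = 0"
    using bounded_op_scale[OF bounded_defect M.H.zero_in, of 0] by simp
  ultimately show ?thesis
    using M.evaluation_in bounded_op_in[OF bounded_defect] by auto
qed

text \<open>Hermitian symmetry comes from \<open>kernel_factorization\<close>: the Gram matrix of
  \<open>M\<close> and \<open>k\<close> are both Hermitian, and \<open>k\<close> can be cancelled on
  the polydisc. Positivity is that of the operator on \<open>lincomb e c\<close>.\<close>

lemma defect_kernel:
  assumes "positive_op M defect"
  shows "positive_kernel (\<lambda>p q. hinner M (defect (e p)) (e q))"
proof
  fix p q
  show "hinner M (defect (e p)) (e q) = cnj (hinner M (defect (e q)) (e p))"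
  proof (cases "fst p \<in> polydisc \<and> fst q \<in> polydisc")
    case True
    then have "hinner H (kernel (fst p)) (kernel (fst q)) \<noteq> 0"
      using hereditary_poly_kernel[of "fst q" "fst p"] by auto
    moreover have "hinner H (kernel (fst p)) (kernel (fst q)) * cnj (hinner M (defect (e q)) (e p))
        = cnj (hinner H (kernel (fst q)) (kernel (fst p)) * hinner M (defect (e q)) (e p))"
      using ip_commute[OF kernel_family_in kernel_family_in, of "fst p" "fst q"] by simp
    moreover have "\<dots> = hinner M (e p) (e q)"
      unfolding kernel_factorization
      using M.H.ip_commute[OF M.evaluation_in M.evaluation_in, of p q] by simp
    ultimately show ?thesis
      using kernel_factorization[of p q] by (metis mult_left_cancel)
  next
    case False
    then have "e p = 0 \<or> e q = 0"
      using e_outside by blast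
    moreover have "defect 0 = 0"
      using bounded_op_scale[OF bounded_defect M.H.zero_in, of 0] by simp
    ultimately show ?thesis
      using M.evaluation_in bounded_op_in[OF bounded_defect] by auto
  qed
next
  fix c :: "(complex, 'n) vec \<times> 'm \<Rightarrow> complex"
  have D_in: "defect (e p) \<in> hcarrier M" for p
    by (rule bounded_op_in[OF bounded_defect M.evaluation_in])
  have "hinner M (defect (lincomb e c)) (lincomb e c) = gram_form (\<lambda>p q. hinner M (defect (e p)) (e q)) c c"
    unfolding bounded_op_lincomb[OF M.H.inner_product_space_axioms bounded_defect M.evaluation_in]
    by (rule M.H.ip_lincomb[OF D_in M.evaluation_in])
  then show "0 \<le> Re (gram_form (\<lambda>p q. hinner M (defect (e p)) (e q)) c c)"
    using assms M.H.lincomb_in[of e c] M.evaluation_in unfolding positive_op_def by metis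
qed

text \<open>
  The kernel \<open>K\<close> of \<open>M\<close> is the product of \<open>k\<close> and \<open>L p q = \<langle>D e p, e q\<rangle>\<close>. With \<open>F\<close> and \<open>T\<close> the spaces
  of \<open>L\<close> and of \<open>k L\<close>, the adjoint of \<open>\<pi>\<close> embeds \<open>M\<close> into \<open>T\<close> along the diagonal.
\<close>

theorem dilation_of_positive:
  assumes "positive_op M defect"
  shows "has_dilation TYPE((complex, 'n) vec \<Rightarrow> 'm \<Rightarrow> complex)
    TYPE((complex, 'n) vec \<Rightarrow> (complex, 'n) vec \<Rightarrow> 'm \<Rightarrow> complex) H M act"
proof -
  obtain F :: "((complex, 'n) vec \<Rightarrow> 'm \<Rightarrow> complex) hspace" and l
    where F: "total_family F l"
      and gram_F: "\<And>p q. hinner F (l p) (l q) = hinner M (defect (e p)) (e q)"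
    by (rule moore_aronszajn[OF defect_kernel[OF assms], where ev = "\<lambda>p f. f (fst p) (snd p)"
          and mk = "\<lambda>\<phi> z i. \<phi> (z, i)"])
      (auto simp: plus_fun_def scaleC_fun_def scaleC_complex_def fun_eq_iff)
  interpret F: total_family F l by fact
  have "positive_kernel (\<lambda>p q. hinner H (kernel (fst p)) (kernel (fst q)) * hinner F (l (snd p)) (l (snd q)))"
    by (intro product_kernel semi_inner_product_space_axioms F.semi_inner_product_space_axioms
        kernel_family_in F.family_in)
  then obtain T :: "((complex, 'n) vec \<Rightarrow> (complex, 'n) vec \<Rightarrow> 'm \<Rightarrow> complex) hspace" and E
    where "total_family T E"
      and gram_T: "\<And>p q. hinner T (E p) (E q)
        = hinner H (kernel (fst p)) (kernel (fst q)) * hinner F (l (snd p)) (l (snd q))"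
      and dense_T: "hdense T (cvec.span (range E))"
    by (rule moore_aronszajn[where ev = "\<lambda>p f. f (fst p) (fst (snd p)) (snd (snd p))"
          and mk = "\<lambda>\<phi> z w i. \<phi> (z, w, i)"])
      (auto simp: plus_fun_def scaleC_fun_def scaleC_complex_def fun_eq_iff)
  interpret T: total_family T E by fact
  interpret tensor: tensor_family H kernel F l T E
    by unfold_locales (fact gram_T dense_T)+
  note hilbert = hilbert_space_axioms F.hilbert_space_axioms T.hilbert_space_axioms

  have "\<exists>AT. bounded_op T T AT
      \<and> (\<forall>h\<in>hcarrier H. \<forall>f\<in>hcarrier F. AT (tensor.tensor h f) = tensor.tensor (\<phi> * h) f)
      \<and> (\<forall>u\<in>hcarrier T. \<forall>z p. hinner T (AT u) (E (z, p)) = \<phi> z * hinner T u (E (z, p)))"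
    if \<phi>: "\<phi> \<in> polydisc_algebra" for \<phi>
  proof -
    obtain AT where AT: "bounded_op T T AT"
      "\<And>h f. \<lbrakk>h \<in> hcarrier H; f \<in> hcarrier F\<rbrakk> \<Longrightarrow> AT (tensor.tensor h f) = tensor.tensor (\<phi> * h) f"
      "\<And>u z p. u \<in> hcarrier T
        \<Longrightarrow> hinner T (AT u) (E (z, p)) = hinner T u (tensor.tensor (hadj H H ((*) \<phi>) (kernel z)) (l p))"
      using tensor.tensor_operator[OF bounded_act[OF \<phi>]] by metis
    \<comment> \<open>Kernel functions are eigenvectors of the adjoint, so the action of
      \<open>\<phi>\<close> multiplies the entry at \<open>(z, p)\<close> by
      \<open>\<phi> z\<close>.\<close>
    have "hadj H H ((*) \<phi>) (kernel z) = cnj (\<phi> z) *\<^sub>C kernel z" for z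
      using bounded_act[OF \<phi>] kernel_family_in ip_act_kernel[OF _ \<phi>]
      by (intro hadj_eigen[OF hilbert(1)]) auto
    then have "tensor.tensor (hadj H H ((*) \<phi>) (kernel z)) (l p) = cnj (\<phi> z) *\<^sub>C E (z, p)" for z p
      using bounded_op_scale[OF tensor.bounded_tensor_left[OF F.family_in] kernel_family_in]
      by (simp add: tensor.tensor_family_eq)
    then show ?thesis
      using AT by (intro exI[of _ AT]) (simp add: T.ip_scale_right)
  qed
  then obtain actT where actT: "\<And>\<phi>. \<phi> \<in> polydisc_algebra \<Longrightarrow> bounded_op T T (actT \<phi>)"
    and actT_tensor: "\<And>\<phi> h f. \<lbrakk>\<phi> \<in> polydisc_algebra; h \<in> hcarrier H; f \<in> hcarrier F\<rbrakk>
      \<Longrightarrow> actT \<phi> (tensor.tensor h f) = tensor.tensor (\<phi> * h) f"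
    and ip_actT: "\<And>\<phi> u z p. \<lbrakk>\<phi> \<in> polydisc_algebra; u \<in> hcarrier T\<rbrakk>
      \<Longrightarrow> hinner T (actT \<phi> u) (E (z, p)) = \<phi> z * hinner T u (E (z, p))"
    by metis

  \<comment> \<open>The diagonal: the first component of the index repeats the point contained in
    \<open>p\<close>. There the entries of \<open>T\<close> become those of
    \<open>M\<close>.\<close>
  define g where "g p = E (fst p, p)" for p
  have gram_g: "hinner T (g p) (g q) = hinner M (e p) (e q)" for p q
    by (simp add: g_def gram_T gram_F kernel_factorization)
  have g_in: "g p \<in> hcarrier T" for p
    by (simp add: g_def)
  \<comment> \<open>The map \<open>e p \<mapsto> g p\<close> preserves norms of combinations, hence
    the constant 1; \<open>\<pi>\<close> is its adjoint.\<close>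
  have "\<exists>\<pi>. bounded_op T M \<pi> \<and> (\<forall>u\<in>hcarrier T. \<forall>p. hinner M (\<pi> u) (e p) = hinner T u (g p))"
  proof (rule M.evaluation.coefficient_operator[OF hilbert(3) g_in, of 1])
    show "hnorm T (lincomb g c) \<le> 1 * hnorm M (lincomb e c)" for c
      using norm_lincomb_eq[where e = g and g = e and c = c, OF T.semi_inner_product_space_axioms M.H.semi_inner_product_space_axioms
          g_in M.evaluation_in gram_g] by simp
  qed simp
  then obtain \<pi> where \<pi>: "bounded_op T M \<pi>"
    and ip_\<pi>: "\<And>u p. u \<in> hcarrier T \<Longrightarrow> hinner M (\<pi> u) (e p) = hinner T u (g p)"
    by blast
  have "module_map T actT M act \<pi>"
    unfolding module_map_def
  proof (intro conjI \<pi> ballI)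
    fix \<phi> :: "(complex, 'n) vec \<Rightarrow> complex" and u
    assume \<phi>: "\<phi> \<in> polydisc_algebra" and u: "u \<in> hcarrier T"
    show "\<pi> (actT \<phi> u) = act \<phi> (\<pi> u)"
    proof (rule M.evaluation.eqI)
      show "\<pi> (actT \<phi> u) \<in> hcarrier M" "act \<phi> (\<pi> u) \<in> hcarrier M"
        using bounded_op_in[OF \<pi>] bounded_op_in[OF actT[OF \<phi>]] bounded_op_in[OF M.bounded_act[OF \<phi>]] u
        by blast+
      show "hinner M (\<pi> (actT \<phi> u)) (e p) = hinner M (act \<phi> (\<pi> u)) (e p)" for p
        using u by (simp add: ip_\<pi> M.ip_act_evaluation[OF \<phi>] bounded_op_in[OF \<pi>]
            bounded_op_in[OF actT[OF \<phi>]] g_def ip_actT[OF \<phi>])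
    qed
  qed
  moreover have "coisometry T M \<pi>"
    unfolding coisometry_def
  proof (intro conjI \<pi> ballI)
    fix y
    assume y: "y \<in> hcarrier M"
    \<comment> \<open>\<open>\<pi>\<close> undoes the isometry on the family, so the coisometry
      equation reduces to a comparison of entries against \<open>e p\<close>.\<close>
    have \<pi>_g: "\<pi> (g p) = e p" for p
      by (rule M.evaluation.eqI)
        (simp_all add: bounded_op_in[OF \<pi>] g_in M.evaluation_in ip_\<pi> gram_g)
    have adj_in: "hadj T M \<pi> y \<in> hcarrier T"
      by (rule hadj_in[OF hilbert(3) hilbert_M \<pi> y])
    show "\<pi> (hadj T M \<pi> y) = y"
    proof (rule M.evaluation.eqI)
      show "hinner M (\<pi> (hadj T M \<pi> y)) (e p) = hinner M y (e p)" for p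
        using ip_hadj_left[OF hilbert(3) hilbert_M \<pi> y g_in] by (simp add: ip_\<pi> adj_in \<pi>_g)
    qed (use y adj_in bounded_op_in[OF \<pi>] in auto)
  qed
  moreover have "tensor_action H F T tensor.tensor actT"
    unfolding tensor_action_def using actT actT_tensor by blast
  ultimately show ?thesis
    unfolding has_dilation_def is_dilation_def using tensor.tensor_product by blast
qed

end

text \<open>The equivalence is asserted for the function types in which the dilation is built; the
  second conjunct, with free types \<open>'f\<close> and \<open>'t\<close>, adds that a dilation
  living in any types forces positivity.\<close>

theorem theorem3p5:
  fixes Q :: "(complex ^ 'n::{finite,linorder} \<Rightarrow> 'm::countable \<Rightarrow> complex) hspace"
    and M :: "'a::complex_vector hspace"
    and act :: "((complex, 'n) vec \<Rightarrow> complex) \<Rightarrow> 'a \<Rightarrow> 'a"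
    and \<iota> :: "((complex, 'n) vec \<Rightarrow> 'm \<Rightarrow> complex) \<Rightarrow> 'a"
    and H :: "((complex, 'n) vec \<Rightarrow> complex) hspace"
    and k :: "(complex, 'n) vec \<Rightarrow> (complex, 'n) vec \<Rightarrow> complex"
    and a :: "('n \<Rightarrow> nat) \<Rightarrow> ('n \<Rightarrow> nat) \<Rightarrow> complex"
  assumes "quasi_free_module Q M act \<iota>"
    and "rk_hilbert_module H k"
    and "finite {(p, q). a p q \<noteq> 0}"
    and "\<And>z w. \<lbrakk>z \<in> polydisc; w \<in> polydisc\<rbrakk>
           \<Longrightarrow> k z w \<noteq> 0 \<and> 1 / k z w = hereditary_poly a z w"
  shows "(has_dilation TYPE((complex, 'n) vec \<Rightarrow> 'm \<Rightarrow> complex)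
            TYPE((complex, 'n) vec \<Rightarrow> (complex, 'n) vec \<Rightarrow> 'm \<Rightarrow> complex) H M act
          \<longleftrightarrow> positive_op M (hereditary_op M a (\<lambda>i. act (coord i)))) \<and>
         (has_dilation TYPE('f::complex_vector) TYPE('t::complex_vector) H M act
          \<longrightarrow> positive_op M (hereditary_op M a (\<lambda>i. act (coord i))))"
proof -
  interpret quasi_free_dilation H k a Q M act \<iota>
    using assms
    by (intro quasi_free_dilation.intro inverse_polynomial_module.intro
        inverse_polynomial_module_axioms.intro)
  show ?thesis
    by (intro conjI iffI impI)
      (erule positive_of_has_dilation[OF M.hilbert_module_axioms] dilation_of_positive[unfolded defect_def])+
qed

end
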